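(* Let $r \ge 3$ be an integer and let $X = X_{n,p}^{K_r}$ denote the number of $r$-vertex cliques in the random graph $G_{n,p}$. Then, for every fixed positive constant $\delta$ and all $p = p(n)$ satisfying $n^{-1}(\log n)^{\frac{1}{r-2}} \ll p^{\frac{r-1}{2}} \ll 1$, $$\lim_{n\to\infty} \frac{-\log \mathbb{P}\big(X \ge (1+\delta)\mathbb{E}[X]\big)}{n^2p^{r-1}\log(1/p)} = \begin{cases} \delta^{2/r}/2 & \text{if } np^{r-1}\to 0,\\ \varphi_r(\delta,c) & \text{if } np^{r-1}\to c\in(0,\infty),\\ \min\{\delta^{2/r}/2,\ \delta/r\} & \text{if } np^{r-1}\to\infty.\end{cases}$$
   Context: $G_{n,p}$ is the binomial random graph on the vertex set $\{1,\dots,n\}$, in which each pair is an edge independently with probability $p$. For $\delta,c>0$ and $x\in[0,1]$ define $$\psi_r(\delta,c,x) = \frac{\big(\delta(1-x)\big)^{2/r}}{2} + \frac{\lfloor x\delta c/r\rfloor + \{x\delta c/r\}^{\frac{1}{r-1}}}{c},\qquad \varphi_r(\delta,c)=\min_{x\in[0,1]}\psi_r(\delta,c,x),$$ where $\{a\}=a-\lfloor a\rfloor$ denotes the fractional part of $a$. For functions of $n$, $f\ll g$ means $f(n)/g(n)\to 0$ as $n\to\infty$. Logarithms are natural. *)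

theory Defs
  imports "HOL-Probability.Probability" "HOL-Library.Landau_Symbols"
begin

definition pairs :: "'a set \<Rightarrow> 'a set set" where
  "pairs V = {e. e \<subseteq> V \<and> card e = 2}"

text \<open>A graph on the vertex set \<open>{1..n}\<close> is represented by its set of edges, a subset of
  \<open>pairs {1..n}\<close>.\<close>

definition random_graph :: "nat \<Rightarrow> real \<Rightarrow> nat set set pmf" where
  "random_graph n p =
     map_pmf (\<lambda>f. {e \<in> pairs {1..n}. f e}) (Pi_pmf (pairs {1..n}) False (\<lambda>_. bernoulli_pmf p))"

definition cliques :: "nat \<Rightarrow> nat \<Rightarrow> nat set set \<Rightarrow> nat set set" where
  "cliques n r E = {S. S \<subseteq> {1..n} \<and> card S = r \<and> pairs S \<subseteq> E}"

definition num_cliques :: "nat \<Rightarrow> nat \<Rightarrow> nat set set \<Rightarrow> real" where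
  "num_cliques n r E = real (card (cliques n r E))"

definition upper_tail_prob :: "nat \<Rightarrow> nat \<Rightarrow> real \<Rightarrow> real \<Rightarrow> real" where
  "upper_tail_prob r n p \<delta> =
     measure_pmf.prob (random_graph n p)
       {E. num_cliques n r E \<ge>
             (1 + \<delta>) * measure_pmf.expectation (random_graph n p) (num_cliques n r)}"

definition log_tail_ratio :: "nat \<Rightarrow> real \<Rightarrow> (nat \<Rightarrow> real) \<Rightarrow> nat \<Rightarrow> real" where
  "log_tail_ratio r \<delta> p n =
     - ln (upper_tail_prob r n (p n) \<delta>) / (real n ^ 2 * p n ^ (r - 1) * ln (1 / p n))"

definition psi :: "nat \<Rightarrow> real \<Rightarrow> real \<Rightarrow> real \<Rightarrow> real" where
  "psi r \<delta> c x =
     (\<delta> * (1 - x)) powr (2 / real r) / 2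
     + (of_int \<lfloor>x * \<delta> * c / real r\<rfloor> + frac (x * \<delta> * c / real r) powr (1 / (real r - 1))) / c"

text \<open>The infimum below is a minimum for the relevant parameters, see \<open>phi_is_minimum\<close>.\<close>

definition phi :: "nat \<Rightarrow> real \<Rightarrow> real \<Rightarrow> real" where
  "phi r \<delta> c = (INF x\<in>{0..1}. psi r \<delta> c x)"

lemma continuous_on_floor_plus_frac_powr:
  fixes a :: real
  assumes "a > 0"
  shows "continuous_on {0..real N} (\<lambda>t. of_int \<lfloor>t\<rfloor> + frac t powr a)"
proof -
  let ?h = "\<lambda>t::real. of_int \<lfloor>t\<rfloor> + frac t powr a"
  have *: "continuous_on {real k..real k + 1} ?h" for k
  proof -
    have "continuous_on {real k..real k + 1} (\<lambda>t. real k + (t - real k) powr a)"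
      using assms by (intro continuous_intros continuous_on_powr') auto
    moreover have "?h t = real k + (t - real k) powr a" if "t \<in> {real k..real k + 1}" for t
    proof (cases "t = real k + 1")
      case True
      then have "t = of_int (int k + 1)" by simp
      then have "\<lfloor>t\<rfloor> = int k + 1" by linarith
      with True show ?thesis by (simp add: frac_def)
    next
      case False
      with that have "\<lfloor>t\<rfloor> = int k" by (auto simp: floor_eq_iff)
      then show ?thesis by (simp add: frac_def)
    qed
    ultimately show ?thesis
      using continuous_on_cong[of "{real k..real k + 1}" _ ?h "\<lambda>t. real k + (t - real k) powr a"]
      by blast
  qed
  have "continuous_on (\<Union>k\<in>{..N}. {real k..real k + 1}) ?h"
    using * by (intro continuous_on_closed_Union) auto
  moreover have "{0..real N} \<subseteq> (\<Union>k\<in>{..N}. {real k..real k + 1})"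
  proof
    fix t assume t: "t \<in> {0..real N}"
    have "nat \<lfloor>t\<rfloor> \<le> N" "real (nat \<lfloor>t\<rfloor>) \<le> t" "t \<le> real (nat \<lfloor>t\<rfloor>) + 1"
      using t by (auto simp: nat_le_iff floor_le_iff)
    then show "t \<in> (\<Union>k\<in>{..N}. {real k..real k + 1})" by auto
  qed
  ultimately show ?thesis by (rule continuous_on_subset)
qed

lemma phi_is_minimum:
  assumes "r \<ge> 3" "\<delta> > 0" "c > 0"
  shows "\<exists>x\<in>{0..1}. phi r \<delta> c = psi r \<delta> c x \<and> (\<forall>y\<in>{0..1}. psi r \<delta> c x \<le> psi r \<delta> c y)"
proof -
  define g where "g = (\<lambda>x. x * \<delta> * c / real r)"
  obtain N :: nat where N: "\<delta> * c / real r \<le> real N" using real_arch_simple by blast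
  have "g ` {0..1} \<subseteq> {0..real N}"
  proof safe
    fix x :: real assume x: "x \<in> {0..1}"
    have "0 \<le> \<delta> * c / real r" using assms by simp
    then have "x * (\<delta> * c / real r) \<le> 1 * (\<delta> * c / real r)" "0 \<le> x * (\<delta> * c / real r)"
      using x by (intro mult_right_mono mult_nonneg_nonneg; simp)+
    with N show "g x \<in> {0..real N}" by (simp add: g_def mult.assoc)
  qed
  moreover have "continuous_on {0..1} g"
    unfolding g_def using assms by (intro continuous_intros) auto
  ultimately have "continuous_on {0..1} (\<lambda>x. of_int \<lfloor>g x\<rfloor> + frac (g x) powr (1 / (real r - 1)))"
    using assms by (intro continuous_on_compose2[OF continuous_on_floor_plus_frac_powr[where N = N], where f = g]) auto
  then have "continuous_on {0..1}
      (\<lambda>x. (of_int \<lfloor>g x\<rfloor> + frac (g x) powr (1 / (real r - 1))) / c)"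
    using assms by (intro continuous_on_divide continuous_on_const) auto
  moreover have "continuous_on {0..1} (\<lambda>x. (\<delta> * (1 - x)) powr (2 / real r) / 2)"
    using assms by (intro continuous_intros continuous_on_powr') auto
  ultimately have "continuous_on {0..1} (psi r \<delta> c)"
    unfolding psi_def[abs_def] g_def by (rule continuous_on_add[rotated])
  then obtain x where x: "x \<in> {0..1}" "\<forall>y\<in>{0..1}. psi r \<delta> c x \<le> psi r \<delta> c y"
    using continuous_attains_inf[of "{0..1::real}" "psi r \<delta> c"] by auto
  then have "phi r \<delta> c = psi r \<delta> c x"
    unfolding phi_def by (intro cInf_eq_minimum) auto
  with x show ?thesis by blast
qed

end

(*
  High moments and entropic stability (Harel, Mousset, Samotij). Write E_G for the expectation of the
  number X of r-cliques conditioned on all edges of G being present. Call G a core if E_G exceeds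
  (1 + d) E[X], G has O(n^2 p^(r-1) log(1/p)) edges, and deleting any single edge lowers E_G
  noticeably. A graph of that size without a core inside has E_G at most (1 + d') E[X], so
  E[X^l; no core] is at most ((1 + d') E[X])^l, and Markov's inequality makes the event
  "X >= (1 + delta) E[X] and no core" negligible. It remains to bound the probability that a core
  appears. Hoelder's inequality shows that every edge of a core joins two vertices of degree almost
  n p^((r-1)/2) or touches a vertex of almost linear degree. So there are only p^(-o(m)) cores with
  m edges, and the excess of E_G comes from r-cliques among the former vertices and r-vertex stars
  at the latter; minimising the number of edges gives the rate. Conversely, planting an optimal
  clique and optimal hubs gives a matching lower bound on the probability.
*)
theory Submission
  imports Defs "HOL-Real_Asymp.Real_Asymp"
begin

section \<open>Conditional expectations and the high moment argument\<close>

text \<open>The obstacle is entropy: the union bound over cores works only if cores with m edges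
  number exp(o(m log(1/p))), while naming a vertex alone costs a factor n. Write s = n p^((r-1)/2),
  so that E[X] is about s^r / r! and s^2 is the natural unit of edges. A core may have order s^2
  log(1/p) edges, so an edge can only be asked to contribute order s^(r-2) / log(1/p). If its ends
  have at most D common neighbours, these span at most D^(r-2) cliques with it, too few when D is a
  small multiple of s / log(1/p)^(1/(r-2)). Hence the vertices of a core have degree at least D or
  neighbour a hub, at most 2m/D of them have to be named, and this is affordable when (log n) / D is
  small against log(1/p). That is the origin of (log n)^(1/(r-2)) in the lower bound on p. Cliques
  through a vertex that is not a common neighbour are handled with Hoelder exponent r - 1 at every
  pair: each vertex of K_r lies in r - 1 pairs, so the exponents fit, and the sum of the (r-1)-th
  powers of the edge weights is of order s^2 plus the number of edges.\<close>

definition rsets :: "nat \<Rightarrow> nat \<Rightarrow> nat set set" where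
  "rsets n r = {S. S \<subseteq> {1..n} \<and> card S = r}"

text \<open>This is E_G of the overview with \<open>U\<close> as the graph: an \<open>r\<close>-set
  is a clique with probability \<open>p\<close> to the number of its pairs not yet present. For
  \<open>U = {}\<close> it is the mean of the clique count.\<close>

definition cexp :: "nat \<Rightarrow> nat \<Rightarrow> real \<Rightarrow> nat set set \<Rightarrow> real" where
  "cexp n r p U = (\<Sum>S\<in>rsets n r. p ^ card (pairs S - U))"

lemma finite_pairs [simp]: "finite V \<Longrightarrow> finite (pairs V)"
  unfolding pairs_def by simp

lemma card_pairs: "finite V \<Longrightarrow> card (pairs V) = card V choose 2"
  unfolding pairs_def by (rule n_subsets)

lemma pairs_mono: "A \<subseteq> B \<Longrightarrow> pairs A \<subseteq> pairs B"
  unfolding pairs_def by auto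

lemma finite_rsets [simp]: "finite (rsets n r)"
  unfolding rsets_def by simp

lemma card_rsets: "card (rsets n r) = n choose r"
  unfolding rsets_def using n_subsets[of "{1..n}" r] by simp

lemma rsetsD: "S \<in> rsets n r \<Longrightarrow> finite S" "S \<in> rsets n r \<Longrightarrow> card S = r"
  "S \<in> rsets n r \<Longrightarrow> S \<subseteq> {1..n}" "S \<in> rsets n r \<Longrightarrow> pairs S \<subseteq> pairs {1..n}"
  unfolding rsets_def by (auto intro: finite_subset pairs_mono dest: pairs_mono)

lemma card_pairs_rsets: "S \<in> rsets n r \<Longrightarrow> card (pairs S) = r choose 2"
  by (simp add: card_pairs rsetsD)

lemma cexp_empty: "cexp n r p {} = real (n choose r) * p ^ (r choose 2)"
  by (simp add: cexp_def card_pairs_rsets card_rsets)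

lemma num_cliques_eq:
  "num_cliques n r E = (\<Sum>S\<in>rsets n r. indicator {E. pairs S \<subseteq> E} E)"
proof -
  have "cliques n r E = rsets n r \<inter> {S. pairs S \<subseteq> E}"
    by (auto simp: cliques_def rsets_def)
  then have "num_cliques n r E = (\<Sum>S\<in>rsets n r. indicator {S. pairs S \<subseteq> E} S)"
    by (simp add: num_cliques_def indicator_def)
  then show ?thesis by (simp add: indicator_def)
qed

lemma num_cliques_nonneg: "0 \<le> num_cliques n r E"
  by (simp add: num_cliques_def)

lemma num_cliques_le: "num_cliques n r E \<le> real (n choose r)"
proof -
  have "cliques n r E \<subseteq> rsets n r" by (auto simp: cliques_def rsets_def)
  then show ?thesis
    by (simp add: num_cliques_def flip: card_rsets) (simp add: card_mono)
qed

lemma set_pmf_random_graph: "set_pmf (random_graph n p) \<subseteq> Pow (pairs {1..n})"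
  unfolding random_graph_def by auto

lemma integrable_random_graph [simp]:
  "integrable (measure_pmf (random_graph n p)) (f :: _ \<Rightarrow> real)"
  by (rule integrable_measure_pmf_finite[OF finite_subset[OF set_pmf_random_graph]]) simp

lemma prob_superset:
  assumes "A \<subseteq> pairs {1..n}" "0 \<le> p" "p \<le> 1"
  shows "measure_pmf.prob (random_graph n p) {E. A \<subseteq> E} = p ^ card A"
proof -
  let ?B = "\<lambda>e. if e \<in> A then {True} else UNIV"
  let ?M = "Pi_pmf (pairs {1..n}) False (\<lambda>_. bernoulli_pmf p)"
  have "measure_pmf.prob (random_graph n p) {E. A \<subseteq> E}
      = measure_pmf.prob ?M {f. A \<subseteq> {e \<in> pairs {1..n}. f e}}"
    by (simp add: random_graph_def vimage_def)
  also have "{f. A \<subseteq> {e \<in> pairs {1..n}. f e}} = Pi (pairs {1..n}) ?B"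
    using assms(1) by (force simp: Pi_def)
  also have "measure_pmf.prob ?M \<dots> = (\<Prod>e\<in>pairs {1..n}. measure_pmf.prob (bernoulli_pmf p) (?B e))"
    by (intro measure_Pi_pmf_Pi) simp
  also have "\<dots> = (\<Prod>e\<in>pairs {1..n}. if e \<in> A then p else 1)"
    using assms by (intro prod.cong) (auto simp: measure_pmf_single)
  also have "\<dots> = (\<Prod>e\<in>A. p)"
    using assms by (subst prod.inter_restrict[symmetric]) (auto simp: Int_absorb1)
  finally show ?thesis by simp
qed

lemma expectation_num_cliques_superset:
  assumes "U \<subseteq> pairs {1..n}" "0 \<le> p" "p \<le> 1"
  shows "measure_pmf.expectation (random_graph n p) (\<lambda>E. indicator {E. U \<subseteq> E} E * num_cliques n r E)
    = p ^ card U * cexp n r p U"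
proof -
  have "measure_pmf.expectation (random_graph n p) (\<lambda>E. indicator {E. U \<subseteq> E} E * num_cliques n r E)
    = measure_pmf.expectation (random_graph n p) (\<lambda>E. \<Sum>S\<in>rsets n r. indicator {E. U \<union> pairs S \<subseteq> E} E)"
    by (simp add: num_cliques_eq sum_distrib_left indicator_def if_distrib cong: if_cong)
       (rule Bochner_Integration.integral_cong, auto intro!: sum.cong)
  also have "\<dots> = (\<Sum>S\<in>rsets n r. measure_pmf.prob (random_graph n p) {E. U \<union> pairs S \<subseteq> E})"
    by (subst Bochner_Integration.integral_sum) auto
  also have "\<dots> = (\<Sum>S\<in>rsets n r. p ^ card (U \<union> pairs S))"
    using assms by (intro sum.cong refl prob_superset Un_least rsetsD(4))
  also have "\<dots> = (\<Sum>S\<in>rsets n r. p ^ card U * p ^ card (pairs S - U))"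
  proof (intro sum.cong refl)
    fix S assume S: "S \<in> rsets n r"
    have "finite U" using assms(1) finite_subset by fastforce
    then have "card (U \<union> pairs S) = card U + card (pairs S - U)"
      using S rsetsD by (subst Un_Diff_cancel[symmetric], subst card_Un_disjoint) auto
    then show "p ^ card (U \<union> pairs S) = p ^ card U * p ^ card (pairs S - U)"
      by (simp add: power_add)
  qed
  finally show ?thesis by (simp add: cexp_def sum_distrib_left)
qed

lemma expectation_num_cliques:
  assumes "0 \<le> p" "p \<le> 1"
  shows "measure_pmf.expectation (random_graph n p) (num_cliques n r) = cexp n r p {}"
  using expectation_num_cliques_superset[of "{}" n p r] assms by simp

text \<open>When \<open>G\<close> is present the count is below \<open>t\<close>, or else at most
  the trivial \<open>n choose r\<close>; taking expectations gives the bound. The crude factor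
  \<open>n choose r\<close> is harmless because it also occurs in the mean and cancels
  there.\<close>

lemma prob_ge_of_planted:
  assumes "G \<subseteq> pairs {1..n}" "0 \<le> p" "p \<le> 1" "0 \<le> t"
  shows "p ^ card G * (cexp n r p G - t)
    \<le> real (n choose r) * measure_pmf.prob (random_graph n p) {E. num_cliques n r E \<ge> t}"
proof -
  let ?R = "random_graph n p"
  have "p ^ card G * cexp n r p G = measure_pmf.expectation ?R (\<lambda>E. indicator {E. G \<subseteq> E} E * num_cliques n r E)"
    using expectation_num_cliques_superset assms by simp
  also have "\<dots> \<le> measure_pmf.expectation ?R
      (\<lambda>E. t * indicator {E. G \<subseteq> E} E + real (n choose r) * indicator {E. num_cliques n r E \<ge> t} E)"
    using assms(4) by (intro integral_mono) (auto simp: indicator_def num_cliques_le intro: add_increasing)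
  also have "\<dots> = t * p ^ card G + real (n choose r) * measure_pmf.prob ?R {E. num_cliques n r E \<ge> t}"
    using prob_superset assms by simp
  finally show ?thesis by (simp add: algebra_simps)
qed

text \<open>Induction on \<open>l\<close> for all revealed edge sets \<open>U\<close>. One factor of
  the count is written as a sum over \<open>r\<close>-sets, each of which adds its pairs to
  \<open>U\<close>; summing \<open>p ^ card (U \<union> pairs S)\<close> turns that factor into
  \<open>cexp n r p U\<close>. \<open>N\<close> is the budget for revealed edges, at most
  \<open>r choose 2\<close> per factor.\<close>

lemma coreless_moment_le:
  fixes \<C> :: "nat set set set" and p lam :: real
  defines "Z \<equiv> (\<lambda>E. indicator {E. \<forall>C\<in>\<C>. \<not> C \<subseteq> E} E :: real)"
  assumes p: "0 \<le> p" "p \<le> 1" and "0 \<le> lam"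
    and lam: "\<And>U. \<lbrakk>U \<subseteq> pairs {1..n}; card U \<le> N; \<forall>C\<in>\<C>. \<not> C \<subseteq> U\<rbrakk> \<Longrightarrow> cexp n r p U \<le> lam"
    and "U \<subseteq> pairs {1..n}" "card U + (r choose 2) * l \<le> N"
  shows "measure_pmf.expectation (random_graph n p)
      (\<lambda>E. indicator {E. U \<subseteq> E} E * Z E * num_cliques n r E ^ l) \<le> p ^ card U * lam ^ l"
  using assms(6,7)
proof (induction l arbitrary: U)
  case 0
  have "measure_pmf.expectation (random_graph n p) (\<lambda>E. indicator {E. U \<subseteq> E} E * Z E)
    \<le> measure_pmf.expectation (random_graph n p) (\<lambda>E. indicator {E. U \<subseteq> E} E)"
    by (intro integral_mono) (auto simp: Z_def indicator_def)
  also have "\<dots> = p ^ card U" using prob_superset[OF 0(1) p] by simp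
  finally show ?case by simp
next
  case (Suc l)
  let ?R = "random_graph n p"
  let ?Ex = "measure_pmf.expectation ?R"
  show ?case
  proof (cases "\<forall>C\<in>\<C>. \<not> C \<subseteq> U")
    \<comment> \<open>Once \<open>U\<close> contains a core, \<open>Z\<close> vanishes wherever
      \<open>U\<close> is present, so the bound \<open>lam\<close> is only ever asked of coreless
      \<open>U\<close>.\<close>
    case False
    then have "(\<lambda>E. indicator {E. U \<subseteq> E} E * Z E * num_cliques n r E ^ Suc l) = (\<lambda>_. 0)"
      by (intro ext) (fastforce simp: Z_def indicator_def)
    then show ?thesis using p \<open>0 \<le> lam\<close> by simp
  next
    case True
    have fU: "finite U" using Suc.prems finite_subset by fastforce
    have cU: "card (U \<union> pairs S) = card U + card (pairs S - U)" if "S \<in> rsets n r" for S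
      using that rsetsD fU by (subst Un_Diff_cancel[symmetric], subst card_Un_disjoint) auto
    have "?Ex (\<lambda>E. indicator {E. U \<subseteq> E} E * Z E * num_cliques n r E ^ Suc l)
      = ?Ex (\<lambda>E. \<Sum>S\<in>rsets n r. indicator {E. U \<union> pairs S \<subseteq> E} E * Z E * num_cliques n r E ^ l)"
    proof (rule Bochner_Integration.integral_cong[OF refl])
      fix E
      have "indicator {E. U \<subseteq> E} E * Z E * num_cliques n r E ^ Suc l
        = (indicator {E. U \<subseteq> E} E * Z E * num_cliques n r E ^ l) * (\<Sum>S\<in>rsets n r. indicator {E. pairs S \<subseteq> E} E)"
        unfolding num_cliques_eq[symmetric] by (simp only: power_Suc mult_ac)
      also have "\<dots> = (\<Sum>S\<in>rsets n r. (indicator {E. U \<subseteq> E} E * Z E * num_cliques n r E ^ l) * indicator {E. pairs S \<subseteq> E} E)"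
        by (rule sum_distrib_left)
      also have "\<dots> = (\<Sum>S\<in>rsets n r. indicator {E. U \<union> pairs S \<subseteq> E} E * Z E * num_cliques n r E ^ l)"
        by (intro sum.cong) (auto simp: indicator_def)
      finally show "indicator {E. U \<subseteq> E} E * Z E * num_cliques n r E ^ Suc l =
        (\<Sum>S\<in>rsets n r. indicator {E. U \<union> pairs S \<subseteq> E} E * Z E * num_cliques n r E ^ l)" .
    qed
    also have "\<dots> = (\<Sum>S\<in>rsets n r. ?Ex (\<lambda>E. indicator {E. U \<union> pairs S \<subseteq> E} E * Z E * num_cliques n r E ^ l))"
      by (rule Bochner_Integration.integral_sum) simp
    also have "\<dots> \<le> (\<Sum>S\<in>rsets n r. p ^ card (U \<union> pairs S) * lam ^ l)"
    proof (intro sum_mono Suc.IH)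
      fix S assume S: "S \<in> rsets n r"
      show "U \<union> pairs S \<subseteq> pairs {1..n}" using Suc.prems S rsetsD(4) by blast
      have "card (U \<union> pairs S) \<le> card U + (r choose 2)"
        using card_Un_le[of U "pairs S"] card_pairs_rsets[OF S] by simp
      then show "card (U \<union> pairs S) + (r choose 2) * l \<le> N" using Suc.prems by simp
    qed
    also have "\<dots> = p ^ card U * lam ^ l * cexp n r p U"
      by (simp add: cexp_def sum_distrib_left cU power_add algebra_simps)
    also have "\<dots> \<le> p ^ card U * lam ^ l * lam"
      using p \<open>0 \<le> lam\<close> Suc.prems True by (intro mult_left_mono lam) auto
    finally show ?thesis by (simp add: algebra_simps)
  qed
qed

lemma prob_superset_family_le:
  assumes "0 \<le> p" "p \<le> 1" "finite \<C>" "\<And>C. C \<in> \<C> \<Longrightarrow> C \<subseteq> pairs {1..n}"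
  shows "measure_pmf.prob (random_graph n p) {E. \<exists>C\<in>\<C>. C \<subseteq> E} \<le> (\<Sum>C\<in>\<C>. p ^ card C)"
proof -
  have "{E. \<exists>C\<in>\<C>. C \<subseteq> E} = (\<Union>C\<in>\<C>. {E. C \<subseteq> E})" by auto
  then have "measure_pmf.prob (random_graph n p) {E. \<exists>C\<in>\<C>. C \<subseteq> E}
    \<le> (\<Sum>C\<in>\<C>. measure_pmf.prob (random_graph n p) {E. C \<subseteq> E})"
    using assms(3) by (simp add: measure_pmf.finite_measure_subadditive_finite)
  also have "\<dots> = (\<Sum>C\<in>\<C>. p ^ card C)"
    using assms by (intro sum.cong refl prob_superset) auto
  finally show ?thesis .
qed

text \<open>A union bound pays for the presence of a core; on the complement Markov's inequality is
  applied to the \<open>l\<close>-th moment.\<close>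

lemma prob_ge_le_cores:
  fixes \<C> :: "nat set set set" and p lam t :: real
  assumes p: "0 \<le> p" "p \<le> 1" and "0 \<le> lam" "0 < t"
    and \<C>: "\<And>C. C \<in> \<C> \<Longrightarrow> C \<subseteq> pairs {1..n}"
    and lam: "\<And>U. \<lbrakk>U \<subseteq> pairs {1..n}; card U \<le> N; \<forall>C\<in>\<C>. \<not> C \<subseteq> U\<rbrakk> \<Longrightarrow> cexp n r p U \<le> lam"
    and l: "(r choose 2) * l \<le> N"
  shows "measure_pmf.prob (random_graph n p) {E. num_cliques n r E \<ge> t}
    \<le> (\<Sum>C\<in>\<C>. p ^ card C) + (lam / t) ^ l"
proof -
  let ?R = "random_graph n p"
  let ?Z = "\<lambda>E. indicator {E. \<forall>C\<in>\<C>. \<not> C \<subseteq> E} E :: real"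
  have fin: "finite \<C>"
    using \<C> by (intro finite_subset[of \<C> "Pow (pairs {1..n})"]) auto
  have "measure_pmf.prob ?R {E. num_cliques n r E \<ge> t \<and> (\<forall>C\<in>\<C>. \<not> C \<subseteq> E)} * t ^ l
    = measure_pmf.expectation ?R (\<lambda>E. indicator {E. num_cliques n r E \<ge> t \<and> (\<forall>C\<in>\<C>. \<not> C \<subseteq> E)} E * t ^ l)"
    by simp
  also have "\<dots> \<le> measure_pmf.expectation ?R (\<lambda>E. indicator {E. {} \<subseteq> E} E * ?Z E * num_cliques n r E ^ l)"
    using \<open>0 < t\<close> by (intro integral_mono) (auto simp: indicator_def num_cliques_nonneg intro: power_mono)
  also have "\<dots> \<le> p ^ card ({} :: nat set set) * lam ^ l"
    by (rule coreless_moment_le[OF p \<open>0 \<le> lam\<close> lam]) (use l in auto)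
  finally have A: "measure_pmf.prob ?R {E. num_cliques n r E \<ge> t \<and> (\<forall>C\<in>\<C>. \<not> C \<subseteq> E)} \<le> (lam / t) ^ l"
    using \<open>0 < t\<close> by (simp add: power_divide field_simps)
  have "measure_pmf.prob ?R {E. num_cliques n r E \<ge> t}
    \<le> measure_pmf.prob ?R ({E. \<exists>C\<in>\<C>. C \<subseteq> E} \<union> {E. num_cliques n r E \<ge> t \<and> (\<forall>C\<in>\<C>. \<not> C \<subseteq> E)})"
    by (intro measure_pmf.finite_measure_mono) auto
  also have "\<dots> \<le> measure_pmf.prob ?R {E. \<exists>C\<in>\<C>. C \<subseteq> E} +
      measure_pmf.prob ?R {E. num_cliques n r E \<ge> t \<and> (\<forall>C\<in>\<C>. \<not> C \<subseteq> E)}"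
    by (rule measure_Un_le) auto
  finally show ?thesis using A prob_superset_family_le[OF p fin \<C>] by linarith
qed

text \<open>Greedy deletion: an element whose removal costs less than \<open>\<eta>\<close> is
  removed, and the hypothesis survives because its right side drops by exactly
  \<open>\<eta>\<close>.\<close>

lemma exists_minimal_core:
  fixes f :: "'a set \<Rightarrow> real"
  assumes "finite U" "f U \<ge> a + real (card U) * \<eta>"
  shows "\<exists>C\<subseteq>U. f C \<ge> a + real (card C) * \<eta> \<and> (\<forall>e\<in>C. f C - f (C - {e}) \<ge> \<eta>)"
  using assms
proof (induction "card U" arbitrary: U)
  case 0
  then show ?case by (intro exI[of _ U]) auto
next
  case (Suc k)
  show ?case
  proof (cases "\<forall>e\<in>U. f U - f (U - {e}) \<ge> \<eta>")
    case True
    then show ?thesis using Suc.prems by (intro exI[of _ U]) auto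
  next
    case False
    then obtain e where e: "e \<in> U" "f U - f (U - {e}) < \<eta>" by auto
    have k: "card (U - {e}) = k" using Suc.hyps(2) Suc.prems(1) e(1) by simp
    have "a + real (Suc k) * \<eta> \<le> f U" using Suc.prems(2) Suc.hyps(2) by simp
    then have "f (U - {e}) \<ge> a + real (card (U - {e})) * \<eta>"
      unfolding k using e(2) by (simp add: algebra_simps)
    then have "\<exists>C\<subseteq>U - {e}. f C \<ge> a + real (card C) * \<eta> \<and> (\<forall>e\<in>C. f C - f (C - {e}) \<ge> \<eta>)"
      using Suc.prems(1) k by (intro Suc.hyps(1)) auto
    then show ?thesis by blast
  qed
qed

section \<open>Hoelder's inequality over complete graphs\<close>

text \<open>The norm with exponent \<open>1 / a\<close>, indexed by the reciprocal so that Hoelder's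
  inequality becomes additive in the index.\<close>

definition lnorm :: "'a set \<Rightarrow> real \<Rightarrow> ('a \<Rightarrow> real) \<Rightarrow> real" where
  "lnorm V a h = (\<Sum>x\<in>V. h x powr (1 / a)) powr a"

lemma lnorm_nonneg: "0 \<le> lnorm V a h"
  by (simp add: lnorm_def)

lemma lnorm_1: "(\<And>x. x \<in> V \<Longrightarrow> 0 \<le> h x) \<Longrightarrow> lnorm V 1 h = (\<Sum>x\<in>V. h x)"
  by (simp add: lnorm_def sum_nonneg)

text \<open>After division by the sums \<open>A\<close> and \<open>B\<close>, Young's inequality
  with weights \<open>\<theta>\<close> and \<open>1 - \<theta>\<close> holds pointwise and is
  summed. A vanishing sum is treated apart; it forces the product to vanish.\<close>

lemma lnorm_mult_le:
  assumes "finite V" "0 < a" "0 < b"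
    and g: "\<And>x. x \<in> V \<Longrightarrow> 0 \<le> g x" and h: "\<And>x. x \<in> V \<Longrightarrow> 0 \<le> h x"
  shows "lnorm V (a + b) (\<lambda>x. g x * h x) \<le> lnorm V a g * lnorm V b h"
proof -
  define \<theta> where "\<theta> = a / (a + b)"
  have \<theta>: "0 < \<theta>" "\<theta> < 1" "1 - \<theta> = b / (a + b)" using assms by (auto simp: \<theta>_def field_simps)
  define A where "A = (\<Sum>x\<in>V. g x powr (1 / a))"
  define B where "B = (\<Sum>x\<in>V. h x powr (1 / b))"
  have AB: "0 \<le> A" "0 \<le> B" by (auto simp: A_def B_def intro: sum_nonneg)
  have "(\<Sum>x\<in>V. (g x * h x) powr (1 / (a + b))) \<le> A powr \<theta> * B powr (1 - \<theta>)"
  proof (cases "A = 0 \<or> B = 0")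
    case True
    then have "\<forall>x\<in>V. g x * h x = 0"
    proof
      assume "A = 0"
      then have "\<forall>x\<in>V. g x powr (1 / a) = 0"
        using assms(1) by (simp add: A_def sum_nonneg_eq_0_iff)
      then show ?thesis by simp
    next
      assume "B = 0"
      then have "\<forall>x\<in>V. h x powr (1 / b) = 0"
        using assms(1) by (simp add: B_def sum_nonneg_eq_0_iff)
      then show ?thesis by simp
    qed
    then have "(\<Sum>x\<in>V. (g x * h x) powr (1 / (a + b))) = 0" by (intro sum.neutral) auto
    then show ?thesis by simp
  next
    case False
    then have pos: "0 < A" "0 < B" using AB by auto
    have "(g x * h x) powr (1 / (a + b)) \<le> A powr \<theta> * B powr (1 - \<theta>) *
        (\<theta> * (g x powr (1 / a) / A) + (1 - \<theta>) * (h x powr (1 / b) / B))" if x: "x \<in> V" for x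
    proof -
      let ?u = "g x powr (1 / a)" and ?v = "h x powr (1 / b)"
      have "(?u / A) powr \<theta> * (?v / B) powr (1 - \<theta>) \<le> \<theta> * (?u / A) + (1 - \<theta>) * (?v / B)"
        using Youngs_inequality_0[of \<theta> "1 - \<theta>" "?u / A" "?v / B"] \<theta>(1,2) pos
        by (cases "?u = 0 \<or> ?v = 0") auto
      moreover have "(?u / A) powr \<theta> * (?v / B) powr (1 - \<theta>)
          = (g x * h x) powr (1 / (a + b)) / (A powr \<theta> * B powr (1 - \<theta>))"
        using pos g[OF x] h[OF x] assms
        by (simp add: powr_divide powr_powr \<theta>(3) powr_mult) (simp add: \<theta>_def)
      ultimately show ?thesis using pos by (simp add: field_simps)
    qed
    then have "(\<Sum>x\<in>V. (g x * h x) powr (1 / (a + b))) \<le> (\<Sum>x\<in>V. A powr \<theta> * B powr (1 - \<theta>) *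
        (\<theta> * (g x powr (1 / a) / A) + (1 - \<theta>) * (h x powr (1 / b) / B)))"
      by (rule sum_mono)
    also have "\<dots> = A powr \<theta> * B powr (1 - \<theta>) * (\<theta> * (A / A) + (1 - \<theta>) * (B / B))"
      unfolding A_def B_def
      by (simp add: sum.distrib flip: sum_distrib_left sum_divide_distrib)
    finally show ?thesis using pos by simp
  qed
  then have "lnorm V (a + b) (\<lambda>x. g x * h x) \<le> (A powr \<theta> * B powr (1 - \<theta>)) powr (a + b)"
    unfolding lnorm_def using assms by (intro powr_mono2 sum_nonneg) auto
  also have "\<dots> = A powr a * B powr b"
    using assms AB by (simp add: powr_mult powr_powr \<theta>(3)) (simp add: \<theta>_def)
  finally show ?thesis by (simp add: lnorm_def A_def B_def)
qed

lemma powr_inverse_power_Suc: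
  fixes x q :: real
  shows "(x powr (1 / q)) ^ Suc j = x powr (Suc j / q)"
  using powr_power[of x "1 / q" "Suc j"] by (cases "x = 0") simp_all

text \<open>A weighted count of \<open>k\<close>-cliques. Vertex weights are included so that the
  family is closed under removing a vertex.\<close>

definition wsum :: "'a set \<Rightarrow> ('a set \<Rightarrow> real) \<Rightarrow> nat \<Rightarrow> ('a \<Rightarrow> real) \<Rightarrow> real" where
  "wsum V f k h = (\<Sum>T | T \<subseteq> V \<and> card T = k. (\<Prod>x\<in>T. h x) * (\<Prod>e\<in>pairs T. f e))"

lemma pairs_empty [simp]: "pairs {} = {}"
  by (auto simp: pairs_def)

lemma pairs_insert: "x \<notin> T \<Longrightarrow> pairs (insert x T) = pairs T \<union> (\<lambda>y. {x, y}) ` T"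
  by (auto simp: pairs_def card_2_iff insert_commute doubleton_eq_iff subset_insert_iff split: if_splits)

lemma inj_on_doubleton: "x \<notin> T \<Longrightarrow> inj_on (\<lambda>y. {x, y}) T"
  by (auto simp: inj_on_def doubleton_eq_iff)

lemma pairs_insert_disjoint: "x \<notin> T \<Longrightarrow> pairs T \<inter> (\<lambda>y. {x, y}) ` T = {}"
  by (auto simp: pairs_def)

lemma prod_pairs_insert:
  fixes f :: "'a set \<Rightarrow> real"
  assumes "finite T" "x \<notin> T"
  shows "(\<Prod>e\<in>pairs (insert x T). f e) = (\<Prod>e\<in>pairs T. f e) * (\<Prod>y\<in>T. f {x, y})"
  unfolding pairs_insert[OF assms(2)]
  using assms pairs_insert_disjoint[OF assms(2)] inj_on_doubleton[OF assms(2)]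
  by (subst prod.union_disjoint) (auto simp: prod.reindex finite_pairs)

lemma wsum_0: "finite V \<Longrightarrow> wsum V f 0 h = 1"
proof -
  assume "finite V"
  then have "{T. T \<subseteq> V \<and> card T = 0} = {{}}" by (auto dest: finite_subset)
  then show ?thesis by (simp add: wsum_def)
qed

text \<open>Each \<open>T\<close> that meets \<open>B\<close> is charged to all its elements of
  \<open>B\<close>; overcounting is harmless as all weights are nonnegative. Removing the charged
  \<open>x\<close> leaves a \<open>k\<close>-set whose vertex weights have absorbed the pairs at
  \<open>x\<close>.\<close>

lemma wsum_meeting_le:
  assumes "finite V" "B \<subseteq> V" and h: "\<And>x. x \<in> V \<Longrightarrow> 0 \<le> h x" and f: "\<And>e. 0 \<le> f e"
  shows "(\<Sum>T | T \<subseteq> V \<and> card T = Suc k \<and> T \<inter> B \<noteq> {}. (\<Prod>x\<in>T. h x) * (\<Prod>e\<in>pairs T. f e))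
    \<le> (\<Sum>x\<in>B. h x * wsum V f k (\<lambda>y. h y * f {x, y}))"
proof -
  let ?val = "\<lambda>T. (\<Prod>x\<in>T. h x) * (\<Prod>e\<in>pairs T. f e)"
  let ?\<T> = "{T. T \<subseteq> V \<and> card T = Suc k \<and> T \<inter> B \<noteq> {}}"
  have fin: "finite ?\<T>" "finite B" using assms finite_subset by auto
  have val: "0 \<le> ?val T" if "T \<subseteq> V" for T
    using that by (intro mult_nonneg_nonneg prod_nonneg) (auto simp: h f subset_iff)
  have "(\<Sum>T\<in>?\<T>. ?val T) \<le> (\<Sum>T\<in>?\<T>. \<Sum>x\<in>B. if x \<in> T then ?val T else 0)"
  proof (intro sum_mono)
    fix T assume T: "T \<in> ?\<T>"
    then obtain x where x: "x \<in> T" "x \<in> B" by auto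
    have "?val T = (if x \<in> T then ?val T else 0)" using x by simp
    also have "\<dots> \<le> (\<Sum>x\<in>B. if x \<in> T then ?val T else 0)"
      using fin x T val by (intro member_le_sum) auto
    finally show "?val T \<le> (\<Sum>x\<in>B. if x \<in> T then ?val T else 0)" .
  qed
  also have "\<dots> = (\<Sum>x\<in>B. \<Sum>T\<in>?\<T>. if x \<in> T then ?val T else 0)" by (rule sum.swap)
  also have "\<dots> = (\<Sum>x\<in>B. \<Sum>T\<in>{T\<in>?\<T>. x \<in> T}. ?val T)"
    by (rule sum.cong[OF refl], rule sum.inter_filter[symmetric], rule fin)
  also have "\<dots> \<le> (\<Sum>x\<in>B. h x * wsum V f k (\<lambda>y. h y * f {x, y}))"
  proof (intro sum_mono)
    fix x assume x: "x \<in> B"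
    let ?S = "{T. T \<subseteq> V - {x} \<and> card T = k}"
    have "(\<Sum>T\<in>{T\<in>?\<T>. x \<in> T}. ?val T) = (\<Sum>T\<in>?S. ?val (insert x T))"
    proof (rule sum.reindex_bij_witness[of _ "insert x" "\<lambda>T. T - {x}"])
      fix T assume "T \<in> ?S"
      moreover from this have "finite T" using assms(1) finite_subset by auto
      ultimately show "insert x T \<in> {T\<in>?\<T>. x \<in> T}" "insert x T - {x} = T"
        using x assms by (auto simp: card_insert_if)
    next
      fix T assume "T \<in> {T\<in>?\<T>. x \<in> T}"
      moreover from this have "finite T" using assms(1) finite_subset by auto
      ultimately show "insert x (T - {x}) = T" "T - {x} \<in> ?S"
        by (auto simp: card_Diff_singleton)
      then show "?val (insert x (T - {x})) = ?val T" by simp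
    qed
    also have "\<dots> = (\<Sum>T\<in>?S. h x * ((\<Prod>y\<in>T. h y * f {x, y}) * (\<Prod>e\<in>pairs T. f e)))"
    proof (intro sum.cong refl)
      fix T assume T: "T \<in> ?S"
      then have "finite T" "x \<notin> T" using assms(1) finite_subset by auto
      then show "?val (insert x T) = h x * ((\<Prod>y\<in>T. h y * f {x, y}) * (\<Prod>e\<in>pairs T. f e))"
        by (simp add: prod_pairs_insert prod.distrib)
    qed
    also have "\<dots> = h x * (\<Sum>T\<in>?S. (\<Prod>y\<in>T. h y * f {x, y}) * (\<Prod>e\<in>pairs T. f e))"
      by (simp add: sum_distrib_left)
    also have "\<dots> \<le> h x * wsum V f k (\<lambda>y. h y * f {x, y})"
      unfolding wsum_def using assms x
      by (intro mult_left_mono sum_mono2 mult_nonneg_nonneg prod_nonneg)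
        (use finite_subset[OF Collect_mono finite_Collect_subsets[OF assms(1)], of "\<lambda>T. T \<subseteq> V \<and> card T = k"] in \<open>auto simp: h f subset_iff\<close>)
    finally show "(\<Sum>T\<in>{T\<in>?\<T>. x \<in> T}. ?val T) \<le> h x * wsum V f k (\<lambda>y. h y * f {x, y})" .
  qed
  finally show ?thesis .
qed

lemma wsum_Suc_le:
  assumes "finite V" and h: "\<And>x. x \<in> V \<Longrightarrow> 0 \<le> h x" and f: "\<And>e. 0 \<le> f e"
  shows "wsum V f (Suc k) h \<le> (\<Sum>x\<in>V. h x * wsum V f k (\<lambda>y. h y * f {x, y}))"
proof -
  have "{T. T \<subseteq> V \<and> card T = Suc k} = {T. T \<subseteq> V \<and> card T = Suc k \<and> T \<inter> V \<noteq> {}}"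
    by (auto dest: Int_absorb2)
  then show ?thesis
    using wsum_meeting_le[of V V h f k] assms by (simp add: wsum_def)
qed

text \<open>With trivial pair weights \<open>wsum\<close> is an elementary symmetric polynomial, and
  expanding the power produces each of its monomials.\<close>

lemma wsum_const_le_power:
  assumes "finite V" and h: "\<And>x. x \<in> V \<Longrightarrow> 0 \<le> h x"
  shows "wsum V (\<lambda>_. 1) k h \<le> (\<Sum>x\<in>V. h x) ^ k"
proof (induction k)
  case 0 then show ?case using assms by (simp add: wsum_0)
next
  case (Suc k)
  have "wsum V (\<lambda>_. 1) (Suc k) h \<le> (\<Sum>x\<in>V. h x * wsum V (\<lambda>_. 1) k h)"
    using wsum_Suc_le[of V h "\<lambda>_. 1" k] assms by simp
  also have "\<dots> = (\<Sum>x\<in>V. h x) * wsum V (\<lambda>_. 1) k h" by (simp add: sum_distrib_right)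
  also have "\<dots> \<le> (\<Sum>x\<in>V. h x) * (\<Sum>x\<in>V. h x) ^ k"
    using Suc assms by (intro mult_left_mono sum_nonneg) auto
  finally show ?case by simp
qed

text \<open>Finner's inequality for complete graphs. Removing one vertex multiplies the remaining
  vertex functions by \<open>f {x, _}\<close>, so two applications of Hoelder's inequality suffice for the
  induction step.\<close>

lemma wsum_step_Finner:
  fixes f :: "'a set \<Rightarrow> real"
  assumes V: "finite V" and f: "\<And>e. 0 \<le> f e" and "real j < q"
    and h: "\<And>x. x \<in> V \<Longrightarrow> 0 \<le> h x" and h': "\<And>x. x \<in> V \<Longrightarrow> 0 \<le> h' x"
  defines "\<phi> \<equiv> (\<Sum>x\<in>V. \<Sum>y\<in>V. f {x, y} powr q) powr (1 / q)"
  shows "(\<Sum>x\<in>V. h' x * wsum V f j (\<lambda>y. h y * f {x, y}))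
    \<le> lnorm V (1 - j / q) h' * lnorm V (1 - j / q) h ^ j * \<phi> ^ (Suc j choose 2)"
  using assms(3-5)
proof (induction j arbitrary: h h')
  case 0
  then show ?case using V by (simp add: wsum_0 lnorm_1 binomial_eq_0)
next
  case (Suc j)
  let ?F = "\<lambda>x. \<Sum>y\<in>V. f {x, y} powr q"
  \<comment> \<open>Every vertex of the \<open>j + 2\<close> now involved lies in
    \<open>Suc j\<close> pairs, each using \<open>1 / q\<close> of the total exponent 1;
    \<open>\<alpha>\<close> is what remains for the vertex function.\<close>
  define \<alpha> where "\<alpha> = 1 - Suc j / q"
  have q: "q > 0" "\<alpha> > 0" "1 - j / q = \<alpha> + 1 / q" "\<alpha> + Suc j / q = 1"
    using Suc.prems by (auto simp: \<alpha>_def field_simps)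
  have F: "0 \<le> ?F x" for x by (intro sum_nonneg) auto
  have inner: "wsum V f (Suc j) (\<lambda>y. h y * f {x, y})
      \<le> lnorm V \<alpha> h ^ Suc j * \<phi> ^ (Suc j choose 2) * ?F x powr (Suc j / q)" for x
  proof -
    let ?g = "\<lambda>y. h y * f {x, y}"
    have "wsum V f (Suc j) ?g \<le> (\<Sum>x\<in>V. ?g x * wsum V f j (\<lambda>y. ?g y * f {x, y}))"
      using Suc.prems f V by (intro wsum_Suc_le) auto
    \<comment> \<open>The induction hypothesis is applied with both vertex functions equal to
      \<open>?g\<close>. The statement keeps \<open>h\<close> and \<open>h'\<close> apart because
      \<open>cexp_diff_le\<close> needs a smaller function at the first vertex.\<close>
    also have "\<dots> \<le> lnorm V (1 - j / q) ?g * lnorm V (1 - j / q) ?g ^ j * \<phi> ^ (Suc j choose 2)"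
      using Suc.prems f by (intro Suc.IH) auto
    also have "\<dots> = lnorm V (\<alpha> + 1 / q) ?g ^ Suc j * \<phi> ^ (Suc j choose 2)" by (simp add: q)
    also have "\<dots> \<le> (lnorm V \<alpha> h * lnorm V (1 / q) (\<lambda>y. f {x, y})) ^ Suc j * \<phi> ^ (Suc j choose 2)"
      using Suc.prems f V q
      by (intro mult_right_mono power_mono lnorm_mult_le) (auto simp: \<phi>_def lnorm_nonneg)
    also have "lnorm V (1 / q) (\<lambda>y. f {x, y}) = ?F x powr (1 / q)"
      using q by (simp add: lnorm_def)
    also have "(lnorm V \<alpha> h * ?F x powr (1 / q)) ^ Suc j = lnorm V \<alpha> h ^ Suc j * ?F x powr (Suc j / q)"
      by (simp only: power_mult_distrib powr_inverse_power_Suc)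
    finally show ?thesis by (simp add: mult_ac)
  qed
  have "(\<Sum>x\<in>V. h' x * wsum V f (Suc j) (\<lambda>y. h y * f {x, y}))
      \<le> (\<Sum>x\<in>V. h' x * (lnorm V \<alpha> h ^ Suc j * \<phi> ^ (Suc j choose 2) * ?F x powr (Suc j / q)))"
    using Suc.prems by (intro sum_mono mult_left_mono inner) auto
  also have "\<dots> = lnorm V \<alpha> h ^ Suc j * \<phi> ^ (Suc j choose 2) * (\<Sum>x\<in>V. h' x * ?F x powr (Suc j / q))"
    by (simp add: sum_distrib_left mult_ac)
  also have "(\<Sum>x\<in>V. h' x * ?F x powr (Suc j / q)) = lnorm V (\<alpha> + Suc j / q) (\<lambda>x. h' x * ?F x powr (Suc j / q))"
    unfolding q(4) using Suc.prems by (intro lnorm_1[symmetric]) auto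
  also have "\<dots> \<le> lnorm V \<alpha> h' * lnorm V (Suc j / q) (\<lambda>x. ?F x powr (Suc j / q))"
    using Suc.prems V q by (intro lnorm_mult_le) auto
  also have "lnorm V (Suc j / q) (\<lambda>x. ?F x powr (Suc j / q)) = \<phi> ^ Suc j"
  proof -
    have "(?F x powr (Suc j / q)) powr (1 / (Suc j / q)) = ?F x" for x
      using F[of x] q by (simp add: powr_powr)
    moreover have "\<phi> ^ Suc j = (\<Sum>x\<in>V. ?F x) powr (Suc j / q)"
      unfolding \<phi>_def by (rule powr_inverse_power_Suc)
    ultimately show ?thesis by (simp add: lnorm_def)
  qed
  also have "lnorm V \<alpha> h ^ Suc j * \<phi> ^ (Suc j choose 2) * (lnorm V \<alpha> h' * \<phi> ^ Suc j)
    = lnorm V \<alpha> h' * lnorm V \<alpha> h ^ Suc j * \<phi> ^ (Suc (Suc j) choose 2)"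
  proof -
    have "Suc (Suc j) choose 2 = (Suc j choose 2) + Suc j" by (simp add: numeral_2_eq_2)
    then show ?thesis by (simp add: power_add mult_ac)
  qed
  finally have "(\<Sum>x\<in>V. h' x * wsum V f (Suc j) (\<lambda>y. h y * f {x, y}))
      \<le> lnorm V \<alpha> h' * lnorm V \<alpha> h ^ Suc j * \<phi> ^ (Suc (Suc j) choose 2)"
    by (simp add: mult_left_mono lnorm_nonneg \<phi>_def)
  then show ?case unfolding \<alpha>_def .
qed

section \<open>The marginal contribution of an edge\<close>

text \<open>The probability that the pair \<open>e\<close> is an edge, given that \<open>G\<close>
  is present.\<close>

definition wt :: "real \<Rightarrow> nat set set \<Rightarrow> nat set \<Rightarrow> real" where
  "wt p G e = (if e \<in> G then 1 else p)"

definition deg :: "nat set set \<Rightarrow> nat \<Rightarrow> nat" where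
  "deg G x = card {y. {x, y} \<in> G}"

lemma wt_nonneg: "0 \<le> p \<Longrightarrow> 0 \<le> wt p G e"
  and wt_le_1: "p \<le> 1 \<Longrightarrow> wt p G e \<le> 1"
  by (simp_all add: wt_def)

lemma prod_wt: "finite A \<Longrightarrow> (\<Prod>e\<in>A. wt p G e) = p ^ card (A - G)"
  by (induction rule: finite_induct) (auto simp: wt_def insert_Diff_if)

lemma pairsD: "{x, y} \<in> pairs V \<Longrightarrow> x \<in> V \<and> y \<in> V \<and> x \<noteq> y"
  by (cases "x = y") (auto simp: pairs_def)

lemma finite_nbhd:
  assumes "G \<subseteq> pairs V" "finite V"
  shows "finite {y. {x, y} \<in> G}" "{y. {x, y} \<in> G} \<subseteq> V"
proof -
  show "{y. {x, y} \<in> G} \<subseteq> V" using assms(1) by (auto dest!: subsetD dest: pairsD)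
  then show "finite {y. {x, y} \<in> G}" using assms finite_subset by blast
qed

lemma deg_eq_incident:
  assumes "G \<subseteq> pairs V"
  shows "deg G x = card {e\<in>G. x \<in> e}"
proof -
  have "{e\<in>G. x \<in> e} = (\<lambda>y. {x, y}) ` {y. {x, y} \<in> G}"
  proof (intro equalityI subsetI)
    fix e assume e: "e \<in> {e\<in>G. x \<in> e}"
    then have "card e = 2" using assms by (auto simp: pairs_def)
    then obtain a b where "e = {a, b}" by (auto simp: card_2_iff)
    then show "e \<in> (\<lambda>y. {x, y}) ` {y. {x, y} \<in> G}"
      using e by (auto simp: insert_commute)
  qed auto
  moreover have "inj_on (\<lambda>y. {x, y}) {y. {x, y} \<in> G}"
    by (auto simp: inj_on_def doubleton_eq_iff)
  ultimately show ?thesis by (simp add: deg_def card_image)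
qed

lemma sum_deg:
  assumes "G \<subseteq> pairs V" "finite V"
  shows "(\<Sum>x\<in>V. deg G x) = 2 * card G"
proof -
  have fG: "finite G" using assms finite_subset finite_pairs by blast
  have "(\<Sum>x\<in>V. deg G x) = (\<Sum>x\<in>V. \<Sum>e\<in>G. if x \<in> e then 1 else 0)"
    using fG by (simp add: deg_eq_incident[OF assms(1)] flip: sum.inter_filter)
  also have "\<dots> = (\<Sum>e\<in>G. \<Sum>x\<in>V. if x \<in> e then 1 else 0)" by (rule sum.swap)
  also have "\<dots> = (\<Sum>e\<in>G. 2)"
  proof (intro sum.cong refl)
    fix e assume "e \<in> G"
    then have e: "e \<subseteq> V" "card e = 2" using assms by (auto simp: pairs_def)
    then have "{x\<in>V. x \<in> e} = e" by auto
    then show "(\<Sum>x\<in>V. if x \<in> e then 1 else 0) = (2 :: nat)"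
      using assms e by (simp flip: sum.inter_filter)
  qed
  finally show ?thesis by simp
qed

text \<open>Only \<open>r\<close>-sets containing both \<open>u\<close> and \<open>v\<close> feel
  the edge, and their term without the edge is dropped as nonnegative. The other
  \<open>r - 2\<close> vertices keep their mutual pairs and carry as vertex weight the two pairs to
  \<open>u\<close> and \<open>v\<close>.\<close>

lemma cexp_diff_le_wsum:
  assumes G: "G \<subseteq> pairs {1..n}" and e: "{u, v} \<in> G" and p: "0 \<le> p" "p \<le> 1" and r: "2 \<le> r"
  shows "cexp n r p G - cexp n r p (G - {{u, v}})
    \<le> wsum ({1..n} - {u, v}) (wt p G) (r - 2) (\<lambda>x. wt p G {u, x} * wt p G {v, x})"
proof -
  let ?e = "{u, v}"
  let ?V = "{1..n} - {u, v}"
  let ?val = "\<lambda>T. (\<Prod>x\<in>T. wt p G {u, x} * wt p G {v, x}) * (\<Prod>e\<in>pairs T. wt p G e)"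
  have uv: "u \<in> {1..n}" "v \<in> {1..n}" "u \<noteq> v" using pairsD[OF subsetD[OF G e]] by auto
  have "cexp n r p G - cexp n r p (G - {?e})
    = (\<Sum>S\<in>rsets n r. p ^ card (pairs S - G) - p ^ card (pairs S - (G - {?e})))"
    by (simp add: cexp_def sum_subtractf)
  also have "\<dots> \<le> (\<Sum>S\<in>rsets n r. if u \<in> S \<and> v \<in> S then p ^ card (pairs S - G) else 0)"
  proof (intro sum_mono)
    fix S assume "S \<in> rsets n r"
    show "p ^ card (pairs S - G) - p ^ card (pairs S - (G - {?e}))
      \<le> (if u \<in> S \<and> v \<in> S then p ^ card (pairs S - G) else 0)"
    proof (cases "u \<in> S \<and> v \<in> S")
      case False
      then have "pairs S - (G - {?e}) = pairs S - G" by (auto simp: pairs_def)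
      then show ?thesis using False by auto
    qed (use p in simp)
  qed
  also have "\<dots> = (\<Sum>S\<in>{S\<in>rsets n r. u \<in> S \<and> v \<in> S}. p ^ card (pairs S - G))"
    by (rule sum.inter_filter[symmetric]) simp
  also have "\<dots> = (\<Sum>T | T \<subseteq> ?V \<and> card T = r - 2. ?val T)"
  proof (rule sum.reindex_bij_witness[of _ "\<lambda>T. insert u (insert v T)" "\<lambda>S. S - {u, v}"])
    fix S assume S: "S \<in> {S\<in>rsets n r. u \<in> S \<and> v \<in> S}"
    then show "insert u (insert v (S - {u, v})) = S" by auto
    have fin: "finite S" using S rsetsD by auto
    show "S - {u, v} \<in> {T. T \<subseteq> ?V \<and> card T = r - 2}"
      using S uv fin by (auto simp: rsets_def card_Diff_subset)
    let ?T = "S - {u, v}"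
    have "p ^ card (pairs S - G) = (\<Prod>e\<in>pairs S. wt p G e)" using fin by (simp add: prod_wt)
    also have "\<dots> = (\<Prod>e\<in>pairs (insert u (insert v ?T)). wt p G e)"
      using S by (intro prod.cong arg_cong[of _ _ pairs]) auto
    also have "\<dots> = (\<Prod>e\<in>pairs ?T. wt p G e) * (\<Prod>y\<in>?T. wt p G {v, y}) * (wt p G {u, v} * (\<Prod>y\<in>?T. wt p G {u, y}))"
      using fin uv by (simp add: prod_pairs_insert)
    also have "wt p G {u, v} = 1" using e by (simp add: wt_def)
    finally show "?val ?T = p ^ card (pairs S - G)" by (simp add: prod.distrib mult_ac)
  next
    fix T assume T: "T \<in> {T. T \<subseteq> ?V \<and> card T = r - 2}"
    then have "finite T" "u \<notin> T" "v \<notin> T" using finite_subset by auto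
    then show "insert u (insert v T) - {u, v} = T"
      "insert u (insert v T) \<in> {S\<in>rsets n r. u \<in> S \<and> v \<in> S}"
      using T uv r by (auto simp: rsets_def)
  qed
  finally show ?thesis by (simp add: wsum_def)
qed

lemma sum_wt_powr_le:
  assumes G: "G \<subseteq> pairs {1..n}" and p: "0 \<le> p" and r: "1 \<le> r" and V: "V \<subseteq> {1..n}"
  shows "(\<Sum>x\<in>V. \<Sum>y\<in>V. wt p G {x, y} powr real (r - 1)) \<le> real n ^ 2 * p powr real (r - 1) + 2 * real (card G)"
proof -
  have "(\<Sum>x\<in>V. \<Sum>y\<in>V. wt p G {x, y} powr real (r - 1))
    \<le> (\<Sum>x\<in>V. \<Sum>y\<in>{1..n}. wt p G {x, y} powr real (r - 1))"
    by (intro sum_mono sum_mono2) (use V in auto)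
  also have "\<dots> \<le> (\<Sum>x\<in>{1..n}. \<Sum>y\<in>{1..n}. wt p G {x, y} powr real (r - 1))"
    by (intro sum_mono2) (use V in \<open>auto intro!: sum_nonneg\<close>)
  also have "\<dots> \<le> (\<Sum>x\<in>{1..n}. \<Sum>y\<in>{1..n}. p powr real (r - 1) + (if {x, y} \<in> G then 1 else 0))"
    by (intro sum_mono) (auto simp: wt_def)
  also have "\<dots> = real n ^ 2 * p powr real (r - 1) + (\<Sum>x\<in>{1..n}. real (card {y \<in> {1..n}. {x, y} \<in> G}))"
    by (simp add: sum.distrib power2_eq_square flip: sum.inter_filter)
  also have "(\<Sum>x\<in>{1..n}. real (card {y \<in> {1..n}. {x, y} \<in> G})) = (\<Sum>x\<in>{1..n}. real (deg G x))"
  proof (intro sum.cong refl)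
    fix x
    have "{y \<in> {1..n}. {x, y} \<in> G} = {y. {x, y} \<in> G}" using finite_nbhd(2)[OF G, of x] by auto
    then show "real (card {y \<in> {1..n}. {x, y} \<in> G}) = real (deg G x)" by (simp add: deg_def)
  qed
  also have "\<dots> = 2 * real (card G)"
    using sum_deg[OF G] by (simp flip: of_nat_sum)
  finally show ?thesis .
qed

text \<open>The \<open>r - 2\<close> further vertices of a clique may all be common neighbours of
  \<open>u\<close> and \<open>v\<close>; there are at most \<open>D\<close> of these, hence the
  first term. Otherwise one of them has a weight containing a factor \<open>p\<close>. Using it as
  the first vertex puts \<open>g'\<close> in place of \<open>g\<close>, whose norm is smaller by a
  power of \<open>\<tau>\<close>, and Finner's inequality bounds the rest by the natural order
  \<open>s ^ (r - 2)\<close>.\<close>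

lemma cexp_diff_le:
  fixes p s D \<tau> \<Lambda> :: real
  assumes G: "G \<subseteq> pairs {1..n}" and e: "{u, v} \<in> G" and p: "0 < p" "p \<le> 1" and r: "3 \<le> r"
    and s: "s = real n * p powr (real (r - 1) / 2)"
    and u: "real (deg G u) \<le> D" "D \<le> s" and v: "real (deg G v) \<le> \<tau> * n"
    and \<tau>: "p powr (real (r - 1) / 2) \<le> \<tau>" "\<tau> \<le> 1"
    and \<Lambda>: "s ^ 2 + 2 * real (card G) \<le> \<Lambda> * s ^ 2" "1 \<le> \<Lambda>"
  shows "cexp n r p G - cexp n r p (G - {{u, v}})
    \<le> D ^ (r - 2) + 48 * \<tau> powr (2 / real (r - 1)) * \<Lambda> ^ (r - 2) * s ^ (r - 2)"
proof -
  define k where "k = r - 3"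
  have rk: "r = k + 3" using r by (simp add: k_def)
  define q where "q = real (r - 1)"
  have q: "q = k + 2" "q \<ge> 2" by (auto simp: q_def rk)
  let ?V = "{1..n} - {u, v}"
  define g where "g = (\<lambda>x. wt p G {u, x} * wt p G {v, x})"
  define N where "N = {x \<in> ?V. {u, x} \<in> G \<and> {v, x} \<in> G}"
  define g' where "g' = (\<lambda>x. if x \<in> N then 0 else g x)"
  have uv: "u \<in> {1..n}" "v \<in> {1..n}" "u \<noteq> v" using pairsD[OF subsetD[OF G e]] by auto
  have npos: "n > 0" using uv by auto
  have spos: "s > 0" using p npos by (simp add: s)
  have \<tau>0: "\<tau> > 0" using \<tau> p by (smt (verit) powr_gt_zero)
  have g01: "0 \<le> g x" "g x \<le> 1" for x
    using p by (auto simp: g_def wt_def mult_le_one)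
  have NV: "N \<subseteq> ?V" by (auto simp: N_def)
  have N_le: "real (card N) \<le> D"
  proof -
    have "card N \<le> deg G u"
      unfolding deg_def using finite_nbhd(1)[OF G] by (intro card_mono) (auto simp: N_def)
    then show ?thesis using u by linarith
  qed
  have D0: "0 \<le> D" using N_le by linarith
  let ?a = "q / 2"
  have pa: "p powr ?a * n = s" by (simp add: s q_def mult.commute)
  \<comment> \<open>Off \<open>N\<close> the weight is at most \<open>p\<close> at neighbours of
    \<open>u\<close> or \<open>v\<close> and \<open>p ^ 2\<close> elsewhere. The degree bounds and
    \<open>p powr ?a \<le> \<tau>\<close> make each of the three contributions at most
    \<open>\<tau> * s\<close>.\<close>
  have g'_sum: "(\<Sum>x\<in>?V. g' x powr ?a) \<le> 3 * \<tau> * s"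
  proof -
    have "(\<Sum>x\<in>?V. g' x powr ?a) \<le> (\<Sum>x\<in>{1..n}. p powr ?a * (if {u, x} \<in> G then 1 else 0)
        + p powr ?a * (if {v, x} \<in> G then 1 else 0) + p powr ?a * p powr ?a)"
    proof (intro order_trans[OF sum_mono sum_mono2])
      fix x assume x: "x \<in> ?V"
      show "g' x powr ?a \<le> p powr ?a * (if {u, x} \<in> G then 1 else 0)
        + p powr ?a * (if {v, x} \<in> G then 1 else 0) + p powr ?a * p powr ?a"
        using x p by (auto simp: g'_def g_def wt_def N_def powr_mult)
    qed (use p in \<open>auto intro!: add_nonneg_nonneg\<close>)
    also have "\<dots> = p powr ?a * card {x\<in>{1..n}. {u, x} \<in> G} + p powr ?a * card {x\<in>{1..n}. {v, x} \<in> G}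
        + n * (p powr ?a * p powr ?a)"
      by (simp add: sum.distrib flip: sum_distrib_left sum.inter_filter)
    also have "{x\<in>{1..n}. {u, x} \<in> G} = {x. {u, x} \<in> G}" using finite_nbhd(2)[OF G, of u] by auto
    also have "{x\<in>{1..n}. {v, x} \<in> G} = {x. {v, x} \<in> G}" using finite_nbhd(2)[OF G, of v] by auto
    also have "p powr ?a * real (card {x. {u, x} \<in> G}) + p powr ?a * real (card {x. {v, x} \<in> G})
        + n * (p powr ?a * p powr ?a) \<le> \<tau> * s + \<tau> * s + \<tau> * s"
    proof (intro add_mono)
      have "p powr ?a * real (deg G u) \<le> \<tau> * s"
        using \<tau> \<tau>0 u p by (intro mult_mono) (auto simp: q_def)
      then show "p powr ?a * real (card {x. {u, x} \<in> G}) \<le> \<tau> * s" by (simp add: deg_def)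
      have "p powr ?a * real (deg G v) \<le> p powr ?a * (\<tau> * n)"
        using v by (intro mult_left_mono) auto
      then show "p powr ?a * real (card {x. {v, x} \<in> G}) \<le> \<tau> * s"
        by (simp add: deg_def pa[symmetric] mult_ac)
      have "n * (p powr ?a * p powr ?a) = p powr ?a * s" by (simp add: pa[symmetric])
      also have "\<dots> \<le> \<tau> * s" using \<tau> spos by (intro mult_right_mono) (auto simp: q_def)
      finally show "n * (p powr ?a * p powr ?a) \<le> \<tau> * s" .
    qed
    finally show ?thesis by simp
  qed
  have g_sum: "(\<Sum>x\<in>?V. g x powr ?a) \<le> 4 * s"
  proof -
    have "(\<Sum>x\<in>?V. g x powr ?a) \<le> (\<Sum>x\<in>?V. g' x powr ?a + (if x \<in> N then 1 else 0))"
      using g01 q by (intro sum_mono) (auto simp: g'_def intro: powr_le1)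
    also have "\<dots> = (\<Sum>x\<in>?V. g' x powr ?a) + card N"
    proof -
      have "{x\<in>?V. x \<in> N} = N" using NV by auto
      then show ?thesis by (simp add: sum.distrib flip: sum.inter_filter)
    qed
    also have "\<dots> \<le> 3 * \<tau> * s + s" using g'_sum N_le u by linarith
    also have "\<dots> \<le> 4 * s" using \<tau> spos by (simp add: algebra_simps)
    finally show ?thesis .
  qed
  define \<phi> where "\<phi> = (\<Sum>x\<in>?V. \<Sum>y\<in>?V. wt p G {x, y} powr q) powr (1 / q)"
  \<comment> \<open>Each of the \<open>r - 2\<close> vertices lies in \<open>k = r - 3\<close> pairs
    with the others, so \<open>2 / q\<close> remains: one \<open>1 / q\<close> for each of the pairs
    to \<open>u\<close> and \<open>v\<close>.\<close>
  have al: "1 - real k / q = 2 / q" using q by (simp add: field_simps)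
  have "wsum ?V (wt p G) (Suc k) g =
      (\<Sum>T | T \<subseteq> ?V \<and> card T = Suc k \<and> T \<inter> (?V - N) = {}. (\<Prod>x\<in>T. g x) * (\<Prod>e\<in>pairs T. wt p G e))
    + (\<Sum>T | T \<subseteq> ?V \<and> card T = Suc k \<and> T \<inter> (?V - N) \<noteq> {}. (\<Prod>x\<in>T. g x) * (\<Prod>e\<in>pairs T. wt p G e))"
    unfolding wsum_def by (subst sum.union_disjoint[symmetric]) (auto intro!: sum.cong)
  also have "\<dots> \<le> D ^ Suc k + lnorm ?V (2 / q) g' * lnorm ?V (2 / q) g ^ k * \<phi> ^ (Suc k choose 2)"
  proof (rule add_mono)
    have "(\<Sum>T | T \<subseteq> ?V \<and> card T = Suc k \<and> T \<inter> (?V - N) = {}. (\<Prod>x\<in>T. g x) * (\<Prod>e\<in>pairs T. wt p G e))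
      \<le> (\<Sum>T | T \<subseteq> ?V \<and> card T = Suc k \<and> T \<inter> (?V - N) = {}. 1)"
      using p by (intro sum_mono mult_le_one prod_le_1 prod_nonneg) (auto simp: g01 wt_nonneg wt_le_1)
    also have "\<dots> = card {T. T \<subseteq> N \<and> card T = Suc k}"
      using NV by (auto intro!: arg_cong[of _ _ card])
    also have "\<dots> = card N choose Suc k"
      using NV by (intro arg_cong[of _ _ real] n_subsets) (auto intro: finite_subset)
    also have "\<dots> \<le> real (card N ^ Suc k)"
      by (cases "Suc k \<le> card N") (auto simp: binomial_eq_0 simp del: power_Suc intro: binomial_le_pow)
    also have "\<dots> \<le> D ^ Suc k" using N_le by (simp del: power_Suc add: power_mono)
    finally show "(\<Sum>T | T \<subseteq> ?V \<and> card T = Suc k \<and> T \<inter> (?V - N) = {}. (\<Prod>x\<in>T. g x) * (\<Prod>e\<in>pairs T. wt p G e)) \<le> D ^ Suc k" .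
  next
    have "(\<Sum>T | T \<subseteq> ?V \<and> card T = Suc k \<and> T \<inter> (?V - N) \<noteq> {}. (\<Prod>x\<in>T. g x) * (\<Prod>e\<in>pairs T. wt p G e))
      \<le> (\<Sum>x\<in>?V - N. g x * wsum ?V (wt p G) k (\<lambda>y. g y * wt p G {x, y}))"
      using p by (intro wsum_meeting_le) (auto simp: g01 wt_nonneg)
    also have "\<dots> = (\<Sum>x\<in>?V. g' x * wsum ?V (wt p G) k (\<lambda>y. g y * wt p G {x, y}))"
      by (intro sum.mono_neutral_cong_left) (auto simp: g'_def)
    also have "\<dots> \<le> lnorm ?V (1 - k / q) g' * lnorm ?V (1 - k / q) g ^ k * \<phi> ^ (Suc k choose 2)"
      unfolding \<phi>_def using p q by (intro wsum_step_Finner) (auto simp: g'_def g01 wt_nonneg)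
    finally show "(\<Sum>T | T \<subseteq> ?V \<and> card T = Suc k \<and> T \<inter> (?V - N) \<noteq> {}. (\<Prod>x\<in>T. g x) * (\<Prod>e\<in>pairs T. wt p G e))
      \<le> lnorm ?V (2 / q) g' * lnorm ?V (2 / q) g ^ k * \<phi> ^ (Suc k choose 2)" by (simp only: al)
  qed
  also have "lnorm ?V (2 / q) g' * lnorm ?V (2 / q) g ^ k * \<phi> ^ (Suc k choose 2)
    \<le> (3 * \<tau> * s) powr (2 / q) * ((4 * s) powr (2 / q)) ^ k * ((\<Lambda> * s ^ 2) powr (1 / q)) ^ (Suc k choose 2)"
  proof (intro mult_mono power_mono)
    show "lnorm ?V (2 / q) g' \<le> (3 * \<tau> * s) powr (2 / q)"
      unfolding lnorm_def using g'_sum q by (intro powr_mono2) (auto intro!: sum_nonneg)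
    show "lnorm ?V (2 / q) g \<le> (4 * s) powr (2 / q)"
      unfolding lnorm_def using g_sum q by (intro powr_mono2) (auto intro!: sum_nonneg)
    have "(\<Sum>x\<in>?V. \<Sum>y\<in>?V. wt p G {x, y} powr q) \<le> real n ^ 2 * p powr q + 2 * real (card G)"
      unfolding q_def using p r by (intro sum_wt_powr_le[OF G]) auto
    also have "real n ^ 2 * p powr q = s ^ 2"
      using p by (simp add: s power_mult_distrib powr_power q_def)
    finally show "\<phi> \<le> (\<Lambda> * s ^ 2) powr (1 / q)"
      unfolding \<phi>_def using \<Lambda> q by (intro powr_mono2) (auto intro!: sum_nonneg)
  qed (auto simp: lnorm_nonneg \<phi>_def)
  also have "\<dots> \<le> 48 * \<tau> powr (2 / q) * \<Lambda> ^ Suc k * s ^ Suc k"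
  proof -
    let ?m = "real (Suc k choose 2)"
    have m: "?m = real k * (real k + 1) / 2"
    proof -
      have "2 * (Suc k choose 2) = Suc k * k" by (simp add: choose_two)
      then have "real (2 * (Suc k choose 2)) = real (Suc k * k)" by (rule arg_cong)
      then show ?thesis by (simp add: algebra_simps)
    qed
    have "(3 * \<tau> * s) powr (2 / q) * ((4 * s) powr (2 / q)) ^ k * ((\<Lambda> * s ^ 2) powr (1 / q)) ^ (Suc k choose 2)
      = (3 * \<tau> * s) powr (2 / q) * (4 * s) powr (2 * k / q) * (\<Lambda> * s ^ 2) powr (?m / q)"
      using spos \<Lambda> by (simp add: powr_power mult.commute)
    also have "\<dots>
      = 3 powr (2 / q) * 4 powr (2 * k / q) * \<tau> powr (2 / q) * \<Lambda> powr (?m / q) * s powr (2 / q + 2 * k / q + 2 * ?m / q)"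
    proof -
      have "(s ^ 2) powr y = s powr (2 * y)" for y
        by (simp only: powr_numeral[OF less_imp_le[OF spos], symmetric] powr_powr)
      then show ?thesis using spos \<Lambda> \<tau>0 by (simp add: powr_mult powr_add mult_ac)
    qed
    also have "2 / q + 2 * k / q + 2 * ?m / q = real (Suc k)"
    proof -
      have "2 + 2 * k + 2 * ?m = real (Suc k) * q" unfolding m q(1) by (simp add: algebra_simps)
      then have "(2 + 2 * k + 2 * ?m) / q = real (Suc k)" using q(2) by (simp add: field_simps)
      then show ?thesis by (simp add: add_divide_distrib)
    qed
    also have "s powr real (Suc k) = s ^ Suc k" using spos by (rule powr_realpow)
    \<comment> \<open>The constant 48 arises here as \<open>3 * 16\<close>, from
      \<open>2 / q \<le> 1\<close> and \<open>2 * k / q \<le> 2\<close>.\<close>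
    also have "3 powr (2 / q) * 4 powr (2 * k / q) * \<tau> powr (2 / q) * \<Lambda> powr (?m / q) * s ^ Suc k
      \<le> 3 * 16 * \<tau> powr (2 / q) * \<Lambda> ^ Suc k * s ^ Suc k"
    proof (intro mult_mono)
      have "3 powr (2 / q) \<le> (3 :: real) powr 1" using q by (intro powr_mono) auto
      then show "3 powr (2 / q) \<le> (3 :: real)" by simp
      have "4 powr (2 * k / q) \<le> (4 :: real) powr 2" using q by (intro powr_mono) (auto simp: field_simps)
      then show "4 powr (2 * k / q) \<le> (16 :: real)" by simp
      have "?m / q \<le> real (Suc k)"
        unfolding m using q by (simp add: field_simps)
      then have "\<Lambda> powr (?m / q) \<le> \<Lambda> powr real (Suc k)" using \<Lambda> by (intro powr_mono) auto
      then show "\<Lambda> powr (?m / q) \<le> \<Lambda> ^ Suc k" using \<Lambda> by (simp add: powr_realpow del: power_Suc of_nat_Suc)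
    qed (use spos \<Lambda> in auto)
    finally show ?thesis by simp
  qed
  finally have "wsum ?V (wt p G) (Suc k) g \<le> D ^ Suc k + 48 * \<tau> powr (2 / q) * \<Lambda> ^ Suc k * s ^ Suc k"
    by simp
  moreover have "cexp n r p G - cexp n r p (G - {{u, v}}) \<le> wsum ?V (wt p G) (r - 2) g"
    unfolding g_def using p r by (intro cexp_diff_le_wsum[OF G e]) auto
  moreover have "r - 2 = Suc k" using rk by simp
  ultimately show ?thesis unfolding q_def by simp
qed

section \<open>The conditional expectation of a structured graph\<close>

lemma real_choose_two: "real (m choose 2) = real m * (real m - 1) / 2"
proof (induction m)
  case (Suc m)
  have "Suc m choose 2 = m + (m choose 2)" by (simp add: numeral_2_eq_2)
  then show ?case using Suc by (simp add: field_simps)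
qed simp

section \<open>Cliques in a graph with a given number of edges\<close>

definition kcl :: "'a set \<Rightarrow> nat \<Rightarrow> 'a set set \<Rightarrow> 'a set set" where
  "kcl V k G = {S. S \<subseteq> V \<and> card S = k \<and> pairs S \<subseteq> G}"

lemma finite_kcl: "finite V \<Longrightarrow> finite (kcl V k G)"
  by (simp add: kcl_def)

text \<open>Double counting of a clique together with one of its vertices: removing the vertex
  leaves a \<open>k\<close>-clique inside its neighbourhood.\<close>

lemma Suc_times_card_kcl_le:
  fixes G :: "nat set set"
  assumes V: "finite V" and G: "G \<subseteq> pairs V"
  shows "Suc k * card (kcl V (Suc k) G) \<le> (\<Sum>x\<in>V. card (kcl {y. {x, y} \<in> G} k (G \<inter> pairs {y. {x, y} \<in> G})))"
proof -
  have "Suc k * card (kcl V (Suc k) G) = (\<Sum>S\<in>kcl V (Suc k) G. \<Sum>x\<in>V. if x \<in> S then 1 else 0)"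
  proof -
    have "(\<Sum>x\<in>V. if x \<in> S then 1 else 0) = Suc k" if "S \<in> kcl V (Suc k) G" for S
    proof -
      have "{x\<in>V. x \<in> S} = S" "card S = Suc k" using that by (auto simp: kcl_def)
      then show ?thesis using V by (simp flip: sum.inter_filter)
    qed
    then show ?thesis by simp
  qed
  also have "\<dots> = (\<Sum>x\<in>V. \<Sum>S\<in>kcl V (Suc k) G. if x \<in> S then 1 else 0)" by (rule sum.swap)
  also have "\<dots> = (\<Sum>x\<in>V. card {S\<in>kcl V (Suc k) G. x \<in> S})"
    using V by (simp add: finite_kcl flip: sum.inter_filter)
  also have "\<dots> \<le> (\<Sum>x\<in>V. card (kcl {y. {x, y} \<in> G} k (G \<inter> pairs {y. {x, y} \<in> G})))"
  proof (intro sum_mono card_inj_on_le[where f = "\<lambda>S. S - {x}" for x])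
    fix x assume "x \<in> V"
    show "inj_on (\<lambda>S. S - {x}) {S\<in>kcl V (Suc k) G. x \<in> S}"
      by (auto simp: inj_on_def)
    show "finite (kcl {y. {x, y} \<in> G} k (G \<inter> pairs {y. {x, y} \<in> G}))"
      by (intro finite_kcl finite_nbhd(1)[OF G V])
    show "(\<lambda>S. S - {x}) ` {S\<in>kcl V (Suc k) G. x \<in> S} \<subseteq> kcl {y. {x, y} \<in> G} k (G \<inter> pairs {y. {x, y} \<in> G})"
    proof (intro subsetI, elim imageE, simp only:)
      fix S assume S: "S \<in> {S\<in>kcl V (Suc k) G. x \<in> S}"
      then have fin: "finite S" using V finite_subset by (auto simp: kcl_def)
      have "{x, y} \<in> G" if "y \<in> S - {x}" for y
      proof -
        have "{x, y} \<in> pairs S" using that S by (auto simp: pairs_def)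
        then show ?thesis using S by (auto simp: kcl_def)
      qed
      then have sub: "S - {x} \<subseteq> {y. {x, y} \<in> G}" by auto
      moreover have "pairs (S - {x}) \<subseteq> G" using S pairs_mono[of "S - {x}" S] by (auto simp: kcl_def)
      moreover have "card (S - {x}) = k" using S fin by (auto simp: kcl_def)
      ultimately show "S - {x} \<in> kcl {y. {x, y} \<in> G} k (G \<inter> pairs {y. {x, y} \<in> G})"
        using pairs_mono[OF sub] by (auto simp: kcl_def)
    qed
  qed
  finally show ?thesis .
qed

lemma fact_times_card_kcl_le_power:
  assumes "finite V"
  shows "fact k * card (kcl V k G) \<le> card V ^ k"
proof -
  have "card (kcl V k G) \<le> card V choose k"
    unfolding kcl_def n_subsets[OF assms, symmetric] using assms by (intro card_mono) auto
  then have "fact k * card (kcl V k G) \<le> fact k * (card V choose k)" by simp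
  also have "\<dots> \<le> card V ^ k" using binomial_fact_pow[of "card V" k] by (simp add: mult.commute)
  finally show ?thesis .
qed

text \<open>The bound is what a complete graph with the same number of edges attains asymptotically.
  Let M be \<open>sqrt (2 * real (card G))\<close>. In the neighbourhood of a vertex of degree at
  most M the trivial bound is good enough, in that of a vertex of larger degree the induction
  hypothesis is. Both give \<open>deg G x * M ^ (k + 1)\<close>, and the degrees sum to
  \<open>M ^ 2\<close>.\<close>

lemma fact_times_card_kcl_le:
  fixes G :: "nat set set"
  assumes "finite V" "G \<subseteq> pairs V"
  shows "fact (k + 2) * real (card (kcl V (k + 2) G)) \<le> sqrt (2 * real (card G)) ^ (k + 2)"
  using assms
proof (induction k arbitrary: V G)
  case 0
  have "kcl V 2 G \<subseteq> G"
  proof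
    fix S assume "S \<in> kcl V 2 G"
    then have "S \<in> pairs S" "pairs S \<subseteq> G" by (auto simp: kcl_def pairs_def)
    then show "S \<in> G" by auto
  qed
  then have "card (kcl V 2 G) \<le> card G"
    using 0 by (intro card_mono) (auto intro: finite_subset finite_pairs)
  then have "fact 2 * real (card (kcl V 2 G)) \<le> sqrt (2 * real (card G)) ^ 2" by simp
  then show ?case by (simp only: add_0)
next
  case (Suc k)
  let ?M = "sqrt (2 * real (card G))"
  let ?N = "\<lambda>x. {y. {x, y} \<in> G}"
  have fG: "finite G" using finite_subset[OF Suc.prems(2)] Suc.prems(1) by simp
  have each: "fact (k + 2) * real (card (kcl (?N x) (k + 2) (G \<inter> pairs (?N x)))) \<le> real (deg G x) * ?M ^ (k + 1)" for x
  proof (cases "real (deg G x) \<le> ?M")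
    case True
    have "fact (k + 2) * real (card (kcl (?N x) (k + 2) (G \<inter> pairs (?N x)))) \<le> real (deg G x) ^ (k + 2)"
    proof -
      have "fact (k + 2) * card (kcl (?N x) (k + 2) (G \<inter> pairs (?N x))) \<le> deg G x ^ (k + 2)"
        unfolding deg_def by (rule fact_times_card_kcl_le_power[OF finite_nbhd(1)[OF Suc.prems(2,1)]])
      then have "real (fact (k + 2) * card (kcl (?N x) (k + 2) (G \<inter> pairs (?N x)))) \<le> real (deg G x ^ (k + 2))"
        by (simp only: of_nat_le_iff)
      then show ?thesis by (simp only: of_nat_mult of_nat_fact of_nat_power)
    qed
    also have "\<dots> = real (deg G x) * real (deg G x) ^ (k + 1)" by simp
    also have "\<dots> \<le> real (deg G x) * ?M ^ (k + 1)"
      using True by (intro mult_left_mono power_mono) auto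
    finally show ?thesis .
  next
    case False
    have "fact (k + 2) * real (card (kcl (?N x) (k + 2) (G \<inter> pairs (?N x))))
      \<le> sqrt (2 * real (card (G \<inter> pairs (?N x)))) ^ (k + 2)"
      by (intro Suc.IH finite_nbhd(1)[OF Suc.prems(2,1)]) auto
    also have "\<dots> \<le> ?M ^ (k + 2)"
      using fG by (intro power_mono real_sqrt_le_mono) (auto intro!: card_mono)
    also have "\<dots> = ?M * ?M ^ (k + 1)" by simp
    also have "\<dots> \<le> real (deg G x) * ?M ^ (k + 1)" using False by (intro mult_right_mono) auto
    finally show ?thesis .
  qed
  have "fact (Suc k + 2) * real (card (kcl V (Suc k + 2) G))
    = fact (k + 2) * real (Suc (k + 2) * card (kcl V (Suc (k + 2)) G))"
    by (simp only: add_Suc fact_Suc of_nat_mult mult_ac)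
  also have "\<dots> \<le> fact (k + 2) * real (\<Sum>x\<in>V. card (kcl (?N x) (k + 2) (G \<inter> pairs (?N x))))"
    using Suc_times_card_kcl_le[OF Suc.prems, of "k + 2"] by (intro mult_left_mono) (simp_all only: of_nat_le_iff, simp)
  also have "\<dots> = (\<Sum>x\<in>V. fact (k + 2) * real (card (kcl (?N x) (k + 2) (G \<inter> pairs (?N x)))))"
    by (simp only: of_nat_sum sum_distrib_left)
  also have "\<dots> \<le> (\<Sum>x\<in>V. real (deg G x) * ?M ^ (k + 1))" by (intro sum_mono each)
  also have "\<dots> = real (\<Sum>x\<in>V. deg G x) * ?M ^ (k + 1)"
    by (simp only: of_nat_sum sum_distrib_right)
  also have "\<dots> = ?M ^ 2 * ?M ^ (k + 1)" using sum_deg[OF Suc.prems(2,1)] by simp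
  also have "\<dots> = ?M ^ (Suc k + 2)" by (simp add: power2_eq_square)
  finally show ?case .
qed

lemma card_star_sets_le:
  assumes "G \<subseteq> pairs {1..n}"
  shows "card {S\<in>rsets n r. v \<in> S \<and> S - {v} \<subseteq> {y. {v, y} \<in> G}} \<le> deg G v choose (r - 1)"
proof -
  let ?N = "{y. {v, y} \<in> G}"
  have fin: "finite ?N" using finite_nbhd(1)[OF assms] by simp
  have "card {S\<in>rsets n r. v \<in> S \<and> S - {v} \<subseteq> ?N} \<le> card {T. T \<subseteq> ?N \<and> card T = r - 1}"
  proof (rule card_inj_on_le[where f = "\<lambda>S. S - {v}"])
    show "(\<lambda>S. S - {v}) ` {S\<in>rsets n r. v \<in> S \<and> S - {v} \<subseteq> ?N} \<subseteq> {T. T \<subseteq> ?N \<and> card T = r - 1}"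
      using rsetsD by fastforce
    show "inj_on (\<lambda>S. S - {v}) {S\<in>rsets n r. v \<in> S \<and> S - {v} \<subseteq> ?N}"
      by (auto simp: inj_on_def)
    show "finite {T. T \<subseteq> ?N \<and> card T = r - 1}" using fin by simp
  qed
  also have "\<dots> = deg G v choose (r - 1)" unfolding deg_def by (rule n_subsets[OF fin])
  finally show ?thesis .
qed

text \<open>An \<open>r\<close>-set with \<open>b\<close> vertices in \<open>B\<close> and \<open>a\<close> vertices in \<open>A - B\<close> spans at least
  \<open>(r - b choose 2) - (a choose 2)\<close> non-edges, which exceeds
  \<open>(r choose 2) - (r - 1) * b - (r - 1) * a / 2\<close> by \<open>(b choose 2) + a * (r - a) / 2\<close>. The excess is at
  least 1 except for \<open>(a, b) = (0, 0)\<close>, \<open>(r, 0)\<close> and \<open>(0, 1)\<close>.\<close>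

lemma rset_weight_le:
  fixes p :: real
  assumes G: "G \<subseteq> pairs {1..n}" and r: "3 \<le> r" and p: "0 < p" "p \<le> 1" and S: "S \<in> rsets n r"
    and AB: "\<And>e. e \<in> G \<Longrightarrow> e \<subseteq> A \<or> e \<inter> B \<noteq> {}"
  defines "\<omega> \<equiv> (\<lambda>x. if x \<in> B then p powr (- real (r - 1)) else if x \<in> A then p powr (- real (r - 1) / 2) else 1)"
  shows "p ^ card (pairs S - G) \<le> p ^ (r choose 2)
    + (if pairs S \<subseteq> {e\<in>G. e \<inter> B = {}} then 1 else 0)
    + (if \<exists>v\<in>B. v \<in> S \<and> S - {v} \<subseteq> {y. {v, y} \<in> G} then p ^ (r - 1 choose 2) else 0)
    + p * p ^ (r choose 2) * (\<Prod>x\<in>S. \<omega> x)"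
    (is "_ \<le> ?t1 + ?t2 + ?t3 + ?t4")
proof -
  define b where "b = card (S \<inter> B)"
  define a where "a = card (S \<inter> A - B)"
  have fin: "finite S" and cS: "card S = r" using S rsetsD by auto
  have ab: "a + b \<le> r"
  proof -
    have "a + b = card ((S \<inter> A - B) \<union> (S \<inter> B))"
      unfolding a_def b_def using fin by (subst card_Un_disjoint) auto
    also have "\<dots> \<le> card S" using fin by (intro card_mono) auto
    finally show ?thesis using cS by simp
  qed
  have prod: "(\<Prod>x\<in>S. \<omega> x) = p powr (- real (r - 1) * b - real (r - 1) / 2 * a)"
  proof -
    have "(\<Prod>x\<in>S. \<omega> x) = (\<Prod>x\<in>S. p powr (if x \<in> B then - real (r - 1) else if x \<in> A then - real (r - 1) / 2 else 0))"
      using p by (intro prod.cong) (auto simp: \<omega>_def)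
    also have "\<dots> = p powr (\<Sum>x\<in>S. if x \<in> B then - real (r - 1) else if x \<in> A then - real (r - 1) / 2 else 0)"
      using p by (simp add: powr_sum fin)
    also have "(\<Sum>x\<in>S. if x \<in> B then - real (r - 1) else if x \<in> A then - real (r - 1) / 2 else 0)
      = (\<Sum>x\<in>S. if x \<in> B then - real (r - 1) else 0) + (\<Sum>x\<in>S. if x \<in> A - B then - real (r - 1) / 2 else 0)"
      unfolding sum.distrib[symmetric] by (intro sum.cong) auto
    also have "\<dots> = - real (r - 1) * b - real (r - 1) / 2 * a"
    proof -
      have "{x\<in>S. x \<in> B} = S \<inter> B" "{x\<in>S. x \<in> A - B} = S \<inter> A - B" by auto
      then show ?thesis using fin by (simp add: a_def b_def flip: sum.inter_filter)
    qed
    finally show ?thesis .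
  qed
  have nn: "0 \<le> ?t1" "0 \<le> ?t2" "0 \<le> ?t3" "0 \<le> ?t4" using p by (auto simp: prod)
  \<comment> \<open>The fourth term has a factor \<open>p\<close> to spare, so it covers every set
    with at least one more missing pair than its weights \<open>\<omega>\<close> account
    for.\<close>
  have small: ?thesis
    if "real (card (pairs S - G)) \<ge> real (r choose 2) + 1 - real (r - 1) * b - real (r - 1) / 2 * a"
  proof -
    have "p ^ card (pairs S - G) = p powr real (card (pairs S - G))" using p by (simp add: powr_realpow)
    also have "\<dots> \<le> p powr (1 + real (r choose 2) + (- real (r - 1) * b - real (r - 1) / 2 * a))"
      using that p by (intro powr_mono') auto
    also have "\<dots> = ?t4" unfolding prod using p by (simp add: powr_add powr_realpow)
    finally show ?thesis using nn by linarith
  qed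
  \<comment> \<open>By \<open>AB\<close>, a pair inside \<open>S - B\<close> can be an edge only if
    both its ends lie in \<open>A\<close>.\<close>
  have sub: "pairs (S - B) - pairs (S \<inter> A - B) \<subseteq> pairs S - G"
    using AB by (auto simp: pairs_def)
  have cdiff: "card (pairs (S - B) - pairs (S \<inter> A - B)) = (r - b choose 2) - (a choose 2)"
  proof -
    have "card (S - B) = r - b" using fin cS by (simp add: b_def card_Diff_subset_Int)
    moreover have "pairs (S \<inter> A - B) \<subseteq> pairs (S - B)" by (intro pairs_mono) auto
    ultimately show ?thesis using fin by (simp add: card_Diff_subset card_pairs a_def)
  qed
  have mono: "(a choose 2) \<le> (r - b choose 2)" using ab by (intro binomial_right_mono) auto
  have lower: "real (card (pairs S - G)) \<ge> real (r - b choose 2) - real (a choose 2)"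
  proof -
    have "card (pairs (S - B) - pairs (S \<inter> A - B)) \<le> card (pairs S - G)"
      using fin by (intro card_mono sub) simp
    then show ?thesis using cdiff mono by (simp flip: of_nat_diff)
  qed
  have excess: "real (r - b choose 2) - real (a choose 2) =
      real (r choose 2) - real (r - 1) * b - real (r - 1) / 2 * a + (real b * (real b - 1) / 2 + real a * (real r - real a) / 2)"
    using ab r by (simp add: real_choose_two of_nat_diff field_simps)
  have gains: "real b * (real b - 1) / 2 \<ge> 0" "real a * (real r - real a) / 2 \<ge> 0"
    using ab by (cases b; simp)+
  consider "b \<ge> 2" | "1 \<le> a" "a < r" | "a = 0" "b = 0" | "a = r" "b = 0" | "a = 0" "b = 1"
    using ab by linarith
  then show ?thesis
  proof cases
    case 1
    then have "2 * 1 \<le> real b * (real b - 1)" by (intro mult_mono) auto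
    then show ?thesis using lower excess gains by (intro small) linarith
  next
    case 2
    \<comment> \<open>This is \<open>a * (r - a) \<ge> r - 1\<close> for
      \<open>1 \<le> a \<le> r - 1\<close>; since \<open>r \<ge> 3\<close>, half of it is at least
      1.\<close>
    then have "0 \<le> (real a - 1) * (real r - 1 - real a)" by (intro mult_nonneg_nonneg) auto
    then have "real r - 1 \<le> real a * (real r - real a)" by (simp add: algebra_simps)
    then show ?thesis using lower excess gains r by (intro small) linarith
  next
    case 3
    then have "S \<inter> B = {}" "S \<inter> A - B = {}" using fin by (auto simp: a_def b_def)
    have "e \<notin> G" if e: "e \<in> pairs S" for e
    proof
      assume "e \<in> G"
      moreover obtain x where "x \<in> e" using e by (fastforce simp: pairs_def)
      moreover have "e \<subseteq> S" using e by (auto simp: pairs_def)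
      ultimately show False using AB[of e] \<open>S \<inter> B = {}\<close> \<open>S \<inter> A - B = {}\<close> by blast
    qed
    then have "pairs S - G = pairs S" by blast
    then show ?thesis using nn S by (simp add: card_pairs_rsets)
  next
    case 4
    then have SB: "S \<inter> B = {}" using fin by (auto simp: b_def)
    show ?thesis
    proof (cases "pairs S \<subseteq> G")
      case True
      then have "?t2 = 1" using SB by (auto simp: pairs_def)
      moreover have "p ^ card (pairs S - G) \<le> 1" using p by (simp add: power_le_one)
      ultimately show ?thesis using nn by linarith
    next
      case False
      then have "card (pairs S - G) \<ge> 1" using fin by (simp add: Suc_le_eq card_gt_0_iff)
      moreover have "real (r choose 2) + 1 - real (r - 1) * b - real (r - 1) / 2 * a = 1"
        using 4 r by (simp add: real_choose_two of_nat_diff)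
      ultimately show ?thesis by (intro small) linarith
    qed
  next
    case 5
    then obtain v where v: "S \<inter> B = {v}" by (auto simp: b_def card_1_singleton_iff)
    have SA: "S \<inter> A - B = {}" using 5 fin by (auto simp: a_def)
    show ?thesis
    proof (cases "S - {v} \<subseteq> {y. {v, y} \<in> G}")
      case True
      then have "?t3 = p ^ (r - 1 choose 2)" using v by auto
      moreover have "r - 1 choose 2 \<le> card (pairs S - G)"
        using lower 5 by (simp add: binomial_eq_0)
      then have "p ^ card (pairs S - G) \<le> p ^ (r - 1 choose 2)"
        using p by (intro power_decreasing) auto
      ultimately show ?thesis using nn by linarith
    next
      case False
      then obtain y where y: "y \<in> S" "y \<noteq> v" "{v, y} \<notin> G" by auto
      have "pairs (S - B) \<subseteq> pairs S - G" using sub unfolding SA by simp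
      moreover have "v \<in> S" using v by blast
      then have "{v, y} \<in> pairs S - G" using y by (simp add: pairs_def)
      ultimately have "insert {v, y} (pairs (S - B)) \<subseteq> pairs S - G" by blast
      then have "card (insert {v, y} (pairs (S - B))) \<le> card (pairs S - G)"
        using fin by (intro card_mono) simp
      moreover have "{v, y} \<notin> pairs (S - B)" using v by (blast dest: pairsD)
      moreover have "card (pairs (S - B)) = r - 1 choose 2"
        using cdiff SA 5 by (simp add: binomial_eq_0)
      ultimately have "card (pairs S - G) \<ge> Suc (r - 1 choose 2)" using fin by simp
      then have "real (card (pairs S - G)) \<ge> 1 + real (r - 1 choose 2)" by linarith
      moreover have "real (r choose 2) + 1 - real (r - 1) * b - real (r - 1) / 2 * a = 1 + real (r - 1 choose 2)"
        using 5 r by (simp add: real_choose_two of_nat_diff field_simps)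
      ultimately show ?thesis by (intro small) linarith
    qed
  qed
qed

text \<open>Summation of \<open>rset_weight_le\<close>: the mean, the cliques away from
  \<open>B\<close>, the stars centred in \<open>B\<close>, and an error. For a core,
  \<open>A\<close> and \<open>B\<close> each add to the sum of the weights \<open>\<omega>\<close>
  only \<open>n\<close> times a power of \<open>log (1 / p)\<close>, so the spare factor
  \<open>p\<close> makes the error negligible.\<close>

lemma cexp_le_structured:
  fixes p :: real
  assumes G: "G \<subseteq> pairs {1..n}" and r: "3 \<le> r" and p: "0 < p" "p \<le> 1" and "A \<subseteq> {1..n}" "B \<subseteq> {1..n}"
    and AB: "\<And>e. e \<in> G \<Longrightarrow> e \<subseteq> A \<or> e \<inter> B \<noteq> {}"
  shows "cexp n r p G \<le> cexp n r p {} + sqrt (2 * real (card {e\<in>G. e \<inter> B = {}})) ^ r / fact r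
    + (\<Sum>v\<in>B. real (deg G v) ^ (r - 1)) / fact (r - 1) * p ^ (r - 1 choose 2)
    + p * p ^ (r choose 2) * (card B * p powr (- real (r - 1)) + card A * p powr (- real (r - 1) / 2) + n) ^ r"
proof -
  define \<omega> where "\<omega> = (\<lambda>x. if x \<in> B then p powr (- real (r - 1)) else if x \<in> A then p powr (- real (r - 1) / 2) else 1)"
  let ?G1 = "{e\<in>G. e \<inter> B = {}}"
  let ?st = "\<lambda>S. \<exists>v\<in>B. v \<in> S \<and> S - {v} \<subseteq> {y. {v, y} \<in> G}"
  have finB: "finite B" using assms finite_subset by blast
  have "cexp n r p G \<le> (\<Sum>S\<in>rsets n r. p ^ (r choose 2) + (if pairs S \<subseteq> ?G1 then 1 else 0)
    + (if ?st S then p ^ (r - 1 choose 2) else 0) + p * p ^ (r choose 2) * (\<Prod>x\<in>S. \<omega> x))"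
    unfolding cexp_def \<omega>_def using AB by (intro sum_mono rset_weight_le[OF G r p]) auto
  also have "\<dots> = cexp n r p {} + card {S\<in>rsets n r. pairs S \<subseteq> ?G1}
    + card {S\<in>rsets n r. ?st S} * p ^ (r - 1 choose 2) + p * p ^ (r choose 2) * (\<Sum>S\<in>rsets n r. \<Prod>x\<in>S. \<omega> x)"
    by (simp add: sum.distrib cexp_empty card_rsets flip: sum.inter_filter sum_distrib_left)
  also have "\<dots> \<le> cexp n r p {} + sqrt (2 * real (card ?G1)) ^ r / fact r
    + (\<Sum>v\<in>B. real (deg G v) ^ (r - 1)) / fact (r - 1) * p ^ (r - 1 choose 2)
    + p * p ^ (r choose 2) * (card B * p powr (- real (r - 1)) + card A * p powr (- real (r - 1) / 2) + n) ^ r"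
  proof (intro add_mono order.refl mult_left_mono mult_right_mono)
    have "{S\<in>rsets n r. pairs S \<subseteq> ?G1} = kcl {1..n} r ?G1" by (auto simp: kcl_def rsets_def)
    moreover have "fact r * real (card (kcl {1..n} r ?G1)) \<le> sqrt (2 * real (card ?G1)) ^ r"
    proof -
      have "r - 2 + 2 = r" using r by simp
      then show ?thesis using fact_times_card_kcl_le[of "{1..n}" ?G1 "r - 2"] G by fastforce
    qed
    ultimately show "real (card {S\<in>rsets n r. pairs S \<subseteq> ?G1}) \<le> sqrt (2 * real (card ?G1)) ^ r / fact r"
      by (simp add: field_simps)
    have "card {S\<in>rsets n r. ?st S} \<le> card (\<Union>v\<in>B. {S\<in>rsets n r. v \<in> S \<and> S - {v} \<subseteq> {y. {v, y} \<in> G}})"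
      using finB by (intro card_mono) auto
    also have "\<dots> \<le> (\<Sum>v\<in>B. card {S\<in>rsets n r. v \<in> S \<and> S - {v} \<subseteq> {y. {v, y} \<in> G}})"
      by (rule card_UN_le[OF finB])
    also have "\<dots> \<le> (\<Sum>v\<in>B. deg G v choose (r - 1))"
      by (intro sum_mono card_star_sets_le[OF G])
    finally have "real (card {S\<in>rsets n r. ?st S}) \<le> (\<Sum>v\<in>B. real (deg G v choose (r - 1)))"
      by (simp flip: of_nat_sum)
    also have "\<dots> \<le> (\<Sum>v\<in>B. real (deg G v) ^ (r - 1) / fact (r - 1))"
    proof (intro sum_mono)
      fix v
      have "real ((deg G v choose (r - 1)) * fact (r - 1)) \<le> real (deg G v ^ (r - 1))"
        using binomial_fact_pow[of "deg G v" "r - 1"] of_nat_le_iff by blast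
      then show "real (deg G v choose (r - 1)) \<le> real (deg G v) ^ (r - 1) / fact (r - 1)"
        by (simp add: field_simps)
    qed
    finally show "real (card {S\<in>rsets n r. ?st S}) \<le> (\<Sum>v\<in>B. real (deg G v) ^ (r - 1)) / fact (r - 1)"
      by (simp add: sum_divide_distrib)
    have \<omega>0: "0 \<le> \<omega> x" for x by (simp add: \<omega>_def)
    have "(\<Sum>S\<in>rsets n r. \<Prod>x\<in>S. \<omega> x) = wsum {1..n} (\<lambda>_. 1) r \<omega>"
      by (simp add: wsum_def rsets_def)
    also have "\<dots> \<le> (\<Sum>x\<in>{1..n}. \<omega> x) ^ r" by (intro wsum_const_le_power) (auto simp: \<omega>0)
    also have "\<dots> \<le> (card B * p powr (- real (r - 1)) + card A * p powr (- real (r - 1) / 2) + n) ^ r"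
    proof (intro power_mono sum_nonneg \<omega>0)
      have "(\<Sum>x\<in>{1..n}. \<omega> x) \<le> (\<Sum>x\<in>{1..n}. (if x \<in> B then p powr (- real (r - 1)) else 0)
          + (if x \<in> A then p powr (- real (r - 1) / 2) else 0) + 1)"
        by (intro sum_mono) (auto simp: \<omega>_def)
      also have "\<dots> = card {x\<in>{1..n}. x \<in> B} * p powr (- real (r - 1)) + card {x\<in>{1..n}. x \<in> A} * p powr (- real (r - 1) / 2) + n"
        by (simp add: sum.distrib flip: sum.inter_filter)
      also have "{x\<in>{1..n}. x \<in> B} = B" using assms by auto
      also have "{x\<in>{1..n}. x \<in> A} = A" using assms by auto
      finally show "(\<Sum>x\<in>{1..n}. \<omega> x) \<le> card B * p powr (- real (r - 1)) + card A * p powr (- real (r - 1) / 2) + n" .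
    qed
    finally show "(\<Sum>S\<in>rsets n r. \<Prod>x\<in>S. \<omega> x) \<le> (card B * p powr (- real (r - 1)) + card A * p powr (- real (r - 1) / 2) + n) ^ r" .
  qed (use p in auto)
  finally show ?thesis .
qed

section \<open>Counting structured graphs\<close>

lemma card_small_subsets_le:
  "card {A. A \<subseteq> {1..n} \<and> card A \<le> k} \<le> (n + 1) ^ k"
proof (induction k)
  case 0
  have "{A. A \<subseteq> {1..n} \<and> card A \<le> 0} = {{}}" by (auto dest: finite_subset)
  then show ?case by simp
next
  case (Suc k)
  let ?F = "\<lambda>k. {A. A \<subseteq> {1..n} \<and> card A \<le> k}"
  \<comment> \<open>The number 0 is no vertex and stands for adding nothing, which covers the empty
    set.\<close>
  have "?F (Suc k) \<subseteq> (\<lambda>(x, A). if x = 0 then A else insert x A) ` ({0..n} \<times> ?F k)"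
  proof
    fix A assume A: "A \<in> ?F (Suc k)"
    show "A \<in> (\<lambda>(x, A). if x = 0 then A else insert x A) ` ({0..n} \<times> ?F k)"
    proof (cases "A = {}")
      case True
      then show ?thesis by (intro image_eqI[of _ _ "(0, {})"]) auto
    next
      case False
      then obtain x where x: "x \<in> A" by auto
      have "finite A" using A finite_subset by auto
      then have "card (A - {x}) \<le> k" using A x by (simp, linarith)
      then show ?thesis using A x by (intro image_eqI[of _ _ "(x, A - {x})"]) auto
    qed
  qed
  then have "card (?F (Suc k)) \<le> card ({0..n} \<times> ?F k)"
    by (rule surj_card_le[rotated]) simp
  also have "\<dots> = (n + 1) * card (?F k)" by (simp add: card_cartesian_product)
  finally show ?case using Suc mult_le_mono2[OF Suc, of "n + 1"] by simp
qed

lemma power_self_le_exp_fact: "real m ^ m \<le> exp (real m) * fact m"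
proof -
  have "(\<Sum>k\<in>{m}. real m ^ k /\<^sub>R fact k) \<le> exp (real m)"
    unfolding exp_def by (intro sum_le_suminf summable_exp_generic) auto
  then show ?thesis by (simp add: field_simps)
qed

lemma card_host_le:
  assumes "A \<subseteq> {1..n}" "B \<subseteq> {1..n}"
  shows "card (pairs A \<union> {e\<in>pairs {1..n}. e \<inter> B \<noteq> {}}) \<le> card A ^ 2 + card B * n"
proof -
  have fin: "finite A" "finite B" using assms finite_subset by auto
  have "card (pairs A) = card A * (card A - 1) div 2" using fin by (simp add: card_pairs choose_two)
  also have "\<dots> \<le> card A * (card A - 1)" by simp
  also have "\<dots> \<le> card A * card A" by (rule mult_le_mono2) simp
  finally have 1: "card (pairs A) \<le> card A ^ 2" by (simp add: power2_eq_square)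
  have "{e\<in>pairs {1..n}. e \<inter> B \<noteq> {}} \<subseteq> (\<lambda>(v, y). {v, y}) ` (B \<times> {1..n})"
  proof
    fix e assume e: "e \<in> {e\<in>pairs {1..n}. e \<inter> B \<noteq> {}}"
    then have "e \<subseteq> {1..n}" "card e = 2" by (auto simp: pairs_def)
    moreover then obtain a b where ab: "e = {a, b}" by (auto simp: card_2_iff)
    ultimately show "e \<in> (\<lambda>(v, y). {v, y}) ` (B \<times> {1..n})"
      using e by (cases "a \<in> B") (auto intro: image_eqI[of _ _ "(a, b)"] image_eqI[of _ _ "(b, a)"])
  qed
  then have "card {e\<in>pairs {1..n}. e \<inter> B \<noteq> {}} \<le> card (B \<times> {1..n})"
    using fin by (intro surj_card_le) auto
  then show ?thesis using 1 card_Un_le[of "pairs A" "{e\<in>pairs {1..n}. e \<inter> B \<noteq> {}}"]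
    by (simp add: card_cartesian_product)
qed

text \<open>There are at most \<open>(n + 1) ^ (2 * k)\<close> choices of \<open>(A, B)\<close>;
  each confines the graph to at most \<open>H\<close> pairs, of which \<open>m\<close> are selected,
  and \<open>H ^ m / fact m\<close> is at most \<open>(exp 1 * H / m) ^ m\<close>.\<close>

lemma card_structured_graphs_le:
  fixes H :: real
  assumes m: "m \<ge> 1" and H: "0 \<le> H" and \<G>: "\<And>G. G \<in> \<G> \<Longrightarrow> G \<subseteq> pairs {1..n} \<and> card G = m \<and>
      (\<exists>A B. A \<subseteq> {1..n} \<and> B \<subseteq> {1..n} \<and> card A \<le> k \<and> card B \<le> k \<and>
        real (card A ^ 2 + card B * n) \<le> H \<and> (\<forall>e\<in>G. e \<subseteq> A \<or> e \<inter> B \<noteq> {}))"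
  shows "real (card \<G>) \<le> real (n + 1) ^ (2 * k) * (exp 1 * H / real m) ^ m"
proof -
  let ?P = "{A. A \<subseteq> {1..n} \<and> card A \<le> k}"
  let ?I = "{(A, B) \<in> ?P \<times> ?P. real (card A ^ 2 + card B * n) \<le> H}"
  let ?host = "\<lambda>(A, B). pairs A \<union> {e\<in>pairs {1..n}. e \<inter> B \<noteq> {}}"
  let ?S = "\<lambda>AB. {G. G \<subseteq> ?host AB \<and> card G = m}"
  have finI: "finite ?I" by (rule finite_subset[of _ "?P \<times> ?P"]) auto
  have fin_host: "finite (?host AB)" if "AB \<in> ?I" for AB
  proof -
    obtain A B where ab: "AB = (A, B)" by (cases AB)
    have "finite A" using that finite_subset[of A "{1..n}"] by (simp add: ab)
    then show ?thesis by (simp add: ab)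
  qed
  have sub: "\<G> \<subseteq> (\<Union>AB\<in>?I. ?S AB)"
  proof
    fix G assume "G \<in> \<G>"
    from \<G>[OF this] obtain A B where *: "G \<subseteq> pairs {1..n}" "card G = m" "A \<subseteq> {1..n}" "B \<subseteq> {1..n}" "card A \<le> k" "card B \<le> k"
        "real (card A ^ 2 + card B * n) \<le> H" "\<forall>e\<in>G. e \<subseteq> A \<or> e \<inter> B \<noteq> {}" by blast
    have "G \<subseteq> ?host (A, B)" using *(1,8) by (auto simp: pairs_def)
    then show "G \<in> (\<Union>AB\<in>?I. ?S AB)" using * by (intro UN_I[of "(A, B)"]) auto
  qed
  have each: "real (card (?S AB)) \<le> (exp 1 * H / real m) ^ m" if AB: "AB \<in> ?I" for AB
  proof -
    obtain A B where ab: "AB = (A, B)" by (cases AB)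
    have "card (?host AB) \<le> card A ^ 2 + card B * n"
      using AB card_host_le[of A n B] by (simp add: ab)
    then have "real (card (?host AB)) \<le> real (card A ^ 2 + card B * n)" by (simp only: of_nat_le_iff)
    moreover have "real (card A ^ 2 + card B * n) \<le> H" using AB unfolding ab by blast
    ultimately have h: "real (card (?host AB)) \<le> H" by (rule order_trans)
    have "card (?S AB) * fact m \<le> card (?host AB) ^ m"
      using n_subsets[OF fin_host[OF AB], of m] binomial_fact_pow[of "card (?host AB)" m] by simp
    then have "real (card (?S AB) * fact m) \<le> real (card (?host AB) ^ m)" by (simp only: of_nat_le_iff)
    then have "real (card (?S AB)) * fact m \<le> real (card (?host AB)) ^ m" by simp
    also have "\<dots> \<le> H ^ m" by (intro power_mono h) simp
    finally have "real (card (?S AB)) * fact m \<le> H ^ m" .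
    then have "real (card (?S AB)) * fact m * real m ^ m \<le> H ^ m * (exp (real m) * fact m)"
      using H by (intro mult_mono power_self_le_exp_fact) auto
    then have "real (card (?S AB)) * real m ^ m \<le> H ^ m * exp (real m)"
      by (simp add: mult_ac)
    moreover have "exp (real m) = exp 1 ^ m" by (simp flip: exp_of_nat_mult)
    ultimately show ?thesis using m by (simp add: power_divide power_mult_distrib field_simps)
  qed
  have "card \<G> \<le> card (\<Union>AB\<in>?I. ?S AB)"
    using finI fin_host by (intro card_mono sub finite_UN_I) auto
  also have "\<dots> \<le> (\<Sum>AB\<in>?I. card (?S AB))" by (rule card_UN_le[OF finI])
  finally have "real (card \<G>) \<le> (\<Sum>AB\<in>?I. real (card (?S AB)))" by (simp flip: of_nat_sum)
  also have "\<dots> \<le> (\<Sum>AB\<in>?I. (exp 1 * H / real m) ^ m)" by (intro sum_mono each)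
  also have "\<dots> = real (card ?I) * (exp 1 * H / real m) ^ m" by simp
  also have "\<dots> \<le> real (n + 1) ^ (2 * k) * (exp 1 * H / real m) ^ m"
  proof (rule mult_right_mono)
    have "card ?I \<le> card (?P \<times> ?P)" by (intro card_mono) auto
    also have "\<dots> \<le> (n + 1) ^ k * (n + 1) ^ k"
      unfolding card_cartesian_product by (intro mult_le_mono card_small_subsets_le)
    finally have "card ?I \<le> (n + 1) ^ (2 * k)" by (simp only: mult_2 power_add)
    then have "real (card ?I) \<le> real ((n + 1) ^ (2 * k))" by (simp only: of_nat_le_iff)
    then show "real (card ?I) \<le> real (n + 1) ^ (2 * k)" by (simp only: of_nat_power)
  qed (use H in simp)
  finally show ?thesis .
qed

section \<open>The staircase function of hub degrees\<close>

text \<open>The least total degree, in units of \<open>n\<close>, of hubs that carry as many stars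
  as \<open>t\<close> full ones. A hub of degree \<open>x * n\<close> is worth
  \<open>x powr q\<close> full hubs, so it is best to fill hubs completely and leave one partial.
  With \<open>q = r - 1\<close> this is the numerator of the second summand of
  \<open>psi\<close>.\<close>

definition stair :: "real \<Rightarrow> real \<Rightarrow> real" where
  "stair q t = of_int \<lfloor>t\<rfloor> + frac t powr (1 / q)"

lemma le_powr_self:
  fixes x \<beta> :: real
  assumes "0 \<le> x" "x \<le> 1" "0 < \<beta>" "\<beta> \<le> 1"
  shows "x \<le> x powr \<beta>"
  using assms powr_mono'[of \<beta> 1 x] by (cases "x = 0") auto

lemma powr_subadditive:
  fixes x y \<beta> :: real
  assumes "0 \<le> x" "0 \<le> y" "0 < \<beta>" "\<beta> \<le> 1"
  shows "(x + y) powr \<beta> \<le> x powr \<beta> + y powr \<beta>"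
proof (cases "x + y = 0")
  case False
  then have pos: "x + y > 0" using assms by simp
  have "x / (x + y) \<le> (x / (x + y)) powr \<beta>" "y / (x + y) \<le> (y / (x + y)) powr \<beta>"
    using assms pos by (intro le_powr_self; simp)+
  moreover have "x / (x + y) + y / (x + y) = 1" using pos by (simp flip: add_divide_distrib)
  ultimately have "1 \<le> (x powr \<beta> + y powr \<beta>) / (x + y) powr \<beta>"
    using assms pos by (simp add: powr_divide add_divide_distrib)
  then show ?thesis using pos by (simp add: field_simps)
qed (use assms in auto)

text \<open>Concavity of the power function between \<open>y\<close> and 1. Young's inequality with
  second factor 1 is the tangent bound at \<open>?x\<close>; the tangent bounds at the two ends are
  averaged.\<close>

lemma powr_concave_to_1:
  fixes y a b \<beta> :: real
  assumes "0 \<le> y" "0 \<le> a" "0 \<le> b" "a + b = 1" "0 < \<beta>" "\<beta> \<le> 1"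
  shows "a * y powr \<beta> + b \<le> (a * y + b) powr \<beta>"
proof (cases "y = 0")
  case True
  then show ?thesis using assms le_powr_self[of b \<beta>] by simp
next
  case False
  let ?x = "a * y + b"
  have x: "?x > 0" using assms False by (cases "a = 0") (auto intro: add_pos_nonneg)
  have "(y / ?x) powr \<beta> * 1 powr (1 - \<beta>) \<le> \<beta> * (y / ?x) + (1 - \<beta>) * 1"
    using assms x False by (intro Youngs_inequality_0) auto
  moreover have "(1 / ?x) powr \<beta> * 1 powr (1 - \<beta>) \<le> \<beta> * (1 / ?x) + (1 - \<beta>) * 1"
    using assms x by (intro Youngs_inequality_0) auto
  ultimately have "a * (y / ?x) powr \<beta> + b * (1 / ?x) powr \<beta>
    \<le> a * (\<beta> * (y / ?x) + (1 - \<beta>)) + b * (\<beta> * (1 / ?x) + (1 - \<beta>))"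
    using assms by (intro add_mono mult_left_mono) auto
  also have "\<dots> = \<beta> * ((a * y + b) / ?x) + (a + b) * (1 - \<beta>)"
    by (simp only: add_divide_distrib) (simp add: algebra_simps)
  also have "\<dots> = 1" using x assms by simp
  finally have "(a * y powr \<beta> + b) / ?x powr \<beta> \<le> 1"
    using assms x by (simp add: powr_divide add_divide_distrib)
  then show ?thesis using x by (simp add: field_simps)
qed

text \<open>The point \<open>(f, u)\<close> lies on the segment between \<open>(y, 1)\<close> and
  \<open>(1, y)\<close> with \<open>y = f + u - 1\<close>, at position \<open>l\<close>, so a
  concave function favours it over the ends. For \<open>y = 1\<close> the segment is a
  point.\<close>

lemma powr_majorization:
  fixes f u \<beta> :: real
  assumes "f \<le> 1" "u \<le> 1" "1 \<le> f + u" "0 < \<beta>" "\<beta> \<le> 1"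
  shows "1 + (f + u - 1) powr \<beta> \<le> f powr \<beta> + u powr \<beta>"
proof (cases "f + u - 1 = 1")
  case False
  define y where "y = f + u - 1"
  define l where "l = (1 - u) / (1 - y)"
  have y: "0 \<le> y" "y < 1" using assms False by (auto simp: y_def)
  have l: "0 \<le> l" "l \<le> 1" "l * (1 - y) = 1 - u" using assms y by (auto simp: l_def y_def field_simps)
  have "(1 - l) * y powr \<beta> + l \<le> ((1 - l) * y + l) powr \<beta>"
    using assms y l by (intro powr_concave_to_1) auto
  moreover have "l * y powr \<beta> + (1 - l) \<le> (l * y + (1 - l)) powr \<beta>"
    using assms y l by (intro powr_concave_to_1) auto
  moreover have "(1 - l) * y + l = f" "l * y + (1 - l) = u" using l(3) by (auto simp: algebra_simps y_def)
  ultimately show ?thesis by (simp add: y_def[symmetric] algebra_simps)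
next
  case True
  then have "f = 1" "u = 1" using assms by linarith+
  then show ?thesis by simp
qed

lemma stair_mono: "\<lbrakk>1 \<le> q; s \<le> t\<rbrakk> \<Longrightarrow> stair q s \<le> stair q t"
proof (cases "\<lfloor>s\<rfloor> = \<lfloor>t\<rfloor>")
  case True
  assume "1 \<le> q" "s \<le> t"
  then show ?thesis using True of_int_floor_le[of s]
    by (auto simp: stair_def frac_def intro!: powr_mono2)
next
  case False
  assume q: "1 \<le> q" and st: "s \<le> t"
  then have "\<lfloor>s\<rfloor> + 1 \<le> \<lfloor>t\<rfloor>" using False floor_mono[OF st] by linarith
  moreover have "frac s powr (1 / q) \<le> 1" using q frac_lt_1[of s] by (intro powr_le1) auto
  moreover have "0 \<le> frac t powr (1 / q)" by simp
  ultimately show ?thesis unfolding stair_def by linarith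
qed

lemma stair_ge: "1 \<le> q \<Longrightarrow> t \<le> stair q t"
  using le_powr_self[of "frac t" "1 / q"] frac_lt_1[of t] by (simp add: stair_def frac_def)

lemma stair_le: "1 \<le> q \<Longrightarrow> stair q t \<le> t + 1"
proof -
  assume "1 \<le> q"
  then have "frac t powr (1 / q) \<le> 1" using frac_lt_1[of t] by (intro powr_le1) auto
  then show ?thesis unfolding stair_def by linarith
qed

lemma stair_nonneg: "0 \<le> t \<Longrightarrow> 0 \<le> stair q t"
  by (simp add: stair_def)

text \<open>If the fractional parts add without a carry, this is subadditivity of the power. With a
  carry, a full hub plus the remainder costs no more than two partial hubs, which is
  \<open>powr_majorization\<close>.\<close>

lemma stair_add_le:
  assumes "1 \<le> q" "0 \<le> u" "u \<le> 1"
  shows "stair q (t + u) \<le> stair q t + u powr (1 / q)"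
proof (cases "u = 1")
  case True
  then show ?thesis by (simp add: stair_def frac_def)
next
  case False
  then have u: "u < 1" using assms by simp
  have fu: "frac u = u" "\<lfloor>u\<rfloor> = 0" using u assms by (auto simp: frac_eq floor_eq_iff)
  show ?thesis
  proof (cases "frac t + u < 1")
    case True
    then have "\<lfloor>t + u\<rfloor> = \<lfloor>t\<rfloor>" "frac (t + u) = frac t + u" using fu by (simp_all add: floor_add frac_add)
    then show ?thesis using powr_subadditive[of "frac t" u "1 / q"] assms by (simp add: stair_def)
  next
    case False
    then have "\<lfloor>t + u\<rfloor> = \<lfloor>t\<rfloor> + 1" "frac (t + u) = frac t + u - 1" using fu by (simp_all add: floor_add frac_add)
    then show ?thesis using powr_majorization[of "frac t" u "1 / q"] assms False u frac_lt_1[of t]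
      by (simp add: stair_def)
  qed
qed

text \<open>Adding the hubs one at a time with \<open>stair_add_le\<close> shows that full hubs are
  optimal; this is where the floor in \<open>psi\<close> comes from.\<close>

lemma stair_sum_le:
  assumes "finite B" "1 \<le> q" "\<And>v. v \<in> B \<Longrightarrow> 0 \<le> \<theta> v \<and> \<theta> v \<le> 1"
  shows "stair q (\<Sum>v\<in>B. \<theta> v powr q) \<le> (\<Sum>v\<in>B. \<theta> v)"
  using assms(1,3)
proof (induction B rule: finite_induct)
  case empty
  then show ?case by (simp add: stair_def)
next
  case (insert x B)
  have "stair q (\<Sum>v\<in>insert x B. \<theta> v powr q) = stair q ((\<Sum>v\<in>B. \<theta> v powr q) + \<theta> x powr q)"
    using insert by (simp add: add.commute)
  also have "\<dots> \<le> stair q (\<Sum>v\<in>B. \<theta> v powr q) + (\<theta> x powr q) powr (1 / q)"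
    using insert assms(2) by (intro stair_add_le powr_le1) auto
  also have "(\<theta> x powr q) powr (1 / q) = \<theta> x" using insert assms(2) by (simp add: powr_powr)
  finally show ?case using insert by simp
qed

section \<open>The asymptotic regime\<close>

lemma binomial_asymp: "(\<lambda>n. real (n choose k) * fact k / real n ^ k) \<longlonglongrightarrow> 1"
proof (induction k)
  case 0
  then show ?case by simp
next
  case (Suc k)
  have "(\<lambda>n. (real n - real k) / real n) \<longlonglongrightarrow> 1" by real_asymp
  from tendsto_mult[OF Suc this]
  have T: "(\<lambda>n. real (n choose k) * fact k / real n ^ k * ((real n - real k) / real n)) \<longlonglongrightarrow> 1" by simp
  have E: "real (n choose k) * fact k / real n ^ k * ((real n - real k) / real n)
    = real (n choose Suc k) * fact (Suc k) / real n ^ Suc k" if "n \<ge> k" for n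
  proof -
    have "(Suc k) * (n choose Suc k) = (n - k) * (n choose k)"
      using binomial_absorb_comp[of n k] by (metis binomial_absorption mult.commute times_binomial_minus1_eq Suc_times_binomial_eq diff_Suc_1 binomial_absorption)
    then have "real (Suc k) * real (n choose Suc k) = (real n - real k) * real (n choose k)"
      using that by (metis of_nat_mult of_nat_diff)
    then have "real (n choose Suc k) * fact (Suc k) = (real n - real k) * real (n choose k) * fact k"
      by (simp only: fact_Suc of_nat_mult mult.assoc mult.left_commute mult.commute)
    then show ?thesis by (simp add: mult_ac)
  qed
  show ?case
    by (rule Lim_transform_eventually[OF T eventually_mono[OF eventually_ge_at_top E]])
qed

text \<open>For \<open>\<kappa> > 0\<close> the sequence \<open>k\<close> tends to infinity and
  \<open>binomial_asymp\<close> applies. For \<open>\<kappa> = 0\<close> it may stay bounded, and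
  the upper bound \<open>k n ^ m\<close> is enough.\<close>

lemma binomial_proportion:
  fixes k :: "nat \<Rightarrow> nat" and g :: "nat \<Rightarrow> real"
  assumes lim: "(\<lambda>n. real (k n) / g n) \<longlonglongrightarrow> \<kappa>" and g: "filterlim g at_top sequentially"
    and "0 \<le> \<kappa>" "0 < m"
  shows "(\<lambda>n. real (k n choose m) * fact m / g n ^ m) \<longlonglongrightarrow> \<kappa> ^ m"
proof -
  have g0: "eventually (\<lambda>n. g n > 0) sequentially" using g by (simp add: filterlim_at_top_dense)
  have pow: "(\<lambda>n. (real (k n) / g n) ^ m) \<longlonglongrightarrow> \<kappa> ^ m" by (intro tendsto_power lim)
  show ?thesis
  proof (cases "\<kappa> = 0")
    case True
    have "(\<lambda>n. real (k n choose m) * fact m / g n ^ m) \<longlonglongrightarrow> 0"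
    proof (rule tendsto_sandwich[OF _ _ tendsto_const])
      show "(\<lambda>n. (real (k n) / g n) ^ m) \<longlonglongrightarrow> 0" using pow True \<open>0 < m\<close> by (simp add: zero_power)
      show "eventually (\<lambda>n. 0 \<le> real (k n choose m) * fact m / g n ^ m) sequentially"
        using g0 by eventually_elim simp
      show "eventually (\<lambda>n. real (k n choose m) * fact m / g n ^ m \<le> (real (k n) / g n) ^ m) sequentially"
        using g0
      proof eventually_elim
        case (elim n)
        have "real ((k n choose m) * fact m) \<le> real (k n ^ m)"
          using binomial_fact_pow[of "k n" m] by (simp only: of_nat_le_iff)
        then show ?case using elim by (simp add: power_divide divide_right_mono)
      qed
    qed
    then show ?thesis using True \<open>0 < m\<close> by (simp add: zero_power)
  next
    case False
    then have "\<kappa> > 0" using \<open>0 \<le> \<kappa>\<close> by simp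
    have A: "filterlim (\<lambda>n. real (k n) / g n * g n) at_top sequentially"
      by (rule filterlim_tendsto_pos_mult_at_top[OF lim \<open>\<kappa> > 0\<close> g])
    have "eventually (\<lambda>n. real (k n) / g n * g n = real (k n)) sequentially"
      using g0 by eventually_elim simp
    from filterlim_cong[OF refl refl this] have "filterlim (\<lambda>n. real (k n)) at_top sequentially"
      using A by (rule iffD1)
    then have k: "filterlim k at_top sequentially" by (simp only: filterlim_sequentially_iff_filterlim_real)
    then have k1: "eventually (\<lambda>n. k n \<ge> 1) sequentially" by (simp add: filterlim_at_top)
    have "(\<lambda>n. real (k n choose m) * fact m / real (k n) ^ m * (real (k n) / g n) ^ m) \<longlonglongrightarrow> 1 * \<kappa> ^ m"
      by (intro tendsto_mult pow filterlim_compose[OF binomial_asymp k])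
    moreover have "eventually (\<lambda>n. real (k n choose m) * fact m / real (k n) ^ m * (real (k n) / g n) ^ m
        = real (k n choose m) * fact m / g n ^ m) sequentially"
      using k1 g0 by eventually_elim (simp add: power_divide)
    ultimately have "(\<lambda>n. real (k n choose m) * fact m / g n ^ m) \<longlonglongrightarrow> 1 * \<kappa> ^ m"
      by (rule Lim_transform_eventually)
    then show ?thesis by simp
  qed
qed

lemma nat_floor_proportion:
  assumes "0 \<le> \<theta>" "0 < k"
  shows "(\<lambda>n. real (nat \<lfloor>\<theta> * real n\<rfloor>) / real n) \<longlonglongrightarrow> \<theta>"
    "(\<lambda>n. real (nat \<lfloor>\<theta> * real n\<rfloor> choose k) * fact k / real n ^ k) \<longlonglongrightarrow> \<theta> ^ k"
proof -
  let ?m = "\<lambda>n. nat \<lfloor>\<theta> * real n\<rfloor>"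
  have mr: "real (?m n) = of_int \<lfloor>\<theta> * real n\<rfloor>" for n using assms by simp
  show lim: "(\<lambda>n. real (?m n) / real n) \<longlonglongrightarrow> \<theta>"
  proof (rule tendsto_sandwich)
    show "eventually (\<lambda>n. \<theta> - 1 / real n \<le> real (?m n) / real n) sequentially"
      using eventually_gt_at_top[of 0]
    proof eventually_elim
      case (elim n)
      have "\<theta> * real n - 1 \<le> real (?m n)" unfolding mr by linarith
      then have "(\<theta> * real n - 1) / real n \<le> real (?m n) / real n" by (rule divide_right_mono) simp
      then show ?case using elim by (simp add: diff_divide_distrib)
    qed
    show "eventually (\<lambda>n. real (?m n) / real n \<le> \<theta>) sequentially"
      using eventually_gt_at_top[of 0]
    proof eventually_elim
      case (elim n)
      then show ?case unfolding mr by (simp add: pos_divide_le_eq)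
    qed
    show "(\<lambda>n. \<theta> - 1 / real n) \<longlonglongrightarrow> \<theta>" by real_asymp
  qed (rule tendsto_const)
  show "(\<lambda>n. real (?m n choose k) * fact k / real n ^ k) \<longlonglongrightarrow> \<theta> ^ k"
    by (intro binomial_proportion lim filterlim_real_sequentially assms)
qed

locale clique_regime =
  fixes r :: nat and p :: "nat \<Rightarrow> real"
  assumes r: "r \<ge> 3" and p01: "\<And>n. 0 \<le> p n \<and> p n \<le> 1"
    and p_lower: "(\<lambda>n. ln (real n) powr (1 / (real r - 2)) / real n) \<in> o(\<lambda>n. p n powr ((real r - 1) / 2))"
    and p_upper: "(\<lambda>n. p n powr ((real r - 1) / 2)) \<in> o(\<lambda>_. 1)"
begin

text \<open>A planted clique has order \<open>s n\<close>, and a vertex adjacent to all others adds a fraction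
  \<open>r / c n\<close> of the mean.\<close>

definition s :: "nat \<Rightarrow> real" where "s n = real n * p n powr (real (r - 1) / 2)"
definition c :: "nat \<Rightarrow> real" where "c n = real n * p n ^ (r - 1)"
definition L :: "nat \<Rightarrow> real" where "L n = ln (1 / p n)"
definition mean :: "nat \<Rightarrow> real" where "mean n = cexp n r (p n) {}"

lemma r_real: "real (r - 1) = real r - 1" "real (r - 2) = real r - 2"
  using r by (simp_all add: of_nat_diff)

lemma p_tendsto_0: "p \<longlonglongrightarrow> 0"
proof -
  have "(\<lambda>n. p n powr ((real r - 1) / 2)) \<longlonglongrightarrow> 0"
    using smalloD_tendsto[OF p_upper] by simp
  then have "(\<lambda>n. (p n powr ((real r - 1) / 2)) powr (2 / (real r - 1))) \<longlonglongrightarrow> 0 powr (2 / (real r - 1))"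
    using r by (intro tendsto_powr') auto
  moreover have "(p n powr ((real r - 1) / 2)) powr (2 / (real r - 1)) = p n" for n
  proof -
    have "(real r - 1) / 2 * (2 / (real r - 1)) = 1" using r by simp
    then show ?thesis using p01[of n] by (simp only: powr_powr powr_one)
  qed
  ultimately show ?thesis by simp
qed

lemma eventually_p_less: "e > 0 \<Longrightarrow> eventually (\<lambda>n. p n < e) sequentially"
  using order_tendstoD(2)[OF p_tendsto_0] by simp

lemma eventually_p_pos: "eventually (\<lambda>n. p n > 0) sequentially"
proof -
  have "eventually (\<lambda>n. norm (ln (real n) powr (1 / (real r - 2)) / real n) \<le> 1 * norm (p n powr ((real r - 1) / 2))) sequentially"
    using landau_o.smallD[OF p_lower, of 1] by simp
  moreover have "eventually (\<lambda>n. n \<ge> (2::nat)) sequentially" by (rule eventually_ge_at_top)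
  ultimately show ?thesis
  proof eventually_elim
    case (elim n)
    have "norm (ln (real n) powr (1 / (real r - 2)) / real n) > 0" using elim(2) by auto
    then have "p n \<noteq> 0" using elim(1) by (intro notI) simp
    then show ?case using p01[of n] by simp
  qed
qed

lemma eventually_p: "eventually (\<lambda>n. 0 < p n \<and> p n < 1 \<and> n > 0) sequentially"
  using eventually_p_pos eventually_p_less[OF zero_less_one] eventually_gt_at_top[of 0]
  by eventually_elim auto

lemma p_eq_exp: "p n > 0 \<Longrightarrow> p n = exp (- L n)"
  by (simp add: L_def ln_div)

lemma L_at_top: "filterlim L at_top sequentially"
proof -
  have "filterlim p (at_right 0) sequentially"
    using p_tendsto_0 eventually_p_pos unfolding filterlim_at by (auto elim: eventually_mono)
  then have "filterlim (\<lambda>n. - ln (p n)) at_top sequentially"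
    unfolding filterlim_uminus_at_bot[symmetric]
    by (intro filterlim_compose[OF ln_at_0]) (simp add: filterlim_compose)
  then show ?thesis
    by (rule filterlim_mono_eventually) (use eventually_p_pos in \<open>auto simp: L_def ln_div elim: eventually_mono\<close>)
qed

lemma eventually_L_ge: "eventually (\<lambda>n. L n \<ge> C) sequentially"
  using L_at_top by (simp add: filterlim_at_top)

text \<open>In terms of \<open>L\<close> the edge probability is \<open>exp (- L n)\<close>, so any
  positive power of it beats every power of \<open>L\<close>. The error terms for cores vanish for
  this reason.\<close>

lemma polylog_times_p: 
  assumes "b > 0"
  shows "(\<lambda>n. L n powr C * p n powr b) \<longlonglongrightarrow> 0"
proof -
  have "((\<lambda>x. x powr C * exp (- x) powr b) \<longlongrightarrow> 0) at_top"
    using assms by real_asymp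
  then have "(\<lambda>n. L n powr C * exp (- L n) powr b) \<longlonglongrightarrow> 0"
    by (rule filterlim_compose[OF _ L_at_top])
  then show ?thesis
    by (rule Lim_transform_eventually) (use eventually_p_pos in \<open>auto simp: p_eq_exp[symmetric] elim: eventually_mono\<close>)
qed

lemma s_pos: "p n > 0 \<Longrightarrow> n > 0 \<Longrightarrow> s n > 0"
  by (simp add: s_def)

text \<open>This is why a hub with \<open>n\<close> edges costs \<open>1 / c n\<close> in the unit
  \<open>s n ^ 2\<close> of edges.\<close>

lemma s_sq: "s n ^ 2 = real n * c n"
proof -
  have "(p n powr (real (r - 1) / 2)) ^ 2 = p n ^ (r - 1)"
  proof (cases "p n = 0")
    case False
    then have "p n > 0" using p01[of n] by simp
    then show ?thesis using powr_power[of "p n" "real (r - 1) / 2" 2] by (simp add: powr_realpow)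
  qed (use r in simp)
  then show ?thesis by (simp add: s_def c_def power_mult_distrib) (simp add: power2_eq_square)
qed

lemma log_tail_ratio_eq: "log_tail_ratio r \<delta> p n = - ln (upper_tail_prob r n (p n) \<delta>) / (s n ^ 2 * L n)"
proof -
  have "real n ^ 2 * p n ^ (r - 1) = s n ^ 2" unfolding s_sq c_def by (simp add: power2_eq_square)
  then show ?thesis unfolding log_tail_ratio_def L_def by (simp only:)
qed

lemma ln_powr_over_s: "(\<lambda>n. ln (real n) powr (1 / real (r - 2)) / s n) \<longlonglongrightarrow> 0"
  using smalloD_tendsto[OF p_lower] unfolding s_def r_real by simp

lemma s_at_top: "filterlim s at_top sequentially"
proof -
  have "filterlim (\<lambda>n. ln (real n) powr (1 / real (r - 2))) at_top sequentially"
    using r by real_asymp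
  moreover have "eventually (\<lambda>n. ln (real n) powr (1 / real (r - 2)) \<le> s n) sequentially"
    using order_tendstoD(2)[OF ln_powr_over_s zero_less_one] eventually_p
  proof eventually_elim
    case (elim n)
    then show ?case using s_pos[of n] by (simp add: field_simps)
  qed
  ultimately show ?thesis by (rule filterlim_at_top_mono)
qed

text \<open>The cost \<open>ln n\<close> of naming a vertex is to be shared by its edges, of which
  there are about \<open>s n / L n powr (1 / (r - 2))\<close>, and to be negligible against the gain
  \<open>L n\<close> of each edge. For large \<open>L n\<close> this is the assumed lower bound on
  \<open>p\<close>; for small \<open>L n\<close> the value \<open>s n\<close> is at least the square
  root of \<open>n\<close>.\<close>

lemma ln_over_sL: "(\<lambda>n. ln (real n) * L n powr (1 / real (r - 2)) / (s n * L n)) \<longlonglongrightarrow> 0"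
proof -
  define \<kappa> where "\<kappa> = 1 / real (r - 2)"
  have \<kappa>: "0 < \<kappa>" "\<kappa> \<le> 1" using r by (auto simp: \<kappa>_def)
  define g where "g = (\<lambda>n. real (r - 1) powr (1 - \<kappa>) * (ln (real n) powr \<kappa> / s n) + ln (real n) / sqrt (real n))"
  have "g \<longlonglongrightarrow> real (r - 1) powr (1 - \<kappa>) * 0 + 0"
    unfolding g_def \<kappa>_def
  proof (intro tendsto_add tendsto_mult tendsto_const ln_powr_over_s)
    show "(\<lambda>n. ln (real n) / sqrt (real n)) \<longlonglongrightarrow> 0" by real_asymp
  qed
  then have g: "g \<longlonglongrightarrow> 0" by simp
  show ?thesis
  proof (rule tendsto_sandwich[OF _ _ tendsto_const g])
    have ev: "eventually (\<lambda>n. 0 < p n \<and> p n < 1 \<and> n > 0 \<and> L n \<ge> 1 \<and> n \<ge> 2) sequentially"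
      using eventually_p eventually_L_ge[of 1] eventually_ge_at_top[of 2] by eventually_elim auto
    then show "eventually (\<lambda>n. 0 \<le> ln (real n) * L n powr (1 / real (r - 2)) / (s n * L n)) sequentially"
      by eventually_elim (auto intro!: divide_nonneg_nonneg mult_nonneg_nonneg simp: s_def)
    show "eventually (\<lambda>n. ln (real n) * L n powr (1 / real (r - 2)) / (s n * L n) \<le> g n) sequentially"
      using ev
    proof eventually_elim
      case (elim n)
      have s: "s n > 0" using elim by (intro s_pos) auto
      have ln: "ln (real n) > 0" using elim by simp
      have eq: "ln (real n) * L n powr (1 / real (r - 2)) / (s n * L n) = ln (real n) * L n powr (\<kappa> - 1) / s n"
        using elim by (simp add: powr_diff \<kappa>_def)
      show ?case
      \<comment> \<open>The two cases meet at \<open>p n = n powr (- 1 / (r - 1))\<close>, that is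
        at \<open>c n = 1\<close>.\<close>
      proof (cases "L n \<ge> ln (real n) / real (r - 1)")
        case True
        have r1: "real (r - 1) > 0" using r by simp
        have "L n powr (\<kappa> - 1) \<le> (ln (real n) / real (r - 1)) powr (\<kappa> - 1)"
          using True ln r1 \<kappa> by (intro powr_mono2') auto
        also have "\<dots> = ln (real n) powr \<kappa> / ln (real n) * real (r - 1) powr (1 - \<kappa>)"
          using ln r1 by (simp add: powr_divide powr_diff)
        finally have "ln (real n) * L n powr (\<kappa> - 1) / s n \<le> ln (real n) * (ln (real n) powr \<kappa> / ln (real n) * real (r - 1) powr (1 - \<kappa>)) / s n"
          using s ln by (intro divide_right_mono mult_left_mono) auto
        also have "\<dots> = real (r - 1) powr (1 - \<kappa>) * (ln (real n) powr \<kappa> / s n)" using ln by simp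
        also have "\<dots> \<le> g n" using ln by (simp add: g_def)
        finally show ?thesis unfolding eq .
      next
        case False
        have r1: "real (r - 1) > 0" using r by simp
        have "sqrt (real n) = real n * real n powr (- 1 / 2)"
          using elim by (simp add: powr_minus_divide powr_half_sqrt real_div_sqrt)
        also have "\<dots> = real n * exp (- (ln (real n) / real (r - 1)) * (real (r - 1) / 2))"
          using elim r1 by (simp add: powr_def)
        also have "\<dots> \<le> real n * exp (- L n * (real (r - 1) / 2))"
        proof -
          have "L n * (real (r - 1) / 2) \<le> ln (real n) / real (r - 1) * (real (r - 1) / 2)"
            using False r1 by (intro mult_right_mono) linarith+
          then show ?thesis by (intro mult_left_mono) simp_all
        qed
        also have "\<dots> = s n" using elim by (subst s_def) (simp add: powr_def L_def ln_div)
        finally have "sqrt (real n) \<le> s n" .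
        moreover have "L n powr (\<kappa> - 1) \<le> 1" using elim \<kappa> powr_mono[of "\<kappa> - 1" 0 "L n"] by simp
        ultimately have "ln (real n) * L n powr (\<kappa> - 1) / s n \<le> ln (real n) * 1 / sqrt (real n)"
          using ln elim s by (intro frac_le mult_left_mono) auto
        also have "\<dots> \<le> g n" using s by (simp add: g_def)
        finally show ?thesis unfolding eq .
      qed
    qed
  qed
qed

text \<open>The exponent of \<open>p n\<close> is \<open>r * (r - 1) / 2\<close>; thus
  \<open>s n ^ r / fact r\<close> is the mean up to a factor tending to 1.\<close>

lemma s_power_r: "p n > 0 \<Longrightarrow> s n ^ r = real n ^ r * p n ^ (r choose 2)"
proof -
  assume p: "p n > 0"
  have "(p n powr (real (r - 1) / 2)) ^ r = p n powr (real (r choose 2))"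
    using p powr_power[of "p n" "real (r - 1) / 2" r] r by (simp add: real_choose_two r_real)
  then show ?thesis using p by (simp add: s_def power_mult_distrib powr_realpow)
qed

lemma mean_asymp: "(\<lambda>n. mean n * fact r / s n ^ r) \<longlonglongrightarrow> 1"
  by (rule Lim_transform_eventually[OF binomial_asymp[of r]])
    (use eventually_p in \<open>auto simp: mean_def cexp_empty s_power_r elim!: eventually_mono\<close>)

lemma eventually_mean_bounds: "eventually (\<lambda>n. s n ^ r / (2 * fact r) \<le> mean n \<and> 0 < mean n) sequentially"
proof -
  have "eventually (\<lambda>n. mean n * fact r / s n ^ r > 1 / 2) sequentially"
    using order_tendstoD(1)[OF mean_asymp, of "1/2"] by simp
  then show ?thesis using eventually_p
  proof eventually_elim
    case (elim n)
    have s: "s n ^ r > 0" using s_pos elim by simp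
    then have "s n ^ r / (2 * fact r) \<le> mean n" using elim by (simp add: field_simps)
    moreover have "s n ^ r / (2 * fact r) > 0" using s by simp
    ultimately show ?case by linarith
  qed
qed

end

section \<open>Cores\<close>

lemma card_high_deg_le:
  assumes "G \<subseteq> pairs V" "finite V" "0 \<le> t"
  shows "real (card {x\<in>V. t \<le> real (deg G x)}) * t \<le> 2 * real (card G)"
proof -
  have "real (card {x\<in>V. t \<le> real (deg G x)}) * t = (\<Sum>x\<in>{x\<in>V. t \<le> real (deg G x)}. t)" by simp
  also have "\<dots> \<le> (\<Sum>x\<in>{x\<in>V. t \<le> real (deg G x)}. real (deg G x))" by (intro sum_mono) auto
  also have "\<dots> \<le> (\<Sum>x\<in>V. real (deg G x))" using assms by (intro sum_mono2) auto
  also have "\<dots> = real (\<Sum>x\<in>V. deg G x)" by simp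
  also have "\<dots> = 2 * real (card G)" unfolding sum_deg[OF assms(1,2)] by simp
  finally show ?thesis .
qed

context clique_regime
begin

text \<open>The threshold is \<open>\<eta> * mean n\<close> over the size scale, so that discarding
  \<open>K * (s n ^ 2 * L n)\<close> edges below it loses at most
  \<open>K * \<eta> * mean n\<close>. The size needs its factor \<open>L n\<close> because Markov's
  inequality gains only a constant factor for every \<open>r choose 2\<close> revealed edges, while
  the target probability is exponential in \<open>s n ^ 2 * L n\<close>.\<close>

definition core :: "real \<Rightarrow> real \<Rightarrow> real \<Rightarrow> nat \<Rightarrow> nat set set set" where
  "core K d \<eta> n = {G. G \<subseteq> pairs {1..n} \<and> real (card G) \<le> K * (s n ^ 2 * L n) \<and>
     (1 + d) * mean n \<le> cexp n r (p n) G \<and>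
     (\<forall>e\<in>G. \<eta> * mean n / (s n ^ 2 * L n) \<le> cexp n r (p n) G - cexp n r (p n) (G - {e}))}"

text \<open>An edge at a vertex of degree below \<open>D\<close> lies in too few cliques to be noticeable, unless it
  is part of many stars at a vertex of degree at least \<open>\<tau> n * n\<close>.\<close>

definition D :: "real \<Rightarrow> nat \<Rightarrow> real" where
  "D \<eta> n = (\<eta> / (4 * fact r) / L n) powr (1 / real (r - 2)) * s n"

definition \<tau> :: "nat \<Rightarrow> real" where "\<tau> n = L n powr (- real (r ^ 2))"

definition clique_part :: "real \<Rightarrow> nat \<Rightarrow> nat set set \<Rightarrow> nat set" where
  "clique_part \<eta> n G = {x\<in>{1..n}. D \<eta> n \<le> real (deg G x)}"

definition hub_part :: "nat \<Rightarrow> nat set set \<Rightarrow> nat set" where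
  "hub_part n G = {x\<in>{1..n}. \<tau> n * real n \<le> real (deg G x)}"

lemma eventually_parameters:
  assumes "0 < \<eta>" "\<eta> \<le> 1"
  shows "eventually (\<lambda>n. 0 < p n \<and> p n < 1 \<and> n > 0 \<and> 1 \<le> L n \<and> 0 < s n \<and> 0 < \<tau> n \<and> \<tau> n \<le> 1 \<and>
    p n powr (real (r - 1) / 2) \<le> \<tau> n \<and> 0 < D \<eta> n \<and> D \<eta> n \<le> s n \<and> s n \<le> \<tau> n * n) sequentially"
proof -
  have "(\<lambda>n. L n powr real (r ^ 2) * p n powr (real (r - 1) / 2)) \<longlonglongrightarrow> 0"
    using r by (intro polylog_times_p) auto
  then have "eventually (\<lambda>n. L n powr real (r ^ 2) * p n powr (real (r - 1) / 2) < 1) sequentially"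
    by (rule order_tendstoD(2)) simp
  then show ?thesis using eventually_p eventually_L_ge[of 1]
  proof eventually_elim
    case (elim n)
    have s: "s n > 0" using elim s_pos by simp
    have \<tau>: "0 < \<tau> n" "\<tau> n \<le> 1"
      using elim powr_mono[of "- real (r ^ 2)" 0 "L n"] by (auto simp: \<tau>_def)
    have pt: "p n powr (real (r - 1) / 2) \<le> \<tau> n"
      using elim by (simp add: \<tau>_def powr_minus field_simps)
    have "\<eta> \<le> 4 * fact r" using fact_ge_1[of r, where 'a = real] assms by linarith
    then have "\<eta> / (4 * fact r) \<le> 1" by (simp add: divide_le_eq_1)
    moreover have "\<eta> / (4 * fact r) / L n \<le> \<eta> / (4 * fact r) / 1"
      using elim assms by (intro divide_left_mono) auto
    ultimately have "\<eta> / (4 * fact r) / L n \<le> 1" by linarith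
    moreover have "0 \<le> \<eta> / (4 * fact r) / L n" using elim assms by simp
    ultimately have "(\<eta> / (4 * fact r) / L n) powr (1 / real (r - 2)) \<le> 1"
      by (intro powr_le1) simp_all
    then have "D \<eta> n \<le> s n" using s by (simp add: D_def)
    moreover have "0 < D \<eta> n" using elim assms s by (simp add: D_def)
    moreover have "s n \<le> \<tau> n * n" using pt by (simp add: s_def mult.commute mult_left_mono)
    ultimately show ?case using elim s \<tau> pt by simp
  qed
qed

text \<open>An offending edge has an end \<open>u\<close> of degree below \<open>D \<eta> n\<close>,
  and its other end \<open>v\<close> is no hub. Then \<open>cexp_diff_le\<close> bounds its
  contribution by about half of what a core demands, which is impossible once \<open>L n\<close> is
  large.\<close>

lemma core_structure:
  assumes K: "1 \<le> K" and \<eta>: "0 < \<eta>" "\<eta> \<le> 1"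
  shows "eventually (\<lambda>n. \<forall>G\<in>core K d \<eta> n. \<forall>e\<in>G. e \<subseteq> clique_part \<eta> n G \<or> e \<inter> hub_part n G \<noteq> {}) sequentially"
proof -
  define \<kappa> where "\<kappa> = \<eta> / (4 * fact r)"
  have \<kappa>: "\<kappa> > 0" using \<eta> by (simp add: \<kappa>_def)
  show ?thesis
    using eventually_parameters[OF \<eta>] eventually_L_ge[of "48 * (3 * K) ^ (r - 2) / \<kappa> + 1"] eventually_mean_bounds
  proof eventually_elim
    case (elim n)
    show ?case
    proof (intro ballI, rule ccontr)
      fix G e assume G: "G \<in> core K d \<eta> n" and e: "e \<in> G"
        and neg: "\<not> (e \<subseteq> clique_part \<eta> n G \<or> e \<inter> hub_part n G \<noteq> {})"
      have Gp: "G \<subseteq> pairs {1..n}" using G by (simp add: core_def)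
      have ep: "e \<subseteq> {1..n}" "card e = 2" using Gp e by (auto simp: pairs_def)
      obtain u where u: "u \<in> e" "u \<notin> clique_part \<eta> n G" using neg by auto
      obtain v where ev: "e = {u, v}" using ep(2) u(1) by (auto simp: card_2_iff)
      have du: "real (deg G u) \<le> D \<eta> n" using u ep by (auto simp: clique_part_def)
      have "v \<notin> hub_part n G" using neg ev by auto
      then have dv: "real (deg G v) \<le> \<tau> n * n" using ev ep by (auto simp: hub_part_def)
      define \<Lambda> where "\<Lambda> = 3 * K * L n"
      have KL: "1 \<le> K * L n" using K elim mult_mono[of 1 K 1 "L n"] by simp
      have Lpos: "L n > 0" using elim by simp
      have spos: "s n > 0" using elim by simp
      have "cexp n r (p n) G - cexp n r (p n) (G - {{u, v}})
        \<le> D \<eta> n ^ (r - 2) + 48 * \<tau> n powr (2 / real (r - 1)) * \<Lambda> ^ (r - 2) * s n ^ (r - 2)"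
      proof (rule cexp_diff_le[OF Gp e[unfolded ev] _ _ r s_def du _ dv])
        have "2 * real (card G) \<le> 2 * (K * (s n ^ 2 * L n))" using G by (simp add: core_def)
        moreover have "1 * s n ^ 2 \<le> K * L n * s n ^ 2" using KL by (intro mult_right_mono) auto
        ultimately show "s n ^ 2 + 2 * real (card G) \<le> \<Lambda> * s n ^ 2"
          by (simp add: \<Lambda>_def mult_ac)
        show "1 \<le> \<Lambda>" using KL by (simp add: \<Lambda>_def)
      qed (use elim in auto)
      \<comment> \<open>\<open>D\<close> was chosen so that \<open>D \<eta> n ^ (r - 2)\<close> is
        half of this lower bound. The 4 in \<open>\<kappa>\<close> is this 2 times the 2 lost in
        \<open>eventually_mean_bounds\<close>.\<close>
      moreover have "2 * \<kappa> / L n * s n ^ (r - 2) \<le> \<eta> * mean n / (s n ^ 2 * L n)"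
      proof -
        have "r - 2 + 2 = r" using r by simp
        then have "s n ^ r = s n ^ (r - 2) * s n ^ 2" using power_add[of "s n" "r - 2" 2] by (simp only:)
        then have "2 * \<kappa> / L n * s n ^ (r - 2) = \<eta> * (s n ^ r / (2 * fact r)) / (s n ^ 2 * L n)"
          using spos Lpos by (simp add: \<kappa>_def field_simps)
        also have "\<dots> \<le> \<eta> * mean n / (s n ^ 2 * L n)"
          using elim \<eta> by (intro divide_right_mono mult_left_mono) auto
        finally show ?thesis .
      qed
      moreover have "\<eta> * mean n / (s n ^ 2 * L n) \<le> cexp n r (p n) G - cexp n r (p n) (G - {{u, v}})"
        using G e ev by (auto simp: core_def)
      moreover have "D \<eta> n ^ (r - 2) = \<kappa> / L n * s n ^ (r - 2)"
      proof -
        have "((\<kappa> / L n) powr (1 / real (r - 2))) ^ (r - 2) = \<kappa> / L n"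
          using r \<kappa> Lpos powr_power[of "\<kappa> / L n" "1 / real (r - 2)" "r - 2"] by simp
        then show ?thesis by (simp add: D_def \<kappa>_def[symmetric] power_mult_distrib)
      qed
      ultimately have "2 * \<kappa> / L n * s n ^ (r - 2)
        \<le> \<kappa> / L n * s n ^ (r - 2) + 48 * \<tau> n powr (2 / real (r - 1)) * \<Lambda> ^ (r - 2) * s n ^ (r - 2)"
        by linarith
      moreover have "2 * \<kappa> / L n * s n ^ (r - 2) = 2 * (\<kappa> / L n * s n ^ (r - 2))" by simp
      ultimately have "\<kappa> / L n * s n ^ (r - 2) \<le> 48 * \<tau> n powr (2 / real (r - 1)) * \<Lambda> ^ (r - 2) * s n ^ (r - 2)"
        by linarith
      then have "\<kappa> / L n \<le> 48 * \<tau> n powr (2 / real (r - 1)) * \<Lambda> ^ (r - 2)"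
        by (rule mult_right_le_imp_le) (use spos in simp)
      also have "\<dots> = 48 * (3 * K) ^ (r - 2) * (\<tau> n powr (2 / real (r - 1)) * L n ^ (r - 2))"
        by (simp add: \<Lambda>_def power_mult_distrib)
      also have "\<dots> \<le> 48 * (3 * K) ^ (r - 2) * L n powr (- 2)"
      proof (rule mult_left_mono)
        have "\<tau> n powr (2 / real (r - 1)) * L n ^ (r - 2) = L n powr (- real (r ^ 2) * (2 / real (r - 1)) + real (r - 2))"
          using Lpos by (simp only: \<tau>_def powr_powr powr_add powr_realpow)
        also have "\<dots> \<le> L n powr (- 2)"
        proof (rule powr_mono)
          \<comment> \<open>The exponent \<open>r ^ 2\<close> in \<open>\<tau>\<close> makes
            \<open>\<tau> n powr (2 / (r - 1))\<close> at most \<open>L n powr (- 2 * r)\<close>,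
            which outweighs the factor \<open>L n ^ (r - 2)\<close> from the edge count and still
            beats the \<open>1 / L n\<close> of the threshold.\<close>
          have "2 * real r * real (r - 1) \<le> 2 * real (r ^ 2)"
            using r by (simp add: power2_eq_square)
          then have "2 * real r \<le> real (r ^ 2) * (2 / real (r - 1))" using r by (simp add: field_simps)
          then show "- real (r ^ 2) * (2 / real (r - 1)) + real (r - 2) \<le> - 2" using r r_real by linarith
        qed (use elim in simp)
        finally show "\<tau> n powr (2 / real (r - 1)) * L n ^ (r - 2) \<le> L n powr (- 2)" .
      qed (use K in simp)
      finally have "\<kappa> / L n \<le> 48 * (3 * K) ^ (r - 2) / L n ^ 2"
        using Lpos by (simp add: powr_minus_divide)
      then have "\<kappa> * L n \<le> 48 * (3 * K) ^ (r - 2)" using Lpos by (simp add: field_simps power2_eq_square)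
      then have "L n \<le> 48 * (3 * K) ^ (r - 2) / \<kappa>" using \<kappa> by (simp add: field_simps)
      then show False using elim by simp
    qed
  qed
qed

lemma card_parts_le:
  assumes "G \<subseteq> pairs {1..n}" "0 < D \<eta> n" "0 < \<tau> n" "D \<eta> n \<le> \<tau> n * n" "n > 0"
  shows "real (card (clique_part \<eta> n G)) \<le> 2 * real (card G) / D \<eta> n"
    "real (card (hub_part n G)) \<le> 2 * real (card G) / (\<tau> n * n)"
    "hub_part n G \<subseteq> clique_part \<eta> n G"
  using card_high_deg_le[OF assms(1), of "D \<eta> n"] card_high_deg_le[OF assms(1), of "\<tau> n * n"] assms
  by (auto simp: clique_part_def hub_part_def field_simps)

text \<open>A core is specified by its two vertex sets and its edges among at most
  \<open>m * Q n\<close> host pairs. \<open>Q n\<close> is at most a power of \<open>L n\<close>, so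
  an edge costs order \<open>ln (L n)\<close>; the vertices to be named number at most
  \<open>4 * m / D \<eta> n\<close> and cost \<open>ln (n + 1)\<close> each, where the lower bound
  on \<open>p\<close> enters through \<open>ln_over_sL\<close>. Both costs are \<open>o(L n)\<close>
  per edge.\<close>

lemma card_core_le:
  assumes K: "1 \<le> K" and \<eta>: "0 < \<eta>" "\<eta> \<le> 1" and \<epsilon>: "0 < \<epsilon>"
  shows "eventually (\<lambda>n. \<forall>m\<ge>1. real (card {G\<in>core K d \<eta> n. card G = m}) \<le> exp (\<epsilon> * L n * real m)) sequentially"
proof -
  define \<kappa> where "\<kappa> = \<eta> / (4 * fact r)"
  have \<kappa>: "\<kappa> > 0" using \<eta> by (simp add: \<kappa>_def)
  define Q where "Q = (\<lambda>n. 4 * K * (s n ^ 2 * L n) / D \<eta> n ^ 2 + 2 / \<tau> n)"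
  define C where "C = 4 * K * \<kappa> powr (- 2 / real (r - 2)) + 2"
  have C: "C > 0" using K by (simp add: C_def add_pos_pos add_nonneg_pos)
  have "(\<lambda>n. 8 * \<kappa> powr (- 1 / real (r - 2)) * (ln (real n) * L n powr (1 / real (r - 2)) / (s n * L n))) \<longlonglongrightarrow> 8 * \<kappa> powr (- 1 / real (r - 2)) * 0"
    by (intro tendsto_mult tendsto_const ln_over_sL)
  then have ev1: "eventually (\<lambda>n. 8 * \<kappa> powr (- 1 / real (r - 2)) * (ln (real n) * L n powr (1 / real (r - 2)) / (s n * L n)) < \<epsilon> / 2) sequentially"
    using \<epsilon> by (intro order_tendstoD(2)) auto
  have "((\<lambda>x. (1 + ln C + real (r ^ 2) * ln x) / x) \<longlongrightarrow> 0) at_top" by real_asymp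
  from filterlim_compose[OF this L_at_top]
  have ev2: "eventually (\<lambda>n. (1 + ln C + real (r ^ 2) * ln (L n)) / L n < \<epsilon> / 2) sequentially"
    using \<epsilon> by (intro order_tendstoD(2)) auto
  show ?thesis
    using eventually_parameters[OF \<eta>] core_structure[OF K \<eta>, of d] ev1 ev2 eventually_ge_at_top[of 2]
  proof eventually_elim
    case (elim n)
    then have par: "0 < p n" "p n < 1" "n > 0" "1 \<le> L n" "0 < s n" "0 < \<tau> n" "\<tau> n \<le> 1" "0 < D \<eta> n" "D \<eta> n \<le> s n" "s n \<le> \<tau> n * n"
      by auto
    have Dinv: "1 / D \<eta> n = \<kappa> powr (- 1 / real (r - 2)) * L n powr (1 / real (r - 2)) / s n"
      using par \<kappa> by (simp add: D_def \<kappa>_def[symmetric] powr_divide powr_minus_divide)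
    have Q_le: "Q n \<le> C * L n powr real (r ^ 2)"
    proof -
      have D2: "(1 / D \<eta> n) ^ 2 = \<kappa> powr (- 2 / real (r - 2)) * L n powr (2 / real (r - 2)) / s n ^ 2"
        unfolding Dinv using par \<kappa> by (simp add: power_divide power_mult_distrib powr_power)
      have "4 * K * (s n ^ 2 * L n) / D \<eta> n ^ 2 = 4 * K * (s n ^ 2 * L n) * (1 / D \<eta> n) ^ 2"
        by (simp add: power_divide)
      also have "\<dots> = 4 * K * (s n ^ 2 * L n) * (\<kappa> powr (- 2 / real (r - 2)) * L n powr (2 / real (r - 2)) / s n ^ 2)"
        by (simp only: D2)
      also have "\<dots> = 4 * K * \<kappa> powr (- 2 / real (r - 2)) * (L n powr 1 * L n powr (2 / real (r - 2)))"
        using par by simp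
      also have "\<dots> = 4 * K * \<kappa> powr (- 2 / real (r - 2)) * L n powr (1 + 2 / real (r - 2))"
        by (simp only: powr_add)
      also have "\<dots> \<le> 4 * K * \<kappa> powr (- 2 / real (r - 2)) * L n powr real (r ^ 2)"
      proof (intro mult_left_mono powr_mono)
        have "2 / real (r - 2) \<le> 2" using r by (simp add: divide_le_eq)
        moreover have "3 * 3 \<le> real r * real r" using r by (intro mult_mono) auto
        ultimately show "1 + 2 / real (r - 2) \<le> real (r ^ 2)" by (simp add: power2_eq_square)
      qed (use par K in auto)
      moreover have "2 / \<tau> n = 2 * L n powr real (r ^ 2)"
        by (simp add: \<tau>_def powr_minus_divide)
      ultimately show ?thesis by (simp add: Q_def C_def algebra_simps)
    qed
    have Q_pos: "Q n > 0" using par K by (simp add: Q_def add_nonneg_pos)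
    have lnQ: "1 + ln (Q n) \<le> \<epsilon> / 2 * L n"
    proof -
      have "ln (Q n) \<le> ln (C * L n powr real (r ^ 2))" using Q_le Q_pos by simp
      also have "\<dots> = ln C + real (r ^ 2) * ln (L n)" using C par by (simp add: ln_mult ln_powr)
      finally show ?thesis using elim(4) par by (simp add: field_simps)
    qed
    have lnD: "ln (real (n + 1)) * (4 / D \<eta> n) \<le> \<epsilon> / 2 * L n"
    proof -
      have "real (n + 1) \<le> real n ^ 2"
      proof -
        have "n + 1 \<le> n * 2" using elim by simp
        also have "\<dots> \<le> n * n" using elim by (intro mult_le_mono2) simp
        finally have "real (n + 1) \<le> real (n * n)" by (simp only: of_nat_le_iff)
        then show ?thesis by (simp add: power2_eq_square)
      qed
      then have "ln (real (n + 1)) \<le> ln (real n ^ 2)" using elim by (subst ln_le_cancel_iff) auto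
      then have "ln (real (n + 1)) * (4 / D \<eta> n) \<le> (2 * ln (real n)) * (4 / D \<eta> n)"
        using par by (intro mult_right_mono) (auto simp: ln_realpow)
      also have "\<dots> = 8 * ln (real n) * (1 / D \<eta> n)" by simp
      also have "\<dots> = 8 * \<kappa> powr (- 1 / real (r - 2)) * (ln (real n) * L n powr (1 / real (r - 2)) / (s n * L n)) * L n"
        unfolding Dinv using par by simp
      also have "\<dots> \<le> \<epsilon> / 2 * L n" using elim(3) par by (intro mult_right_mono) auto
      finally show ?thesis .
    qed
    show ?case
    proof (intro allI impI)
      fix m :: nat assume m: "m \<ge> 1"
      let ?\<G> = "{G\<in>core K d \<eta> n. card G = m}"
      define k where "k = nat \<lfloor>2 * real m / D \<eta> n\<rfloor>"
      have kle: "real k \<le> 2 * real m / D \<eta> n" using par by (simp add: k_def)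
      have "real (card ?\<G>) \<le> real (n + 1) ^ (2 * k) * (exp 1 * (real m * Q n) / real m) ^ m"
      proof (rule card_structured_graphs_le[OF m])
        show "0 \<le> real m * Q n" using Q_pos by simp
        fix G assume G: "G \<in> ?\<G>"
        then have Gp: "G \<subseteq> pairs {1..n}" and cG: "card G = m" and mK: "real m \<le> K * (s n ^ 2 * L n)"
          by (auto simp: core_def)
        have "D \<eta> n \<le> \<tau> n * n" using par by linarith
        note parts = card_parts_le[OF Gp par(8) par(6) this par(3), unfolded cG]
        let ?A = "clique_part \<eta> n G" and ?B = "hub_part n G"
        have AB: "?A \<subseteq> {1..n}" "?B \<subseteq> {1..n}" by (auto simp: clique_part_def hub_part_def)
        have cA: "card ?A \<le> k" using parts(1) par by (simp add: k_def le_nat_floor)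
        have "card ?B \<le> card ?A" using parts(3) AB(1) by (intro card_mono) (auto intro: finite_subset)
        then have cB: "card ?B \<le> k" using cA by simp
        \<comment> \<open>This is quadratic in \<open>m\<close>, but a core has at most
          \<open>K * (s n ^ 2 * L n)\<close> edges, and dividing by \<open>D \<eta> n ^ 2\<close>
          turns one factor \<open>m\<close> into a power of \<open>L n\<close>.\<close>
        have "real (card ?A) ^ 2 \<le> (2 * real m / D \<eta> n) ^ 2" using parts(1) by (intro power_mono) auto
        also have "\<dots> = 4 * real m * real m / D \<eta> n ^ 2" by (simp add: power2_eq_square)
        also have "\<dots> \<le> 4 * real m * (K * (s n ^ 2 * L n)) / D \<eta> n ^ 2"
          using mK by (intro divide_right_mono mult_left_mono) auto
        finally have 1: "real (card ?A) ^ 2 \<le> real m * (4 * K * (s n ^ 2 * L n) / D \<eta> n ^ 2)" by (simp add: mult_ac)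
        have "real (card ?B) * real n \<le> 2 * real m / (\<tau> n * n) * real n"
          using parts(2) by (intro mult_right_mono) auto
        also have "\<dots> = real m * (2 / \<tau> n)" using par by simp
        finally have "real (card ?A ^ 2 + card ?B * n) \<le> real m * Q n"
          using 1 by (simp add: Q_def algebra_simps)
        moreover have "\<forall>e\<in>G. e \<subseteq> ?A \<or> e \<inter> ?B \<noteq> {}" using elim(2) G by auto
        ultimately show "G \<subseteq> pairs {1..n} \<and> card G = m \<and> (\<exists>A B. A \<subseteq> {1..n} \<and> B \<subseteq> {1..n} \<and> card A \<le> k \<and> card B \<le> k \<and>
            real (card A ^ 2 + card B * n) \<le> real m * Q n \<and> (\<forall>e\<in>G. e \<subseteq> A \<or> e \<inter> B \<noteq> {}))"
          using Gp cG AB cA cB by blast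
      qed
      also have "exp 1 * (real m * Q n) / real m = exp (1 + ln (Q n))" using m Q_pos by (simp add: exp_add)
      also have "real (n + 1) ^ (2 * k) * exp (1 + ln (Q n)) ^ m = exp (ln (real (n + 1)) * (2 * real k) + real m * (1 + ln (Q n)))"
      proof -
        have 1: "real (n + 1) ^ (2 * k) = exp (real (2 * k) * ln (real (n + 1)))"
          unfolding exp_of_nat_mult by simp
        have 2: "exp (1 + ln (Q n)) ^ m = exp (real m * (1 + ln (Q n)))"
          by (rule exp_of_nat_mult[symmetric])
        show ?thesis unfolding 1 2 exp_add[symmetric] by (simp add: mult_ac)
      qed
      also have "\<dots> \<le> exp (\<epsilon> * L n * real m)"
      proof -
        have "ln (real (n + 1)) * (2 * real k) \<le> ln (real (n + 1)) * (2 * (2 * real m / D \<eta> n))"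
          using kle by (intro mult_left_mono) auto
        also have "\<dots> = real m * (ln (real (n + 1)) * (4 / D \<eta> n))" by simp
        also have "\<dots> \<le> real m * (\<epsilon> / 2 * L n)" using lnD by (intro mult_left_mono) auto
        finally have "ln (real (n + 1)) * (2 * real k) \<le> real m * (\<epsilon> / 2 * L n)" .
        moreover have "real m * (1 + ln (Q n)) \<le> real m * (\<epsilon> / 2 * L n)" using lnQ by (intro mult_left_mono) auto
        ultimately have "ln (real (n + 1)) * (2 * real k) + real m * (1 + ln (Q n))
            \<le> real m * (\<epsilon> / 2 * L n) + real m * (\<epsilon> / 2 * L n)" by (rule add_mono)
        also have "\<dots> = \<epsilon> * L n * real m" by (simp add: algebra_simps)
        finally show ?thesis by simp
      qed
      finally show "real (card ?\<G>) \<le> exp (\<epsilon> * L n * real m)" .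
    qed
  qed
qed

end

text \<open>\<open>psi\<close> in the variable \<open>y = \<delta> * (1 - x)\<close>, the share of the excess that is due to a clique.\<close>

definition rho :: "nat \<Rightarrow> real \<Rightarrow> real \<Rightarrow> real \<Rightarrow> real" where
  "rho r \<delta> c y = y powr (2 / real r) / 2 + stair (real (r - 1)) ((\<delta> - y) * c / real r) / c"

section \<open>The number of edges of a core\<close>

text \<open>The degree sum counts an edge with one end in \<open>B\<close> once and an edge inside
  \<open>B\<close> twice; the latter are at most \<open>card B ^ 2\<close>.\<close>

lemma sum_deg_le_incident:
  assumes "G \<subseteq> pairs V" "finite V" "B \<subseteq> V"
  shows "(\<Sum>v\<in>B. deg G v) \<le> card {e\<in>G. e \<inter> B \<noteq> {}} + card B ^ 2"
proof -
  have fG: "finite G" using finite_subset[OF assms(1)] assms(2) by simp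
  have fB: "finite B" using assms(2,3) finite_subset by blast
  have "(\<Sum>v\<in>B. deg G v) = (\<Sum>v\<in>B. \<Sum>e\<in>G. if v \<in> e then 1 else 0)"
    using fG by (simp add: deg_eq_incident[OF assms(1)] flip: sum.inter_filter)
  also have "\<dots> = (\<Sum>e\<in>G. \<Sum>v\<in>B. if v \<in> e then 1 else 0)" by (rule sum.swap)
  also have "\<dots> \<le> (\<Sum>e\<in>G. (if e \<inter> B \<noteq> {} then 1 else 0) + (if e \<in> pairs B then 1 else 0))"
  proof (intro sum_mono)
    fix e assume e: "e \<in> G"
    then have ce: "card e = 2" using assms(1) by (auto simp: pairs_def)
    then have fe: "finite e" by (intro card_ge_0_finite) simp
    have "{v\<in>B. v \<in> e} = e \<inter> B" by auto
    then have eq: "(\<Sum>v\<in>B. if v \<in> e then 1 else 0) = card (e \<inter> B)"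
      using fB by (simp flip: sum.inter_filter)
    have "card (e \<inter> B) \<le> (if e \<inter> B \<noteq> {} then 1 else 0) + (if e \<in> pairs B then 1 else 0)"
    proof (cases "e \<subseteq> B")
      case True
      then have "e \<inter> B = e" by blast
      moreover have "e \<noteq> {}" using ce by auto
      ultimately show ?thesis using True ce by (simp add: pairs_def)
    next
      case False
      then have "card (e \<inter> B) < card e" using fe by (intro psubset_card_mono) auto
      then have "card (e \<inter> B) \<le> 1" using ce by simp
      then show ?thesis by (cases "e \<inter> B = {}") simp_all
    qed
    then show "(\<Sum>v\<in>B. if v \<in> e then 1 else 0) \<le> (if e \<inter> B \<noteq> {} then 1 else 0) + (if e \<in> pairs B then 1 else 0 :: nat)"
      unfolding eq .
  qed
  also have "\<dots> = card {e\<in>G. e \<inter> B \<noteq> {}} + card {e\<in>G. e \<in> pairs B}"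
    using fG by (simp add: sum.distrib flip: sum.inter_filter)
  also have "card {e\<in>G. e \<in> pairs B} \<le> card (pairs B)" using fB by (intro card_mono) auto
  also have "card (pairs B) = card B * (card B - 1) div 2" using fB by (simp add: card_pairs choose_two)
  also have "\<dots> \<le> card B * (card B - 1)" by simp
  also have "\<dots> \<le> card B ^ 2" by (simp add: power2_eq_square)
  finally show ?thesis by simp
qed

context clique_regime
begin

lemma c_pos: "p n > 0 \<Longrightarrow> n > 0 \<Longrightarrow> c n > 0"
  by (simp add: c_def)

text \<open>A star at a hub leaves \<open>r - 1 choose 2\<close> pairs to chance, and a full hub
  centres about \<open>n ^ (r - 1) / fact (r - 1)\<close> stars. Hence a full hub adds
  \<open>r / c n\<close> times \<open>s n ^ r / fact r\<close>.\<close>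

lemma star_scale:
  assumes "p n > 0" "n > 0"
  shows "p n ^ (r - 1 choose 2) * fact r / s n ^ r = real r * fact (r - 1) / (real n ^ (r - 1) * c n)"
proof -
  have f: "fact r = real r * fact (r - 1)" using r by (simp add: fact_reduce)
  have ch: "r choose 2 = (r - 1 choose 2) + (r - 1)" using r by (cases r) (auto simp: numeral_2_eq_2)
  have "p n ^ (r choose 2) = p n ^ (r - 1 choose 2) * p n ^ (r - 1)" unfolding ch by (rule power_add)
  moreover have "real n ^ r = real n * real n ^ (r - 1)" using r power_eq_if[of "real n" r] by simp
  ultimately have "s n ^ r = (real n * real n ^ (r - 1)) * (p n ^ (r - 1 choose 2) * p n ^ (r - 1))"
    by (simp only: s_power_r[OF assms(1)])
  then show ?thesis using assms unfolding f c_def by simp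
qed

text \<open>In units of \<open>s n ^ r / fact r\<close>, the excess is at most \<open>y0\<close>
  from cliques away from the hubs plus \<open>r * \<Theta> / c n\<close> from stars, up to errors
  absorbed by \<open>d' < d\<close>. In units of \<open>s n ^ 2\<close>, the edges away from the
  hubs number \<open>y0 powr (2 / r) / 2\<close>, and by \<open>stair_sum_le\<close> those at the
  hubs at least \<open>stair (r - 1) \<Theta> / c n\<close>, up to \<open>\<zeta>\<close>.\<close>

lemma core_size:
  assumes K: "1 \<le> K" and \<eta>: "0 < \<eta>" "\<eta> \<le> 1" and d: "0 < d'" "d' < d" and \<zeta>: "0 < \<zeta>"
  shows "eventually (\<lambda>n. \<forall>G\<in>core K d \<eta> n. \<exists>y. 0 \<le> y \<and> y \<le> d' \<and>
    rho r d' (c n) y - \<zeta> \<le> real (card G) / s n ^ 2) sequentially"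
proof -
  define \<kappa> where "\<kappa> = \<eta> / (4 * fact r)"
  have \<kappa>: "\<kappa> > 0" using \<eta> by (simp add: \<kappa>_def)
  define C where "C = 2 * K + 2 * K * \<kappa> powr (- 1 / real (r - 2)) + 1"
  define E where "E = (\<lambda>n. C ^ r * (L n powr (real r * (real (r ^ 2) + 1)) * p n powr 1))"
  have "(\<lambda>n. d * (mean n * fact r / s n ^ r) - fact r * E n) \<longlonglongrightarrow> d * 1 - fact r * (C ^ r * 0)"
    unfolding E_def by (intro tendsto_diff tendsto_mult tendsto_const mean_asymp polylog_times_p) simp
  then have ev1: "eventually (\<lambda>n. d * (mean n * fact r / s n ^ r) - fact r * E n > d') sequentially"
    using d by (intro order_tendstoD(1)) auto
  have "(\<lambda>n. 4 * K ^ 2 * (L n powr (2 + 2 * real (r ^ 2)) * p n powr real (r - 1))) \<longlonglongrightarrow> 4 * K ^ 2 * 0"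
    using r by (intro tendsto_mult tendsto_const polylog_times_p) simp
  then have ev2: "eventually (\<lambda>n. 4 * K ^ 2 * (L n powr (2 + 2 * real (r ^ 2)) * p n powr real (r - 1)) < \<zeta>) sequentially"
    using \<zeta> by (intro order_tendstoD(2)) auto
  show ?thesis
    using eventually_parameters[OF \<eta>] core_structure[OF K \<eta>, of d] ev1 ev2
  proof eventually_elim
    case (elim n)
    then have par: "0 < p n" "p n < 1" "n > 0" "1 \<le> L n" "0 < s n" "0 < \<tau> n" "\<tau> n \<le> 1" "0 < D \<eta> n" "D \<eta> n \<le> s n" "s n \<le> \<tau> n * n"
      by auto
    have cp: "c n > 0" using par c_pos by simp
    have s2: "s n ^ 2 = real n ^ 2 * p n ^ (r - 1)"
      unfolding s_sq c_def by (simp add: power2_eq_square)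
    have pinv: "p n powr (- real (r - 1)) = real n ^ 2 / s n ^ 2"
      using par unfolding s2 by (simp add: powr_minus powr_realpow field_simps)
    have pinv': "p n powr (- real (r - 1) / 2) = real n / s n"
    proof -
      have "p n powr (- real (r - 1) / 2) = 1 / p n powr (real (r - 1) / 2)"
        by (simp add: powr_minus_divide)
      then show ?thesis using par by (simp add: s_def)
    qed
    show ?case
    proof
      fix G assume G: "G \<in> core K d \<eta> n"
      then have Gp: "G \<subseteq> pairs {1..n}" and mK: "real (card G) \<le> K * (s n ^ 2 * L n)"
        and big: "(1 + d) * mean n \<le> cexp n r (p n) G" by (auto simp: core_def)
      have fG: "finite G" using finite_subset[OF Gp] by simp
      define A where "A = clique_part \<eta> n G"
      define B where "B = hub_part n G"
      have "D \<eta> n \<le> \<tau> n * n" using par by linarith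
      note parts = card_parts_le[OF Gp par(8) par(6) this par(3), folded A_def B_def]
      have AB: "A \<subseteq> {1..n}" "B \<subseteq> {1..n}" by (auto simp: A_def B_def clique_part_def hub_part_def)
      have fB: "finite B" using AB finite_subset by blast
      have str: "\<And>e. e \<in> G \<Longrightarrow> e \<subseteq> A \<or> e \<inter> B \<noteq> {}" using elim(2) G by (auto simp: A_def B_def)
      let ?e1 = "real (card {e\<in>G. e \<inter> B = {}})"
      have cB: "real (card B) \<le> 2 * K * L n * (s n ^ 2 / (\<tau> n * n))"
      proof -
        have "2 * real (card G) / (\<tau> n * n) \<le> 2 * (K * (s n ^ 2 * L n)) / (\<tau> n * n)"
          using mK par by (intro divide_right_mono mult_left_mono) auto
        then show ?thesis using parts(2) by (simp add: mult_ac)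
      qed
      have cA: "real (card A) \<le> 2 * K * L n * (s n ^ 2 / D \<eta> n)"
      proof -
        have "2 * real (card G) / D \<eta> n \<le> 2 * (K * (s n ^ 2 * L n)) / D \<eta> n"
          using mK par by (intro divide_right_mono mult_left_mono) auto
        then show ?thesis using parts(1) by (simp add: mult_ac)
      qed
      let ?W = "card B * p n powr (- real (r - 1)) + card A * p n powr (- real (r - 1) / 2) + n"
      have W: "?W \<le> real n * (C * L n powr (real (r ^ 2) + 1))"
      proof -
        have "real (card B) * p n powr (- real (r - 1)) \<le> 2 * K * L n * (s n ^ 2 / (\<tau> n * n)) * (real n ^ 2 / s n ^ 2)"
          unfolding pinv by (intro mult_right_mono cB) simp
        also have "\<dots> = real n * (2 * K * (L n powr 1 / \<tau> n))"
          using par by (simp add: power2_eq_square)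
        also have "L n powr 1 / \<tau> n = L n powr (real (r ^ 2) + 1)"
          by (simp add: \<tau>_def powr_minus_divide powr_add mult.commute)
        finally have 1: "real (card B) * p n powr (- real (r - 1)) \<le> real n * (2 * K * L n powr (real (r ^ 2) + 1))" .
        have "real (card A) * p n powr (- real (r - 1) / 2) \<le> 2 * K * L n * (s n ^ 2 / D \<eta> n) * (real n / s n)"
          unfolding pinv' using par by (intro mult_right_mono cA) simp
        also have "\<dots> = real n * (2 * K * (L n * (s n / D \<eta> n)))"
          using par by (simp add: power2_eq_square)
        also have "s n / D \<eta> n = \<kappa> powr (- 1 / real (r - 2)) * L n powr (1 / real (r - 2))"
          using par \<kappa> by (simp add: D_def \<kappa>_def[symmetric] powr_divide powr_minus_divide)
        also have "L n * (\<kappa> powr (- 1 / real (r - 2)) * L n powr (1 / real (r - 2))) = \<kappa> powr (- 1 / real (r - 2)) * L n powr (1 / real (r - 2) + 1)"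
          using par by (simp add: powr_add)
        also have "real n * (2 * K * (\<kappa> powr (- 1 / real (r - 2)) * L n powr (1 / real (r - 2) + 1)))
          \<le> real n * (2 * K * (\<kappa> powr (- 1 / real (r - 2)) * L n powr (real (r ^ 2) + 1)))"
        proof (intro mult_left_mono powr_mono)
          have "1 / real (r - 2) \<le> 1" using r by (simp add: divide_le_eq)
          moreover have "1 * 1 \<le> real r * real r" using r by (intro mult_mono) auto
          ultimately show "1 / real (r - 2) + 1 \<le> real (r ^ 2) + 1" by (simp add: power2_eq_square)
        qed (use par K in auto)
        finally have 2: "real (card A) * p n powr (- real (r - 1) / 2) \<le> real n * (2 * K * (\<kappa> powr (- 1 / real (r - 2)) * L n powr (real (r ^ 2) + 1)))" .
        have "1 \<le> L n powr (real (r ^ 2) + 1)" using par by (intro ge_one_powr_ge_zero) auto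
        then have "real n * 1 \<le> real n * L n powr (real (r ^ 2) + 1)" by (intro mult_left_mono) auto
        then show ?thesis using 1 2 by (simp add: C_def algebra_simps)
      qed
      have last: "p n * p n ^ (r choose 2) * ?W ^ r \<le> s n ^ r * E n"
      proof -
        have "p n * p n ^ (r choose 2) * ?W ^ r \<le> p n * p n ^ (r choose 2) * (real n * (C * L n powr (real (r ^ 2) + 1))) ^ r"
          using par by (intro mult_left_mono power_mono W) auto
        also have "\<dots> = s n ^ r * (C ^ r * ((L n powr (real (r ^ 2) + 1)) ^ r * p n))"
          using par by (simp add: s_power_r power_mult_distrib)
        also have "(L n powr (real (r ^ 2) + 1)) ^ r = L n powr (real r * (real (r ^ 2) + 1))"
          using par powr_power[of "L n" "real (r ^ 2) + 1" r] by simp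
        finally show ?thesis using par by (simp add: E_def)
      qed
      define \<theta> where "\<theta> = (\<lambda>v. real (deg G v) / real n)"
      have \<theta>: "0 \<le> \<theta> v \<and> \<theta> v \<le> 1" for v
      proof -
        have "deg G v \<le> card {1..n}" unfolding deg_def using finite_nbhd(2)[OF Gp, of v] by (intro card_mono) auto
        then show ?thesis using par by (simp add: \<theta>_def divide_le_eq)
      qed
      define \<Theta> where "\<Theta> = (\<Sum>v\<in>B. \<theta> v powr real (r - 1))"
      define y0 where "y0 = (sqrt (2 * ?e1) / s n) ^ r"
      have y0: "0 \<le> y0" using par by (simp add: y0_def)
      have \<Theta>: "0 \<le> \<Theta>" by (auto simp: \<Theta>_def intro: sum_nonneg)
      have star: "(\<Sum>v\<in>B. real (deg G v) ^ (r - 1)) = real n ^ (r - 1) * \<Theta>"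
      proof -
        have "real (deg G v) ^ (r - 1) = real n ^ (r - 1) * \<theta> v powr real (r - 1)" for v
        proof -
          have "\<theta> v powr real (r - 1) = \<theta> v ^ (r - 1)"
          proof (cases "\<theta> v = 0")
            case False
            then have "0 < \<theta> v" using \<theta>[of v] by simp
            then show ?thesis by (rule powr_realpow)
          qed (use r in simp)
          then show ?thesis using par by (simp add: \<theta>_def power_divide)
        qed
        then show ?thesis by (simp add: \<Theta>_def sum_distrib_left)
      qed
      have d'_le: "d' \<le> y0 + real r * \<Theta> / c n"
      proof -
        have "(1 + d) * mean n \<le> mean n + sqrt (2 * ?e1) ^ r / fact r
            + real n ^ (r - 1) * \<Theta> / fact (r - 1) * p n ^ (r - 1 choose 2) + s n ^ r * E n"
          using big cexp_le_structured[OF Gp r par(1) less_imp_le[OF par(2)] AB str] last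
          unfolding star mean_def[symmetric] by linarith
        then have "d * mean n \<le> sqrt (2 * ?e1) ^ r / fact r
            + real n ^ (r - 1) * \<Theta> / fact (r - 1) * p n ^ (r - 1 choose 2) + s n ^ r * E n"
          by (simp add: algebra_simps)
        then have "d * mean n * (fact r / s n ^ r) \<le> (sqrt (2 * ?e1) ^ r / fact r
            + real n ^ (r - 1) * \<Theta> / fact (r - 1) * p n ^ (r - 1 choose 2) + s n ^ r * E n) * (fact r / s n ^ r)"
          using par by (intro mult_right_mono) auto
        also have "\<dots> = y0 + real n ^ (r - 1) * p n ^ (r - 1 choose 2) * fact r / (fact (r - 1) * s n ^ r) * \<Theta> + fact r * E n"
          using par by (simp add: y0_def power_divide field_simps)
        also have "real n ^ (r - 1) * p n ^ (r - 1 choose 2) * fact r / (fact (r - 1) * s n ^ r) = real r / c n"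
        proof -
          have "real n ^ (r - 1) * p n ^ (r - 1 choose 2) * fact r / (fact (r - 1) * s n ^ r)
            = real n ^ (r - 1) / fact (r - 1) * (p n ^ (r - 1 choose 2) * fact r / s n ^ r)" by simp
          also have "\<dots> = real r / c n" unfolding star_scale[OF par(1,3)] using par by simp
          finally show ?thesis .
        qed
        finally show ?thesis using elim(3) by (simp add: mult_ac)
      qed
      have edges: "y0 powr (2 / real r) / 2 + (\<Sum>v\<in>B. \<theta> v) / c n - \<zeta> \<le> real (card G) / s n ^ 2"
      proof -
        have y0p: "y0 powr (2 / real r) / 2 = ?e1 / s n ^ 2"
        proof (cases "?e1 = 0")
          case True
          then show ?thesis using r by (simp add: y0_def)
        next
          case False
          then have pos: "sqrt (2 * ?e1) / s n > 0" using par by simp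
          have "y0 powr (2 / real r) = (sqrt (2 * ?e1) / s n) powr (real r * (2 / real r))"
            unfolding y0_def powr_powr[symmetric] using pos by (simp only: powr_realpow)
          also have "real r * (2 / real r) = 2" using r by simp
          also have "(sqrt (2 * ?e1) / s n) powr 2 = (sqrt (2 * ?e1) / s n) ^ 2" using pos by simp
          finally show ?thesis by (simp add: power_divide)
        qed
        have "real (\<Sum>v\<in>B. deg G v) \<le> real (card {e\<in>G. e \<inter> B \<noteq> {}} + card B ^ 2)"
          using sum_deg_le_incident[OF Gp _ AB(2)] by (simp only: of_nat_le_iff finite_atLeastAtMost)
        then have "real (\<Sum>v\<in>B. deg G v) \<le> real (card {e\<in>G. e \<inter> B \<noteq> {}}) + real (card B) ^ 2"
          by simp
        moreover have "card G = card {e\<in>G. e \<inter> B = {}} + card {e\<in>G. e \<inter> B \<noteq> {}}"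
          using fG by (subst card_Un_disjoint[symmetric]) (auto intro: arg_cong[of _ _ card])
        ultimately have "?e1 + real (\<Sum>v\<in>B. deg G v) \<le> real (card G) + real (card B) ^ 2" by simp
        then have "(?e1 + real (\<Sum>v\<in>B. deg G v)) / s n ^ 2 \<le> (real (card G) + real (card B) ^ 2) / s n ^ 2"
          by (intro divide_right_mono) auto
        then have "?e1 / s n ^ 2 + real (\<Sum>v\<in>B. deg G v) / s n ^ 2 \<le> real (card G) / s n ^ 2 + real (card B) ^ 2 / s n ^ 2"
          by (simp only: add_divide_distrib)
        moreover have "real (\<Sum>v\<in>B. deg G v) / s n ^ 2 = (\<Sum>v\<in>B. \<theta> v) / c n"
          using par unfolding s_sq \<theta>_def by (simp add: sum_divide_distrib[symmetric])
        \<comment> \<open>Edges between hubs are negligible: up to powers of \<open>L n\<close>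
          there are only \<open>s n ^ 2 / n\<close> hubs, so the ratio is
          \<open>p n ^ (r - 1)\<close> up to powers of \<open>L n\<close>.\<close>
        moreover have "real (card B) ^ 2 / s n ^ 2 \<le> \<zeta>"
        proof -
          have "real (card B) ^ 2 / s n ^ 2 \<le> (2 * K * L n * (s n ^ 2 / (\<tau> n * n))) ^ 2 / s n ^ 2"
            by (intro divide_right_mono power_mono cB) auto
          also have "\<dots> = 4 * K ^ 2 * ((L n / \<tau> n) ^ 2 * (s n ^ 2 / real n ^ 2))"
            using par by (simp add: power2_eq_square mult_ac)
          also have "L n / \<tau> n = L n powr (1 + real (r ^ 2))"
            using par by (simp add: \<tau>_def powr_minus_divide powr_add)
          also have "(L n powr (1 + real (r ^ 2))) ^ 2 = L n powr (2 + 2 * real (r ^ 2))"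
            using par powr_power[of "L n" "1 + real (r ^ 2)" 2] by simp
          also have "s n ^ 2 / real n ^ 2 = p n powr real (r - 1)"
            using par unfolding s2 by (simp add: powr_realpow)
          finally show ?thesis using elim(4) by simp
        qed
        ultimately show ?thesis using y0p by linarith
      qed
      \<comment> \<open>Capping at \<open>d'\<close> keeps the share of the stars nonnegative when
        the clique alone supplies more than the whole excess.\<close>
      define y where "y = min y0 d'"
      have y: "0 \<le> y" "y \<le> d'" using y0 d by (auto simp: y_def)
      have "stair (real (r - 1)) ((d' - y) * c n / real r) \<le> stair (real (r - 1)) \<Theta>"
      proof (rule stair_mono)
        show "(d' - y) * c n / real r \<le> \<Theta>"
        proof (cases "y0 \<le> d'")
          case True
          then have "(d' - y) * c n \<le> (real r * \<Theta> / c n) * c n"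
            using d'_le cp by (intro mult_right_mono) (auto simp: y_def)
          then show ?thesis using cp r by (simp add: field_simps)
        next
          case False
          then show ?thesis using \<Theta> by (simp add: y_def)
        qed
      qed (use r in simp)
      also have "\<dots> \<le> (\<Sum>v\<in>B. \<theta> v)"
        unfolding \<Theta>_def using fB \<theta> r by (intro stair_sum_le) auto
      finally have "stair (real (r - 1)) ((d' - y) * c n / real r) / c n \<le> (\<Sum>v\<in>B. \<theta> v) / c n"
        using cp by (intro divide_right_mono) auto
      moreover have "y powr (2 / real r) / 2 \<le> y0 powr (2 / real r) / 2"
        using y by (intro divide_right_mono powr_mono2) (auto simp: y_def)
      ultimately have "rho r d' (c n) y - \<zeta> \<le> real (card G) / s n ^ 2"
        using edges unfolding rho_def by linarith
      then show "\<exists>y. 0 \<le> y \<and> y \<le> d' \<and> rho r d' (c n) y - \<zeta> \<le> real (card G) / s n ^ 2"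
        using y by blast
    qed
  qed
qed

end

section \<open>The lower bound on the rate\<close>

context clique_regime
begin

lemma upper_tail_prob_eq:
  "upper_tail_prob r n (p n) \<delta> = measure_pmf.prob (random_graph n (p n)) {E. num_cliques n r E \<ge> (1 + \<delta>) * mean n}"
  using p01[of n] by (simp add: upper_tail_prob_def expectation_num_cliques mean_def)

lemma s2L_at_top: "filterlim (\<lambda>n. s n ^ 2 * L n) at_top sequentially"
  by (intro filterlim_at_top_mult_at_top L_at_top filterlim_pow_at_top s_at_top) simp

text \<open>Planting the complete graph suffices, since all its \<open>r\<close>-sets are cliques
  while the mean is a vanishing fraction of them. Positivity is what allows logarithms of the
  probability to be compared.\<close>

lemma eventually_upper_tail_prob_pos:
  assumes "\<delta> > 0"
  shows "eventually (\<lambda>n. 0 < upper_tail_prob r n (p n) \<delta>) sequentially"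
proof -
  have "eventually (\<lambda>n. p n < 1 / (1 + \<delta>)) sequentially"
    using assms by (intro eventually_p_less) simp
  then show ?thesis using eventually_p eventually_ge_at_top[of r]
  proof eventually_elim
    case (elim n)
    let ?G = "pairs {1..n}"
    have full: "cexp n r (p n) ?G = real (n choose r)"
    proof -
      have E: "pairs S - ?G = {}" if "S \<in> rsets n r" for S using rsetsD(4)[OF that] by blast
      have "cexp n r (p n) ?G = (\<Sum>S\<in>rsets n r. 1)"
        unfolding cexp_def by (intro sum.cong refl) (simp only: E card.empty power_0)
      then show ?thesis by (simp add: card_rsets)
    qed
    have C: "real (n choose r) > 0" using elim by simp
    have "1 \<le> r choose 2" using zero_less_binomial[of 2 r] r by linarith
    from power_decreasing[OF this, of "p n"] have "p n ^ (r choose 2) \<le> p n ^ 1" using elim by simp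
    also have "\<dots> < 1 / (1 + \<delta>)" using elim by simp
    finally have "(1 + \<delta>) * p n ^ (r choose 2) < 1" using assms by (simp add: field_simps)
    then have "(1 + \<delta>) * p n ^ (r choose 2) * real (n choose r) < 1 * real (n choose r)"
      using C by (intro mult_strict_right_mono)
    then have "(1 + \<delta>) * mean n < real (n choose r)" by (simp add: mean_def cexp_empty mult_ac)
    then have "0 < p n ^ card ?G * (cexp n r (p n) ?G - (1 + \<delta>) * mean n)"
      using elim unfolding full by simp
    also have "\<dots> \<le> real (n choose r) * upper_tail_prob r n (p n) \<delta>"
      unfolding upper_tail_prob_eq
      using elim assms by (intro prob_ge_of_planted) (auto simp: mean_def cexp_empty)
    finally show ?case using C by (simp add: zero_less_mult_iff)
  qed
qed

text \<open>The values \<open>d' < d < \<delta>1 < \<delta>\<close> are the excess entering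
  \<open>rho\<close>, that of a core, that possible without a core, and that of the event. The first
  gap absorbs the errors in \<open>core_size\<close>, the second the edges discarded on the way to a
  core, and the third makes Markov's ratio \<open>q0\<close> less than 1.\<close>

lemma eventually_ratio_ge:
  assumes d': "0 < d'" "d' < \<delta>" and v: "0 < v" and \<epsilon>: "0 < \<epsilon>"
    and ev: "eventually (\<lambda>n. \<forall>y. 0 \<le> y \<longrightarrow> y \<le> d' \<longrightarrow> v \<le> rho r d' (c n) y) sequentially"
  shows "eventually (\<lambda>n. v - \<epsilon> \<le> log_tail_ratio r \<delta> p n) sequentially"
proof -
  define \<zeta> where "\<zeta> = min (v / 2) (\<epsilon> / 4)"
  define \<epsilon>1 where "\<epsilon>1 = min (1 / 2) (\<epsilon> / (4 * v))"
  have \<zeta>: "0 < \<zeta>" "\<zeta> \<le> v / 2" "\<zeta> \<le> \<epsilon> / 4" using v \<epsilon> by (auto simp: \<zeta>_def)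
  have \<epsilon>1: "0 < \<epsilon>1" "\<epsilon>1 \<le> 1 / 2" "\<epsilon>1 * v \<le> \<epsilon> / 4"
  proof -
    show "0 < \<epsilon>1" "\<epsilon>1 \<le> 1 / 2" using v \<epsilon> by (auto simp: \<epsilon>1_def)
    have "\<epsilon>1 * v \<le> \<epsilon> / (4 * v) * v" using v by (intro mult_right_mono) (auto simp: \<epsilon>1_def)
    then show "\<epsilon>1 * v \<le> \<epsilon> / 4" using v by simp
  qed
  \<comment> \<open>The rate left after the loss \<open>\<zeta>\<close> in the size of a core and
    the fraction \<open>\<epsilon>1\<close> spent on counting cores.\<close>
  define w where "w = (1 - \<epsilon>1) * (v - \<zeta>)"
  have w: "v - \<epsilon> / 2 \<le> w" "w \<le> v" "0 < w"
  proof -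
    have "w = v - \<zeta> - \<epsilon>1 * v + \<epsilon>1 * \<zeta>" by (simp add: w_def algebra_simps)
    moreover have "0 \<le> \<epsilon>1 * \<zeta>" using \<epsilon>1 \<zeta> by simp
    ultimately show "v - \<epsilon> / 2 \<le> w" using \<epsilon>1 \<zeta> by linarith
    show "0 < w" using \<epsilon>1 \<zeta> v by (simp add: w_def)
    have "(1 - \<epsilon>1) * (v - \<zeta>) \<le> 1 * v" using \<epsilon>1 \<zeta> v by (intro mult_mono) auto
    then show "w \<le> v" by (simp add: w_def)
  qed
  define d where "d = (d' + \<delta>) / 2"
  define \<delta>1 where "\<delta>1 = (d + \<delta>) / 2"
  have dd: "d' < d" "d < \<delta>1" "\<delta>1 < \<delta>" using d' by (auto simp: d_def \<delta>1_def)
  define q0 where "q0 = (1 + \<delta>1) / (1 + \<delta>)"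
  have q0: "0 < q0" "q0 < 1" "ln q0 < 0" using dd d' by (auto simp: q0_def)
  define C2 where "C2 = real (r choose 2)"
  have "0 < r choose 2" using r by (intro zero_less_binomial) simp
  then have C2: "C2 \<ge> 1" by (simp add: C2_def Suc_le_eq)
  \<comment> \<open>Markov's bound is \<open>q0 ^ l\<close> with \<open>l\<close> about
    \<open>K * s n ^ 2 * L n / C2\<close>; this \<open>K\<close> makes it of order at most
    \<open>exp (- v * s n ^ 2 * L n)\<close>.\<close>
  define K where "K = max 1 (C2 * v / (- ln q0))"
  have K: "1 \<le> K" "v * C2 \<le> K * (- ln q0)"
  proof -
    show "1 \<le> K" by (simp add: K_def)
    have "C2 * v / (- ln q0) * (- ln q0) \<le> K * (- ln q0)"
      using q0 by (intro mult_right_mono) (auto simp: K_def)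
    then show "v * C2 \<le> K * (- ln q0)" using q0 by (simp add: mult.commute)
  qed
  define \<eta> where "\<eta> = min 1 ((\<delta>1 - d) / K)"
  have \<eta>: "0 < \<eta>" "\<eta> \<le> 1" "K * \<eta> \<le> \<delta>1 - d"
  proof -
    show "0 < \<eta>" "\<eta> \<le> 1" using K dd by (auto simp: \<eta>_def)
    have "K * \<eta> \<le> K * ((\<delta>1 - d) / K)" using K by (intro mult_left_mono) (auto simp: \<eta>_def)
    then show "K * \<eta> \<le> \<delta>1 - d" using K by simp
  qed
  \<comment> \<open>\<open>N\<close> and \<open>l\<close> are both rounded down, which costs at most
    two factors \<open>q0\<close>.\<close>
  define q where "q = 1 / q0 ^ 2"
  have q: "q > 0" using q0 by (simp add: q_def)
  have "((\<lambda>x. ln (K * x + q) / x) \<longlongrightarrow> 0) at_top" using K q by real_asymp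
  from filterlim_compose[OF this s2L_at_top]
  have ev_ln: "eventually (\<lambda>n. ln (K * (s n ^ 2 * L n) + q) / (s n ^ 2 * L n) < \<epsilon> / 2) sequentially"
    using \<epsilon> by (intro order_tendstoD(2)) auto
  have d0: "0 < d" using d' dd by simp
  show ?thesis
    using core_size[OF K(1) \<eta>(1,2) d'(1) dd(1) \<zeta>(1)] card_core_le[OF K(1) \<eta>(1,2) \<epsilon>1(1), of d] ev ev_ln
      eventually_parameters[OF \<eta>(1,2)] eventually_mean_bounds eventually_upper_tail_prob_pos[OF less_trans[OF d']]
  proof eventually_elim
    case (elim n)
    then have par: "0 < p n" "p n < 1" "1 \<le> L n" "0 < s n" and mean: "0 < mean n" by auto
    define x where "x = s n ^ 2 * L n"
    have x: "x > 0" using par by (simp add: x_def)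
    define N where "N = nat \<lfloor>K * x\<rfloor>"
    have N: "real N \<le> K * x" "K * x - 1 \<le> real N" using K x by (auto simp: N_def)
    have N_iff: "m \<le> N \<longleftrightarrow> real m \<le> K * x" for m using K x by (simp add: N_def le_nat_floor le_nat_iff le_floor_iff)
    define \<C> where "\<C> = core K d \<eta> n"
    define M where "M = exp (- w * x)"
    have fin: "finite \<C>" unfolding \<C>_def core_def by (rule finite_subset[of _ "Pow (pairs {1..n})"]) auto
    have coreless: "cexp n r (p n) U \<le> (1 + \<delta>1) * mean n"
      if U: "U \<subseteq> pairs {1..n}" "card U \<le> N" "\<forall>C\<in>\<C>. \<not> C \<subseteq> U" for U
    proof (rule ccontr)
      assume neg: "\<not> cexp n r (p n) U \<le> (1 + \<delta>1) * mean n"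
      have fU: "finite U" using finite_subset[OF U(1)] by simp
      have "real (card U) * (\<eta> * mean n / x) \<le> K * x * (\<eta> * mean n / x)"
        using U(2) x mean \<eta> by (intro mult_right_mono) (auto simp: N_iff)
      also have "\<dots> = K * \<eta> * mean n" using x by simp
      also have "\<dots> \<le> (\<delta>1 - d) * mean n" using \<eta> mean by (intro mult_right_mono) auto
      finally have "(1 + d) * mean n + real (card U) * (\<eta> * mean n / x) \<le> cexp n r (p n) U"
        using neg by (simp add: algebra_simps)
      from exists_minimal_core[where f = "cexp n r (p n)", OF fU this] obtain C where C: "C \<subseteq> U"
        "(1 + d) * mean n + real (card C) * (\<eta> * mean n / x) \<le> cexp n r (p n) C"
        "\<forall>e\<in>C. \<eta> * mean n / x \<le> cexp n r (p n) C - cexp n r (p n) (C - {e})" by blast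
      have "0 \<le> real (card C) * (\<eta> * mean n / x)" using \<eta> mean x by simp
      then have "(1 + d) * mean n \<le> cexp n r (p n) C" using C(2) by linarith
      moreover have "card C \<le> N" using card_mono[OF fU C(1)] U(2) by simp
      ultimately have "C \<in> \<C>" using C U(1) unfolding \<C>_def core_def x_def[symmetric] by (auto simp: N_iff)
      then show False using U(3) C(1) by blast
    qed
    have sum_core: "(\<Sum>C\<in>\<C>. p n ^ card C) \<le> real N * M"
    proof -
      have cards: "card C \<in> {1..N}" if C: "C \<in> \<C>" for C
      proof -
        have "card C \<le> N" using C unfolding \<C>_def core_def x_def[symmetric] by (auto simp: N_iff)
        \<comment> \<open>The count in \<open>card_core_le\<close> starts at one edge; the empty
          graph has no excess, while \<open>d > 0\<close>.\<close>
        moreover have "C \<noteq> {}"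
        proof
          assume "C = {}"
          then have "(1 + d) * mean n \<le> mean n" using C by (auto simp: \<C>_def core_def mean_def)
          then show False using mult_pos_pos[OF d0 mean] by (simp add: algebra_simps)
        qed
        moreover have "finite C" using C finite_subset[of C "pairs {1..n}"] by (simp add: \<C>_def core_def)
        ultimately show ?thesis by (simp add: Suc_le_eq card_gt_0_iff)
      qed
      \<comment> \<open>Cores are grouped by their number \<open>m\<close> of edges: each class
        contributes at most \<open>p n\<close> to the power \<open>(1 - \<epsilon>1) * m\<close>,
        and the at most \<open>N\<close> classes are harmless by \<open>ev_ln\<close>.\<close>
      have "(\<Sum>C\<in>\<C>. p n ^ card C) = (\<Sum>m\<in>card ` \<C>. \<Sum>C\<in>{C\<in>\<C>. card C = m}. p n ^ card C)"
        by (rule sum.image_gen[OF fin])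
      also have "\<dots> \<le> (\<Sum>m\<in>card ` \<C>. M)"
      proof (intro sum_mono)
        fix m assume "m \<in> card ` \<C>"
        then obtain C where C: "C \<in> \<C>" "card C = m" by auto
        have m1: "m \<ge> 1" using cards[OF C(1)] C(2) by simp
        obtain y where y: "0 \<le> y" "y \<le> d'" "rho r d' (c n) y - \<zeta> \<le> real m / s n ^ 2"
          using elim(1) C by (auto simp: \<C>_def)
        have "v \<le> rho r d' (c n) y" using elim(3) y by blast
        then have "v - \<zeta> \<le> real m / s n ^ 2" using y(3) by linarith
        then have m_ge: "(v - \<zeta>) * s n ^ 2 \<le> real m" using par by (simp add: field_simps)
        have "(\<Sum>C\<in>{C\<in>\<C>. card C = m}. p n ^ card C) = real (card {C\<in>\<C>. card C = m}) * p n ^ m" by simp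
        also have "\<dots> \<le> exp (\<epsilon>1 * L n * real m) * p n ^ m"
          using elim(2) m1 par unfolding \<C>_def by (intro mult_right_mono) auto
        also have "p n ^ m = exp (- L n * real m)"
          using p_eq_exp[OF par(1)] exp_of_nat_mult[of m "- L n"] by (simp add: mult.commute)
        also have "exp (\<epsilon>1 * L n * real m) * exp (- L n * real m) = exp (- ((1 - \<epsilon>1) * L n * real m))"
          unfolding exp_add[symmetric] by (simp add: algebra_simps)
        also have "\<dots> \<le> M"
        proof -
          have "(1 - \<epsilon>1) * L n * ((v - \<zeta>) * s n ^ 2) \<le> (1 - \<epsilon>1) * L n * real m"
            using m_ge \<epsilon>1 par by (intro mult_left_mono) auto
          then show ?thesis by (simp add: M_def w_def x_def mult_ac)
        qed
        finally show "(\<Sum>C\<in>{C\<in>\<C>. card C = m}. p n ^ card C) \<le> M" .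
      qed
      also have "\<dots> = real (card (card ` \<C>)) * M" by simp
      also have "\<dots> \<le> real N * M"
      proof (rule mult_right_mono)
        have "card (card ` \<C>) \<le> card {1..N}" using cards by (intro card_mono) auto
        then show "real (card (card ` \<C>)) \<le> real N" by simp
      qed (simp add: M_def)
      finally show ?thesis .
    qed
    define l where "l = N div (r choose 2)"
    have ql: "q0 ^ l \<le> q * M"
    proof -
      have "C2 * (real l + 1) \<ge> real N"
      proof -
        have "N < (r choose 2) * (l + 1)"
          using r unfolding l_def by (simp add: dividend_less_times_div)
        then have "real N \<le> real ((r choose 2) * (l + 1))" by (simp only: of_nat_le_iff)
        then show ?thesis by (simp add: C2_def algebra_simps)
      qed
      then have "K * x \<le> C2 * (real l + 1) + 1" using N by linarith
      also have "\<dots> \<le> C2 * (real l + 2)" using C2 by (simp add: algebra_simps)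
      finally have "K * x * (- ln q0) \<le> C2 * (real l + 2) * (- ln q0)" using q0 by (intro mult_right_mono) auto
      moreover have "v * C2 * x \<le> K * (- ln q0) * x" using K x by (intro mult_right_mono) auto
      ultimately have "C2 * (v * x) \<le> C2 * ((real l + 2) * (- ln q0))" by (simp add: mult_ac)
      then have "v * x \<le> (real l + 2) * (- ln q0)"
        by (rule mult_left_le_imp_le) (use C2 in simp)
      moreover have "w * x \<le> v * x" using w x by (intro mult_right_mono) auto
      ultimately have "real l * ln q0 \<le> - 2 * ln q0 + - w * x" by (simp add: algebra_simps)
      then have "exp (real l * ln q0) \<le> exp (- 2 * ln q0) * M"
        by (simp add: M_def flip: exp_add)
      moreover have "exp (real l * ln q0) = q0 ^ l" using q0 exp_of_nat_mult[of l "ln q0"] by simp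
      moreover have "exp (- 2 * ln q0) = q"
      proof -
        have "exp (- 2 * ln q0) = 1 / exp (real 2 * ln q0)" by (simp add: exp_minus inverse_eq_divide)
        also have "\<dots> = q" using q0 exp_of_nat_mult[of 2 "ln q0"] by (simp add: q_def)
        finally show ?thesis .
      qed
      ultimately show ?thesis by simp
    qed
    have "upper_tail_prob r n (p n) \<delta>
      \<le> (\<Sum>C\<in>\<C>. p n ^ card C) + ((1 + \<delta>1) * mean n / ((1 + \<delta>) * mean n)) ^ l"
      unfolding upper_tail_prob_eq
    proof (rule prob_ge_le_cores[where N = N])
      show "(r choose 2) * l \<le> N" by (simp add: l_def)
      show "C \<in> \<C> \<Longrightarrow> C \<subseteq> pairs {1..n}" for C by (auto simp: \<C>_def core_def)
    qed (use par mean dd d' d0 coreless in auto)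
    also have "(1 + \<delta>1) * mean n / ((1 + \<delta>) * mean n) = q0" using mean by (simp add: q0_def)
    also have "(\<Sum>C\<in>\<C>. p n ^ card C) + q0 ^ l \<le> (K * x + q) * M"
    proof -
      have "real N * M \<le> K * x * M" using N by (intro mult_right_mono) (auto simp: M_def)
      then show ?thesis using sum_core ql by (simp add: algebra_simps)
    qed
    finally have P: "upper_tail_prob r n (p n) \<delta> \<le> (K * x + q) * M" .
    have Kx: "K * x + q > 0" using K x q by (simp add: add_pos_pos)
    have "ln (upper_tail_prob r n (p n) \<delta>) \<le> ln ((K * x + q) * M)"
      using P elim(7) by simp
    also have "\<dots> = ln (K * x + q) - w * x" using Kx by (simp add: ln_mult M_def)
    finally have "(w * x - ln (K * x + q)) / x \<le> - ln (upper_tail_prob r n (p n) \<delta>) / x"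
      using x by (intro divide_right_mono) auto
    moreover have "(w * x - ln (K * x + q)) / x = w - ln (K * x + q) / x" using x by (simp add: diff_divide_distrib)
    moreover have "ln (K * x + q) / x < \<epsilon> / 2" using elim(4) by (simp add: x_def)
    moreover have "log_tail_ratio r \<delta> p n = - ln (upper_tail_prob r n (p n) \<delta>) / x"
      by (simp add: log_tail_ratio_eq x_def)
    ultimately show ?case using w by linarith
  qed
qed

end

section \<open>Planting a clique and hubs\<close>

text \<open>An \<open>r\<close>-set inside \<open>Q\<close> is certain; a hub with
  \<open>r - 1\<close> of its leaves misses at most the pairs among the leaves. No hub is a leaf or
  lies in \<open>Q\<close>, so a star has exactly one vertex in \<open>H\<close>: its hub is
  determined, and no star is a subset of \<open>Q\<close>.\<close>

lemma planted_graph: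
  fixes p :: real and N :: "nat \<Rightarrow> nat set"
  assumes Q: "Q \<subseteq> {1..n}" and H: "H \<subseteq> {1..n}" and QH: "Q \<inter> H = {}" and N: "\<And>x. x \<in> H \<Longrightarrow> N x \<subseteq> {1..n} - H"
    and p: "0 \<le> p" "p \<le> 1" and r: "2 \<le> r"
  defines "G \<equiv> pairs Q \<union> (\<Union>x\<in>H. (\<lambda>y. {x, y}) ` N x)"
  shows "G \<subseteq> pairs {1..n}"
    and "card G \<le> (card Q choose 2) + (\<Sum>x\<in>H. card (N x))"
    and "real (n choose r) * p ^ (r choose 2) + real (card Q choose r) * (1 - p ^ (r choose 2))
      + real (\<Sum>x\<in>H. card (N x) choose (r - 1)) * (p ^ (r - 1 choose 2) - p ^ (r choose 2)) \<le> cexp n r p G"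
proof -
  have fin: "finite Q" "finite H" using Q H finite_subset by blast+
  have finN: "finite (N x)" if "x \<in> H" for x using N[OF that] finite_subset by blast
  show "G \<subseteq> pairs {1..n}"
  proof -
    have "{x, y} \<in> pairs {1..n}" if "x \<in> H" "y \<in> N x" for x y
    proof -
      have "x \<noteq> y" "y \<in> {1..n}" "x \<in> {1..n}" using that N[OF that(1)] H by auto
      then show ?thesis by (simp add: pairs_def)
    qed
    then show ?thesis using pairs_mono[OF Q] by (auto simp: G_def)
  qed
  have "card (\<Union>x\<in>H. (\<lambda>y. {x, y}) ` N x) \<le> (\<Sum>x\<in>H. card ((\<lambda>y. {x, y}) ` N x))" by (rule card_UN_le[OF fin(2)])
  also have "\<dots> \<le> (\<Sum>x\<in>H. card (N x))" by (intro sum_mono card_image_le finN)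
  finally show "card G \<le> (card Q choose 2) + (\<Sum>x\<in>H. card (N x))"
    unfolding G_def using card_Un_le[of "pairs Q" "\<Union>x\<in>H. (\<lambda>y. {x, y}) ` N x"] card_pairs[OF fin(1)] by linarith
  let ?T = "\<lambda>x. {T. T \<subseteq> N x \<and> card T = r - 1}"
  define S2 where "S2 = (\<Union>x\<in>H. insert x ` ?T x)"
  have notH: "T \<inter> H = {}" "finite T" if "x \<in> H" "T \<in> ?T x" for x T
    using that N[OF that(1)] finite_subset[OF _ finN[OF that(1)]] by auto
  have S2_sub: "S2 \<subseteq> rsets n r"
  proof
    fix S assume "S \<in> S2"
    then obtain x T where xT: "x \<in> H" "T \<in> ?T x" "S = insert x T" by (auto simp: S2_def)
    then have "x \<notin> T" using notH[OF xT(1,2)] by auto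
    then have "card S = r" using xT notH[OF xT(1,2)] r by simp
    moreover have "S \<subseteq> {1..n}" using xT N[OF xT(1)] H by auto
    ultimately show "S \<in> rsets n r" by (simp add: rsets_def)
  qed
  have card_S2: "card S2 = (\<Sum>x\<in>H. card (N x) choose (r - 1))"
  proof -
    have "card S2 = (\<Sum>x\<in>H. card (insert x ` ?T x))"
      unfolding S2_def
    proof (rule card_UN_disjoint[OF fin(2)])
      show "\<forall>x\<in>H. finite (insert x ` ?T x)" using finN by simp
      show "\<forall>x\<in>H. \<forall>y\<in>H. x \<noteq> y \<longrightarrow> insert x ` ?T x \<inter> insert y ` ?T y = {}"
      proof (intro ballI impI)
        fix x y assume xy: "x \<in> H" "y \<in> H" "x \<noteq> y"
        have "insert x T \<inter> H = {x}" if "T \<in> ?T x" for T using notH[OF xy(1) that] xy by auto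
        moreover have "insert y T \<inter> H = {y}" if "T \<in> ?T y" for T using notH[OF xy(2) that] xy by auto
        ultimately show "insert x ` ?T x \<inter> insert y ` ?T y = {}" using xy(3) by (metis (no_types, lifting) disjoint_iff imageE singleton_inject)
      qed
    qed
    also have "\<dots> = (\<Sum>x\<in>H. card (?T x))"
    proof (intro sum.cong refl card_image)
      fix x assume x: "x \<in> H"
      have "x \<notin> T" if "T \<in> ?T x" for T using notH[OF x that] x by auto
      then show "inj_on (insert x) (?T x)" by (meson inj_onI insert_ident)
    qed
    also have "\<dots> = (\<Sum>x\<in>H. card (N x) choose (r - 1))" by (intro sum.cong refl n_subsets finN)
    finally show ?thesis .
  qed
  let ?a = "p ^ (r choose 2)" and ?b = "p ^ (r - 1 choose 2)"
  have "real (n choose r) * ?a + real (card Q choose r) * (1 - ?a) + real (\<Sum>x\<in>H. card (N x) choose (r - 1)) * (?b - ?a)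
    = (\<Sum>S\<in>rsets n r. ?a + (if S \<subseteq> Q then 1 - ?a else 0) + (if S \<in> S2 then ?b - ?a else 0))"
  proof -
    have "{S\<in>rsets n r. S \<subseteq> Q} = {S. S \<subseteq> Q \<and> card S = r}" using Q by (auto simp: rsets_def)
    moreover have "{S\<in>rsets n r. S \<in> S2} = S2" using S2_sub by auto
    ultimately show ?thesis
      using n_subsets[OF fin(1), of r] by (simp add: sum.distrib card_rsets card_S2 flip: sum.inter_filter)
  qed
  also have "\<dots> \<le> cexp n r p G"
    unfolding cexp_def
  proof (intro sum_mono)
    fix S assume S: "S \<in> rsets n r"
    have a_le: "?a \<le> p ^ card (pairs S - G)"
    proof (rule power_decreasing)
      show "card (pairs S - G) \<le> r choose 2"
        using card_mono[of "pairs S" "pairs S - G"] card_pairs_rsets[OF S] rsetsD(1)[OF S] by auto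
    qed (use p in auto)
    show "?a + (if S \<subseteq> Q then 1 - ?a else 0) + (if S \<in> S2 then ?b - ?a else 0) \<le> p ^ card (pairs S - G)"
    proof (cases "S \<in> S2")
      case True
      then obtain x T where xT: "x \<in> H" "T \<in> ?T x" "S = insert x T" by (auto simp: S2_def)
      then have nQ: "\<not> S \<subseteq> Q" using QH by auto
      have xT': "x \<notin> T" "finite T" using notH[OF xT(1,2)] xT(1) by auto
      have "pairs S - G \<subseteq> pairs T"
        using xT unfolding xT(3) pairs_insert[OF xT'(1)] by (auto simp: G_def)
      then have "card (pairs S - G) \<le> card (pairs T)" using xT'(2) by (intro card_mono) auto
      then have "?b \<le> p ^ card (pairs S - G)"
        using p xT xT' by (intro power_decreasing) (auto simp: card_pairs)
      then show ?thesis using nQ True by simp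
    next
      case False
      show ?thesis
      proof (cases "S \<subseteq> Q")
        case True
        then have "pairs S - G = {}" using pairs_mono[of S Q] by (auto simp: G_def)
        then show ?thesis using True False by (simp only: card.empty) simp
      qed (use False a_le in simp)
    qed
  qed
  finally show "real (n choose r) * ?a + real (card Q choose r) * (1 - ?a)
      + real (\<Sum>x\<in>H. card (N x) choose (r - 1)) * (?b - ?a) \<le> cexp n r p G" .
qed

context clique_regime
begin

lemma s_over_n: "(\<lambda>n. s n / real n) \<longlonglongrightarrow> 0"
proof -
  have "(\<lambda>n. L n powr 0 * p n powr (real (r - 1) / 2)) \<longlonglongrightarrow> 0"
    using r by (intro polylog_times_p) auto
  moreover have "eventually (\<lambda>n. L n powr 0 * p n powr (real (r - 1) / 2) = s n / real n) sequentially"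
    using eventually_p eventually_L_ge[of 1] by eventually_elim (auto simp: s_def)
  ultimately show ?thesis by (rule Lim_transform_eventually)
qed

lemma p_power_tendsto_0: "k > 0 \<Longrightarrow> (\<lambda>n. p n ^ k) \<longlonglongrightarrow> 0"
  using tendsto_power[OF p_tendsto_0, of k] by (simp add: zero_power)

lemma ceiling_clique_size:
  assumes "0 \<le> \<kappa>"
  shows "(\<lambda>n. real (nat \<lceil>\<kappa> * s n\<rceil>) / s n) \<longlonglongrightarrow> \<kappa>"
    "(\<lambda>n. real (nat \<lceil>\<kappa> * s n\<rceil> choose r) * fact r / s n ^ r) \<longlonglongrightarrow> \<kappa> ^ r"
proof -
  let ?k = "\<lambda>n. nat \<lceil>\<kappa> * s n\<rceil>"
  have s0: "eventually (\<lambda>n. s n > 0) sequentially" using eventually_p by eventually_elim (auto intro: s_pos)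
  show lim: "(\<lambda>n. real (?k n) / s n) \<longlonglongrightarrow> \<kappa>"
  proof (rule tendsto_sandwich)
    show "eventually (\<lambda>n. \<kappa> \<le> real (?k n) / s n) sequentially"
      using s0
    proof eventually_elim
      case (elim n)
      then show ?case using real_nat_ceiling_ge[of "\<kappa> * s n"] by (simp add: pos_le_divide_eq)
    qed
    show "eventually (\<lambda>n. real (?k n) / s n \<le> \<kappa> + 1 / s n) sequentially"
      using s0
    proof eventually_elim
      case (elim n)
      have "0 \<le> \<kappa> * s n" using assms elim by simp
      then have "real (?k n) = of_int \<lceil>\<kappa> * s n\<rceil>" by simp
      also have "\<dots> \<le> \<kappa> * s n + 1" by linarith
      finally show ?case using elim by (simp add: field_simps)
    qed
    have "(\<lambda>n. 1 / s n) \<longlonglongrightarrow> 0"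
      by (rule tendsto_divide_0[OF tendsto_const]) (rule filterlim_at_top_imp_at_infinity[OF s_at_top])
    from tendsto_add[OF tendsto_const this] show "(\<lambda>n. \<kappa> + 1 / s n) \<longlonglongrightarrow> \<kappa>" by simp
  qed (rule tendsto_const)
  show "(\<lambda>n. real (?k n choose r) * fact r / s n ^ r) \<longlonglongrightarrow> \<kappa> ^ r"
    using r by (intro binomial_proportion lim s_at_top assms) simp
qed

text \<open>The planted graph has a clique on about \<open>\<kappa> * s n\<close> vertices,
  \<open>h n\<close> hubs joined to everything that is no hub, and one further hub with
  \<open>d n\<close> leaves. The hubs add \<open>a\<close> and \<open>b\<close> to the excess in
  units of \<open>r\<close> times the mean, and use \<open>a\<close> and \<open>g\<close> edges in
  units of \<open>s n ^ 2\<close>. The strict inequality \<open>large\<close> leaves a fixed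
  proportion of the mean to spare.\<close>

lemma eventually_ratio_le:
  fixes h d :: "nat \<Rightarrow> nat"
  assumes \<delta>: "0 < \<delta>" and \<kappa>: "0 \<le> \<kappa>"
    and h: "(\<lambda>n. real (h n) / c n) \<longlonglongrightarrow> a"
    and d: "(\<lambda>n. real (d n choose (r - 1)) * fact (r - 1) / real n ^ (r - 1) / c n) \<longlonglongrightarrow> b"
    and d': "(\<lambda>n. real (d n) / real n / c n) \<longlonglongrightarrow> g"
    and room: "eventually (\<lambda>n. d n + h n + 1 \<le> n) sequentially"
    and large: "\<delta> < \<kappa> ^ r + real r * (a + b)" and \<epsilon>: "0 < \<epsilon>"
  shows "eventually (\<lambda>n. log_tail_ratio r \<delta> p n \<le> \<kappa> ^ 2 / 2 + a + g + \<epsilon>) sequentially"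
proof -
  define k where "k = (\<lambda>n. nat \<lceil>\<kappa> * s n\<rceil>)"
  have k_lim: "(\<lambda>n. real (k n) / s n) \<longlonglongrightarrow> \<kappa>"
      "(\<lambda>n. real (k n choose r) * fact r / s n ^ r) \<longlonglongrightarrow> \<kappa> ^ r"
    unfolding k_def by (rule ceiling_clique_size[OF \<kappa>])+
  have one_n: "(\<lambda>n. 1 / real n) \<longlonglongrightarrow> 0" by real_asymp
  have hn: "(\<lambda>n. real (h n) / real n) \<longlonglongrightarrow> 0"
  proof -
    have "(\<lambda>n. real (h n) / c n * p n ^ (r - 1)) \<longlonglongrightarrow> a * 0"
      using r by (intro tendsto_mult h p_power_tendsto_0) simp
    moreover have "eventually (\<lambda>n. real (h n) / c n * p n ^ (r - 1) = real (h n) / real n) sequentially"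
      using eventually_p by eventually_elim (simp add: c_def)
    ultimately show ?thesis by (simp add: Lim_transform_eventually)
  qed
  have kn: "(\<lambda>n. real (k n) / real n) \<longlonglongrightarrow> 0"
  proof -
    have "(\<lambda>n. real (k n) / s n * (s n / real n)) \<longlonglongrightarrow> \<kappa> * 0" by (intro tendsto_mult k_lim s_over_n)
    moreover have "eventually (\<lambda>n. real (k n) / s n * (s n / real n) = real (k n) / real n) sequentially"
      using eventually_p by eventually_elim (simp add: s_def)
    ultimately show ?thesis by (simp add: Lim_transform_eventually)
  qed
  have room_k: "eventually (\<lambda>n. k n + h n + 1 \<le> n) sequentially"
  proof -
    have "(\<lambda>n. real (k n) / real n + real (h n) / real n + 1 / real n) \<longlonglongrightarrow> 0 + 0 + 0"
      by (intro tendsto_add kn hn one_n)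
    then have "eventually (\<lambda>n. real (k n) / real n + real (h n) / real n + 1 / real n < 1) sequentially"
      by (intro order_tendstoD(2)) auto
    then show ?thesis using eventually_p
    proof eventually_elim
      case (elim n)
      then have "(real (k n) + real (h n) + 1) / real n < 1" by (simp only: add_divide_distrib)
      then show ?case using elim by (simp add: divide_less_eq)
    qed
  qed
  \<comment> \<open>The number of leaves of a full hub: all vertices but the \<open>h n + 1\<close>
    hubs, the partial one included.\<close>
  define N where "N = (\<lambda>n. n - h n - 1)"
  have N_lim: "(\<lambda>n. real (N n choose (r - 1)) * fact (r - 1) / real n ^ (r - 1)) \<longlonglongrightarrow> 1"
  proof -
    have "(\<lambda>n. 1 - real (h n) / real n - 1 / real n) \<longlonglongrightarrow> 1 - 0 - 0" by (intro tendsto_diff tendsto_const hn one_n)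
    moreover have "eventually (\<lambda>n. 1 - real (h n) / real n - 1 / real n = real (N n) / real n) sequentially"
      using eventually_p room
    proof eventually_elim
      case (elim n)
      then have "real (N n) = real n - real (h n) - 1" by (simp add: N_def of_nat_diff)
      then show ?case using elim by (simp add: diff_divide_distrib)
    qed
    ultimately have Nn: "(\<lambda>n. real (N n) / real n) \<longlonglongrightarrow> 1" by (simp add: Lim_transform_eventually)
    have "(\<lambda>n. real (N n choose (r - 1)) * fact (r - 1) / real n ^ (r - 1)) \<longlonglongrightarrow> 1 ^ (r - 1)"
      using r by (intro binomial_proportion Nn filterlim_real_sequentially) simp_all
    then show ?thesis by simp
  qed
  \<comment> \<open>A lower bound for the excess of the planted graph, in units of
    \<open>s n ^ r / fact r\<close>.\<close>
  define X where "X = (\<lambda>n. real (k n choose r) * fact r / s n ^ r * (1 - p n ^ (r choose 2))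
      + (1 - p n ^ (r - 1)) * (real r * (real (h n) / c n * (real (N n choose (r - 1)) * fact (r - 1) / real n ^ (r - 1))
        + real (d n choose (r - 1)) * fact (r - 1) / real n ^ (r - 1) / c n)))"
  have r2: "0 < r choose 2" using zero_less_binomial[of 2 r] r by linarith
  have X_lim: "(\<lambda>n. X n - \<delta> * (mean n * fact r / s n ^ r)) \<longlonglongrightarrow>
      (\<kappa> ^ r * (1 - 0) + (1 - 0) * (real r * (a * 1 + b))) - \<delta> * 1"
    unfolding X_def using r r2
    by (intro tendsto_diff tendsto_add tendsto_mult tendsto_const k_lim(2) p_power_tendsto_0 h d N_lim mean_asymp) simp_all
  define z where "z = (\<kappa> ^ r + real r * (a + b) - \<delta>) / 2"
  have z: "z > 0" using large by (simp add: z_def)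
  have ev_X: "eventually (\<lambda>n. X n - \<delta> * (mean n * fact r / s n ^ r) > z) sequentially"
    by (rule order_tendstoD(1)[OF X_lim]) (use large in \<open>simp add: z_def\<close>)
  have ev_mean: "eventually (\<lambda>n. mean n * fact r / s n ^ r < 2) sequentially"
    by (rule order_tendstoD(2)[OF mean_asymp]) simp
  define U where "U = (\<lambda>n. (real (k n) / s n) ^ 2 / 2 + real (h n) / c n + real (d n) / real n / c n
      + real (r choose 2) / s n ^ 2 - ln (z / 2) / (s n ^ 2 * L n))"
  have "filterlim (\<lambda>n. s n ^ 2) at_top sequentially" by (intro filterlim_pow_at_top s_at_top) simp
  then have "U \<longlonglongrightarrow> \<kappa> ^ 2 / 2 + a + g + 0 - 0"
    unfolding U_def
    by (intro tendsto_add tendsto_diff tendsto_divide tendsto_const tendsto_power k_lim(1) h d'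
        tendsto_divide_0[OF tendsto_const] filterlim_at_top_imp_at_infinity s2L_at_top) simp_all
  then have ev_U: "eventually (\<lambda>n. U n < \<kappa> ^ 2 / 2 + a + g + \<epsilon>) sequentially"
    using \<epsilon> by (intro order_tendstoD(2)) auto
  show ?thesis
    using ev_X ev_mean ev_U room room_k eventually_p eventually_L_ge[of 1] eventually_mean_bounds
      eventually_upper_tail_prob_pos[OF \<delta>]
  proof eventually_elim
    case (elim n)
    then have par: "0 < p n" "p n < 1" "n > 0" and L: "L n \<ge> 1" and mean: "mean n > 0"
      and pos: "0 < upper_tail_prob r n (p n) \<delta>" by auto
    have s: "s n > 0" and cp: "c n > 0" using par s_pos c_pos by auto
    \<comment> \<open>The clique takes the first vertices after the hubs. It may share them with the
      leaves, since clique edges contain no hub.\<close>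
    define Q where "Q = {h n + 2..h n + 1 + k n}"
    define H where "H = {1..h n + 1}"
    define M where "M = (\<lambda>x. if x \<le> h n then {h n + 2..n} else {h n + 2..h n + 1 + d n})"
    define G where "G = pairs Q \<union> (\<Union>x\<in>H. (\<lambda>y. {x, y}) ` M x)"
    have sumH: "(\<Sum>x\<in>H. f (M x)) = h n * f {h n + 2..n} + f {h n + 2..h n + 1 + d n}" for f :: "nat set \<Rightarrow> nat"
    proof -
      have "H = insert (h n + 1) {1..h n}" by (auto simp: H_def)
      then have "(\<Sum>x\<in>H. f (M x)) = f (M (h n + 1)) + (\<Sum>x\<in>{1..h n}. f (M x))" by simp
      also have "(\<Sum>x\<in>{1..h n}. f (M x)) = (\<Sum>x\<in>{1..h n}. f {h n + 2..n})"
        by (intro sum.cong) (auto simp: M_def)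
      finally show ?thesis by (simp add: M_def)
    qed
    have QHM: "Q \<subseteq> {1..n}" "H \<subseteq> {1..n}" "Q \<inter> H = {}" "\<And>x. x \<in> H \<Longrightarrow> M x \<subseteq> {1..n} - H"
      using elim(4,5) by (auto simp: Q_def H_def M_def)
    have r2': "2 \<le> r" using r by simp
    note pl = planted_graph[where N = M, OF QHM less_imp_le[OF par(1)] less_imp_le[OF par(2)] r2', folded G_def]
    have cQ: "card Q = k n" by (simp add: Q_def)
    have cN: "card {h n + 2..n} = N n" by (simp add: N_def)
    have cd: "card {h n + 2..h n + 1 + d n} = d n" by simp
    have sumc: "(\<Sum>x\<in>H. card (M x)) = h n * N n + d n" using sumH[of card] unfolding cN cd .
    have sumb: "(\<Sum>x\<in>H. card (M x) choose (r - 1)) = h n * (N n choose (r - 1)) + (d n choose (r - 1))"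
      using sumH[of "\<lambda>A. card A choose (r - 1)"] unfolding cN cd .
    have edges: "real (card G) / s n ^ 2 \<le> (real (k n) / s n) ^ 2 / 2 + real (h n) / c n + real (d n) / real n / c n"
    proof -
      have "card G \<le> (k n choose 2) + (h n * N n + d n)" using pl(2) unfolding cQ sumc .
      then have "real (card G) \<le> real ((k n choose 2) + (h n * N n + d n))" by (simp only: of_nat_le_iff)
      also have "\<dots> = real (k n choose 2) + (real (h n) * real (N n) + real (d n))" by simp
      also have "real (k n choose 2) \<le> real (k n) ^ 2 / 2"
        unfolding real_choose_two by (simp add: power2_eq_square algebra_simps)
      also have "real (h n) * real (N n) \<le> real (h n) * real n"
        by (intro mult_left_mono) (simp_all add: N_def)
      finally have "real (card G) \<le> real (k n) ^ 2 / 2 + (real (h n) * real n + real (d n))" by simp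
      then have "real (card G) / s n ^ 2 \<le> (real (k n) ^ 2 / 2 + (real (h n) * real n + real (d n))) / s n ^ 2"
        by (intro divide_right_mono) auto
      also have "\<dots> = real (k n) ^ 2 / 2 / s n ^ 2 + real (h n) * real n / s n ^ 2 + real (d n) / s n ^ 2"
        by (simp only: add_divide_distrib add.assoc)
      also have "real (h n) * real n / s n ^ 2 = real (h n) / c n" using par unfolding s_sq by simp
      also have "real (d n) / s n ^ 2 = real (d n) / real n / c n" unfolding s_sq by simp
      finally show ?thesis by (simp add: power_divide)
    qed
    have "mean n + real (k n choose r) * (1 - p n ^ (r choose 2))
      + real (h n * (N n choose (r - 1)) + (d n choose (r - 1))) * (p n ^ (r - 1 choose 2) - p n ^ (r choose 2)) \<le> cexp n r (p n) G"
      using pl(3) unfolding cQ sumb mean_def cexp_empty .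
    moreover have "real (k n choose r) * (1 - p n ^ (r choose 2))
      + real (h n * (N n choose (r - 1)) + (d n choose (r - 1))) * (p n ^ (r - 1 choose 2) - p n ^ (r choose 2))
      = X n * (s n ^ r / fact r)"
    proof -
      have ch: "r choose 2 = (r - 1 choose 2) + (r - 1)" using r by (cases r) (auto simp: numeral_2_eq_2)
      have "p n ^ (r choose 2) = p n ^ (r - 1 choose 2) * p n ^ (r - 1)" unfolding ch by (rule power_add)
      then have e1: "p n ^ (r - 1 choose 2) - p n ^ (r choose 2) = p n ^ (r - 1 choose 2) * (1 - p n ^ (r - 1))"
        by (simp add: algebra_simps)
      have e2: "p n ^ (r - 1 choose 2) = real r * fact (r - 1) / (real n ^ (r - 1) * c n) * (s n ^ r / fact r)"
        unfolding star_scale[OF par(1,3), symmetric] using s by simp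
      have diff: "p n ^ (r - 1 choose 2) - p n ^ (r choose 2)
        = real r * fact (r - 1) / (real n ^ (r - 1) * c n) * (s n ^ r / fact r) * (1 - p n ^ (r - 1))"
        by (rule trans[OF e1]) (simp only: e2)
      have one: "real (k n choose r) * fact r / s n ^ r * (s n ^ r / fact r) = real (k n choose r)"
        using s by simp
      have alg: "(H1 * B1 + B2) * (R * F / (W * C) * T * w) = w * (R * (H1 / C * (B1 * F / W) + B2 * F / W / C)) * T"
        for H1 B1 B2 R F W C T w :: real
        by (simp add: algebra_simps add_divide_distrib)
      have "X n * (s n ^ r / fact r) = real (k n choose r) * fact r / s n ^ r * (s n ^ r / fact r) * (1 - p n ^ (r choose 2))
        + (1 - p n ^ (r - 1)) * (real r * (real (h n) / c n * (real (N n choose (r - 1)) * fact (r - 1) / real n ^ (r - 1))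
        + real (d n choose (r - 1)) * fact (r - 1) / real n ^ (r - 1) / c n)) * (s n ^ r / fact r)"
        unfolding X_def distrib_right by (simp only: mult.assoc mult.commute mult.left_commute)
      then show ?thesis
        unfolding one alg[symmetric] diff by simp
    qed
    ultimately have "mean n + X n * (s n ^ r / fact r) \<le> cexp n r (p n) G" by linarith
    moreover have "z * (s n ^ r / fact r) \<le> (X n - \<delta> * (mean n * fact r / s n ^ r)) * (s n ^ r / fact r)"
      using elim(1) s by (intro mult_right_mono) auto
    moreover have "(X n - \<delta> * (mean n * fact r / s n ^ r)) * (s n ^ r / fact r) = X n * (s n ^ r / fact r) - \<delta> * mean n"
      unfolding left_diff_distrib using s by simp
    ultimately have ex: "z * (s n ^ r / fact r) \<le> cexp n r (p n) G - (1 + \<delta>) * mean n"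
      by (simp add: algebra_simps)
    have "mean n / 2 \<le> s n ^ r / fact r" using elim(2) s by (simp add: field_simps)
    then have "z * (mean n / 2) \<le> z * (s n ^ r / fact r)" using z by (intro mult_left_mono) auto
    then have "z * (mean n / 2) \<le> cexp n r (p n) G - (1 + \<delta>) * mean n" using ex by (rule order_trans)
    then have "p n ^ card G * (z * (mean n / 2)) \<le> p n ^ card G * (cexp n r (p n) G - (1 + \<delta>) * mean n)"
      by (rule mult_left_mono) (use par in simp)
    also have "\<dots> \<le> real (n choose r) * upper_tail_prob r n (p n) \<delta>"
      unfolding upper_tail_prob_eq using pl(1) par \<delta> mean by (intro prob_ge_of_planted) auto
    \<comment> \<open>As the mean is \<open>(n choose r) * p n ^ (r choose 2)\<close>, the binomial
      cancels and only \<open>r choose 2\<close> further factors \<open>p n\<close> are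
      lost.\<close>
    finally have "real (n choose r) * (p n ^ card G * (p n ^ (r choose 2) * (z / 2))) \<le> real (n choose r) * upper_tail_prob r n (p n) \<delta>"
      by (simp add: mean_def cexp_empty mult_ac)
    moreover have "real (n choose r) > 0" using mean par by (cases "n choose r = 0") (auto simp: mean_def cexp_empty)
    ultimately have "p n ^ card G * (p n ^ (r choose 2) * (z / 2)) \<le> upper_tail_prob r n (p n) \<delta>"
      using mult_le_cancel_left_pos by blast
    then have "ln (p n ^ card G * (p n ^ (r choose 2) * (z / 2))) \<le> ln (upper_tail_prob r n (p n) \<delta>)"
      using par z by (intro ln_mono) auto
    moreover have "ln (p n ^ card G * (p n ^ (r choose 2) * (z / 2))) = - (real (card G) * L n) - real (r choose 2) * L n + ln (z / 2)"
      using par z by (simp add: ln_mult ln_realpow L_def ln_div)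
    ultimately have "- ln (upper_tail_prob r n (p n) \<delta>) \<le> real (card G) * L n + real (r choose 2) * L n - ln (z / 2)" by linarith
    then have "log_tail_ratio r \<delta> p n \<le> (real (card G) * L n + real (r choose 2) * L n - ln (z / 2)) / (s n ^ 2 * L n)"
      unfolding log_tail_ratio_eq using s L by (intro divide_right_mono) auto
    also have "\<dots> = real (card G) / s n ^ 2 + real (r choose 2) / s n ^ 2 - ln (z / 2) / (s n ^ 2 * L n)"
      using s L by (simp add: add_divide_distrib diff_divide_distrib)
    also have "\<dots> \<le> U n" using edges by (simp add: U_def)
    finally show ?case using elim(3) by simp
  qed
qed

end

section \<open>The limits\<close>

text \<open>The lower bound is asked only for \<open>\<epsilon> < v\<close> because
  \<open>eventually_ratio_ge\<close> needs a positive rate.\<close>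

lemma tendsto_squeeze_epsilon:
  fixes f :: "nat \<Rightarrow> real"
  assumes "0 < v"
    and lo: "\<And>\<epsilon>. 0 < \<epsilon> \<Longrightarrow> \<epsilon> < v \<Longrightarrow> eventually (\<lambda>n. v - \<epsilon> \<le> f n) sequentially"
    and up: "\<And>\<epsilon>. 0 < \<epsilon> \<Longrightarrow> eventually (\<lambda>n. f n \<le> v + \<epsilon>) sequentially"
  shows "f \<longlonglongrightarrow> v"
proof (rule tendstoI)
  fix e :: real assume e: "0 < e"
  define \<epsilon> where "\<epsilon> = min (e / 2) (v / 2)"
  have \<epsilon>: "0 < \<epsilon>" "\<epsilon> < v" "\<epsilon> < e" using e \<open>0 < v\<close> by (auto simp: \<epsilon>_def)
  show "eventually (\<lambda>n. dist (f n) v < e) sequentially"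
    using lo[OF \<epsilon>(1,2)] up[OF \<epsilon>(1)] by eventually_elim (use \<epsilon>(3) in \<open>auto simp: dist_real_def\<close>)
qed

lemma obtain_smaller:
  fixes f :: "real \<Rightarrow> real"
  assumes "isCont f \<delta>" "0 < \<epsilon>" "0 < \<delta>"
  obtains x where "0 < x" "x < \<delta>" "f \<delta> - \<epsilon> < f x"
proof -
  have "(f \<longlongrightarrow> f \<delta>) (at_left \<delta>)"
    using assms(1) by (simp add: isCont_def filterlim_at_split)
  then have "eventually (\<lambda>x. f \<delta> - \<epsilon> < f x) (at_left \<delta>)"
    using assms(2) by (intro order_tendstoD(1)) auto
  moreover have "eventually (\<lambda>x. x \<in> {0<..<\<delta>}) (at_left \<delta>)"
    using assms(3) by (rule eventually_at_left_real)
  ultimately have "eventually (\<lambda>x. 0 < x \<and> x < \<delta> \<and> f \<delta> - \<epsilon> < f x) (at_left \<delta>)"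
    by eventually_elim auto
  then show ?thesis using that eventually_happens'[OF trivial_limit_at_left_real] by blast
qed

context clique_regime
begin

lemma root_clique_size:
  assumes "0 \<le> y"
  shows "(y powr (1 / real r)) ^ r = y" "(y powr (1 / real r)) ^ 2 = y powr (2 / real r)"
  using assms r powr_power[of y "1 / real r" r] powr_power[of y "1 / real r" 2]
  by (cases "y = 0"; simp)+

text \<open>Equality in the excess is allowed, where \<open>eventually_ratio_le\<close> needs a
  strict inequality: the clique's share is raised by \<open>e\<close>, and subadditivity of the
  power \<open>2 / r\<close> bounds the added cost by \<open>\<epsilon> / 2\<close>, even at
  \<open>y = 0\<close>.\<close>

lemma eventually_clique_ratio_le:
  fixes h d :: "nat \<Rightarrow> nat"
  assumes \<delta>: "0 < \<delta>" and y: "0 \<le> y"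
    and h: "(\<lambda>n. real (h n) / c n) \<longlonglongrightarrow> a"
    and d: "(\<lambda>n. real (d n choose (r - 1)) * fact (r - 1) / real n ^ (r - 1) / c n) \<longlonglongrightarrow> b"
    and d': "(\<lambda>n. real (d n) / real n / c n) \<longlonglongrightarrow> g"
    and room: "eventually (\<lambda>n. d n + h n + 1 \<le> n) sequentially"
    and large: "\<delta> \<le> y + real r * (a + b)" and \<epsilon>: "0 < \<epsilon>"
  shows "eventually (\<lambda>n. log_tail_ratio r \<delta> p n \<le> y powr (2 / real r) / 2 + a + g + \<epsilon>) sequentially"
proof -
  define e where "e = \<epsilon> powr (real r / 2)"
  have e: "0 < e" "e powr (2 / real r) = \<epsilon>" using \<epsilon> r by (auto simp: e_def powr_powr)
  define \<kappa> where "\<kappa> = (y + e) powr (1 / real r)"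
  have \<kappa>: "\<kappa> ^ r = y + e" "\<kappa> ^ 2 = (y + e) powr (2 / real r)"
    unfolding \<kappa>_def using y e by (intro root_clique_size; simp)+
  have "(y + e) powr (2 / real r) \<le> y powr (2 / real r) + e powr (2 / real r)"
    using y e r by (intro powr_subadditive) auto
  then have le: "\<kappa> ^ 2 / 2 \<le> y powr (2 / real r) / 2 + \<epsilon> / 2" using e \<kappa> by simp
  have "eventually (\<lambda>n. log_tail_ratio r \<delta> p n \<le> \<kappa> ^ 2 / 2 + a + g + \<epsilon> / 2) sequentially"
    by (rule eventually_ratio_le[OF \<delta> _ h d d' room]) (use \<kappa> e large \<epsilon> in \<open>auto simp: \<kappa>_def\<close>)
  then show ?thesis by eventually_elim (use le in linarith)
qed

lemma eventually_clique_only_ratio_le: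
  assumes "0 < \<delta>" "0 < \<epsilon>"
  shows "eventually (\<lambda>n. log_tail_ratio r \<delta> p n \<le> \<delta> powr (2 / real r) / 2 + \<epsilon>) sequentially"
proof -
  have "0 < r - 1" using r by simp
  then have "eventually (\<lambda>n. log_tail_ratio r \<delta> p n \<le> \<delta> powr (2 / real r) / 2 + 0 + 0 + \<epsilon>) sequentially"
    using assms eventually_ge_at_top[of 1]
    by (intro eventually_clique_ratio_le[where h = "\<lambda>_. 0" and d = "\<lambda>_. 0" and b = 0])
      (auto simp: binomial_eq_0 elim: eventually_mono)
  then show ?thesis by simp
qed

lemma r1: "1 \<le> real (r - 1)" "2 \<le> real (r - 1)"
  using r by simp_all

text \<open>For small \<open>c n\<close> hubs are too expensive: taking a fixed share of the excess
  from them costs at least \<open>sqrt (\<beta> * c n) / c n\<close>, which tends to infinity. So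
  the clique must supply almost all of it.\<close>

lemma ratio_tendsto_small:
  assumes \<delta>: "0 < \<delta>" and c0: "c \<longlonglongrightarrow> 0"
  shows "log_tail_ratio r \<delta> p \<longlonglongrightarrow> \<delta> powr (2 / real r) / 2"
proof (rule tendsto_squeeze_epsilon)
  fix \<epsilon> :: real assume \<epsilon>: "0 < \<epsilon>"
  show "eventually (\<lambda>n. log_tail_ratio r \<delta> p n \<le> \<delta> powr (2 / real r) / 2 + \<epsilon>) sequentially"
    using \<delta> \<epsilon> by (rule eventually_clique_only_ratio_le)
  have half: "0 < \<epsilon> / 2" using \<epsilon> by simp
  have C: "isCont (\<lambda>x. x powr (2 / real r) / 2) \<delta>" using \<delta> by (intro continuous_intros) auto
  obtain d'' where d'': "0 < d''" "d'' < \<delta>" "\<delta> powr (2 / real r) / 2 - \<epsilon> / 2 < d'' powr (2 / real r) / 2"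
    using obtain_smaller[OF C half \<delta>] by blast
  define d' where "d' = (d'' + \<delta>) / 2"
  have d': "0 < d'" "d'' < d'" "d' < \<delta>" using d'' by (auto simp: d'_def)
  define v where "v = d'' powr (2 / real r) / 2"
  have v: "0 < v" using d'' by (simp add: v_def)
  define \<beta> where "\<beta> = (d' - d'') / real r"
  have \<beta>: "\<beta> > 0" using d' r by (simp add: \<beta>_def)
  \<comment> \<open>The first bound gives \<open>v * c n \<le> sqrt (\<beta> * c n)\<close>; the
    second keeps \<open>\<beta> * c n\<close> below the first step of the staircase, where it is a
    pure power.\<close>
  have "eventually (\<lambda>n. c n < \<beta> / v ^ 2) sequentially" "eventually (\<lambda>n. c n < 1 / \<beta>) sequentially"
    using \<beta> v by (intro order_tendstoD(2)[OF c0]; simp)+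
  then have ev: "eventually (\<lambda>n. \<forall>y. 0 \<le> y \<longrightarrow> y \<le> d' \<longrightarrow> v \<le> rho r d' (c n) y) sequentially"
    using eventually_p
  proof eventually_elim
    case (elim n)
    have cp: "c n > 0" using elim c_pos by simp
    show ?case
    proof (intro allI impI)
      fix y assume y: "0 \<le> y" "y \<le> d'"
      have st: "0 \<le> stair (real (r - 1)) ((d' - y) * c n / real r)" using y cp by (intro stair_nonneg) simp
      show "v \<le> rho r d' (c n) y"
      proof (cases "d'' \<le> y")
        case True
        then have "v \<le> y powr (2 / real r) / 2" unfolding v_def using d'' by (intro divide_right_mono powr_mono2) auto
        moreover have "0 \<le> stair (real (r - 1)) ((d' - y) * c n / real r) / c n" using st cp by simp
        ultimately show ?thesis unfolding rho_def by linarith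
      next
        case False
        have t0: "0 < \<beta> * c n" "\<beta> * c n < 1" using \<beta> cp elim by (auto simp: field_simps)
        then have fl: "\<lfloor>\<beta> * c n\<rfloor> = 0" by (simp add: floor_eq_iff)
        have "(v * c n) ^ 2 \<le> \<beta> * c n"
        proof -
          have "c n * v ^ 2 \<le> \<beta>" using elim v by (simp add: field_simps)
          then have "c n * v ^ 2 * c n \<le> \<beta> * c n" using cp by (intro mult_right_mono) auto
          then show ?thesis by (simp add: power2_eq_square mult_ac)
        qed
        then have "v * c n \<le> (\<beta> * c n) powr (1 / 2)" using v cp t0 by (simp add: powr_half_sqrt real_le_rsqrt)
        also have "\<dots> \<le> (\<beta> * c n) powr (1 / real (r - 1))"
          using t0 r1 by (intro powr_mono') (auto simp: field_simps)
        also have "\<dots> = stair (real (r - 1)) (\<beta> * c n)" using fl by (simp add: stair_def frac_def)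
        also have "\<dots> \<le> stair (real (r - 1)) ((d' - y) * c n / real r)"
        proof (rule stair_mono[OF r1(1)])
          have "\<beta> * c n = (d' - d'') * c n / real r" by (simp add: \<beta>_def)
          also have "\<dots> \<le> (d' - y) * c n / real r" using False cp by (intro divide_right_mono mult_right_mono) auto
          finally show "\<beta> * c n \<le> (d' - y) * c n / real r" .
        qed
        finally have "v \<le> stair (real (r - 1)) ((d' - y) * c n / real r) / c n" using cp by (simp add: pos_le_divide_eq)
        moreover have "0 \<le> y powr (2 / real r) / 2" by simp
        ultimately show ?thesis unfolding rho_def by linarith
      qed
    qed
  qed
  from eventually_ratio_ge[OF d'(1,3) v half ev]
  show "eventually (\<lambda>n. \<delta> powr (2 / real r) / 2 - \<epsilon> \<le> log_tail_ratio r \<delta> p n) sequentially"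
    by eventually_elim (use d''(3) in \<open>simp add: v_def\<close>)
qed (use \<delta> in simp)

text \<open>For large \<open>c n\<close> the rounding of hubs is negligible and their cost is linear
  in their share, while the clique's cost is concave in its own. The sum is therefore smallest at an
  end: clique only or hubs only.\<close>

lemma ratio_tendsto_large:
  assumes \<delta>: "0 < \<delta>" and c0: "filterlim c at_top sequentially"
  shows "log_tail_ratio r \<delta> p \<longlonglongrightarrow> min (\<delta> powr (2 / real r) / 2) (\<delta> / real r)"
proof (rule tendsto_squeeze_epsilon)
  show "0 < min (\<delta> powr (2 / real r) / 2) (\<delta> / real r)" using \<delta> r by simp
  fix \<epsilon> :: real assume \<epsilon>: "0 < \<epsilon>"
  have hubs: "eventually (\<lambda>n. log_tail_ratio r \<delta> p n \<le> \<delta> / real r + \<epsilon>) sequentially"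
  proof -
    define h where "h = (\<lambda>n. nat \<lceil>\<delta> / real r * c n\<rceil>)"
    have cev: "eventually (\<lambda>n. c n > 0) sequentially" using eventually_p by eventually_elim (auto intro: c_pos)
    have h_le: "real (h n) \<le> \<delta> / real r * c n + 1" if "c n > 0" for n
    proof -
      have "0 \<le> \<delta> / real r * c n" using that \<delta> by simp
      then have "real (h n) = of_int \<lceil>\<delta> / real r * c n\<rceil>" by (simp add: h_def)
      then show ?thesis by linarith
    qed
    have hl: "(\<lambda>n. real (h n) / c n) \<longlonglongrightarrow> \<delta> / real r"
    proof (rule tendsto_sandwich)
      show "eventually (\<lambda>n. \<delta> / real r \<le> real (h n) / c n) sequentially"
        using cev
      proof eventually_elim
        case (elim n)
        then show ?case using real_nat_ceiling_ge[of "\<delta> / real r * c n"] by (simp add: pos_le_divide_eq h_def)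
      qed
      show "eventually (\<lambda>n. real (h n) / c n \<le> \<delta> / real r + 1 / c n) sequentially"
        using cev
      proof eventually_elim
        case (elim n)
        have "real (h n) / c n \<le> (\<delta> / real r * c n + 1) / c n" using h_le elim by (intro divide_right_mono) auto
        then show ?case using elim by (simp add: add_divide_distrib)
      qed
      have "(\<lambda>n. 1 / c n) \<longlonglongrightarrow> 0"
        by (rule tendsto_divide_0[OF tendsto_const filterlim_at_top_imp_at_infinity[OF c0]])
      from tendsto_add[OF tendsto_const this] show "(\<lambda>n. \<delta> / real r + 1 / c n) \<longlonglongrightarrow> \<delta> / real r" by simp
    qed (rule tendsto_const)
    have "(\<lambda>n. \<delta> / real r * p n ^ (r - 1) + 2 * (1 / real n)) \<longlonglongrightarrow> \<delta> / real r * 0 + 2 * 0"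
    proof (intro tendsto_add tendsto_mult tendsto_const p_power_tendsto_0)
      show "(\<lambda>n. 1 / real n) \<longlonglongrightarrow> 0" by real_asymp
    qed (use r in simp)
    then have "eventually (\<lambda>n. \<delta> / real r * p n ^ (r - 1) + 2 * (1 / real n) < 1) sequentially"
      by (intro order_tendstoD(2)) auto
    then have room: "eventually (\<lambda>n. 0 + h n + 1 \<le> n) sequentially"
      using eventually_p
    proof eventually_elim
      case (elim n)
      have cp: "c n > 0" using elim c_pos by simp
      have "\<delta> / real r * c n + 2 = (\<delta> / real r * p n ^ (r - 1) + 2 * (1 / real n)) * real n"
        using elim by (simp add: c_def algebra_simps)
      also have "\<dots> \<le> 1 * real n" using elim by (intro mult_right_mono) auto
      finally have "real (h n) + 1 \<le> real n" using h_le[OF cp] by simp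
      then show ?case by linarith
    qed
    have r0: "0 < r - 1" using r by simp
    have "eventually (\<lambda>n. log_tail_ratio r \<delta> p n \<le> 0 powr (2 / real r) / 2 + \<delta> / real r + 0 + \<epsilon>) sequentially"
      by (rule eventually_clique_ratio_le[OF \<delta> order.refl hl _ _ room _ \<epsilon>, where b = 0])
        (use r r0 \<epsilon> in \<open>auto simp: binomial_eq_0\<close>)
    then show ?thesis by simp
  qed
  show "eventually (\<lambda>n. log_tail_ratio r \<delta> p n \<le> min (\<delta> powr (2 / real r) / 2) (\<delta> / real r) + \<epsilon>) sequentially"
    using hubs eventually_clique_only_ratio_le[OF \<delta> \<epsilon>] by eventually_elim auto
  have half: "0 < \<epsilon> / 2" using \<epsilon> by simp
  have C: "isCont (\<lambda>x. min (x powr (2 / real r) / 2) (x / real r)) \<delta>" using \<delta> r by (intro continuous_intros) auto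
  obtain d' where d': "0 < d'" "d' < \<delta>"
    "min (\<delta> powr (2 / real r) / 2) (\<delta> / real r) - \<epsilon> / 2 < min (d' powr (2 / real r) / 2) (d' / real r)"
    using obtain_smaller[OF C half \<delta>] by blast
  define v where "v = min (d' powr (2 / real r) / 2) (d' / real r)"
  have v: "0 < v" using d' r by (simp add: v_def)
  have ev: "eventually (\<lambda>n. \<forall>y. 0 \<le> y \<longrightarrow> y \<le> d' \<longrightarrow> v \<le> rho r d' (c n) y) sequentially"
    using eventually_p
  proof eventually_elim
    case (elim n)
    have cp: "c n > 0" using elim c_pos by simp
    show ?case
    proof (intro allI impI)
      fix y assume y: "0 \<le> y" "y \<le> d'"
      \<comment> \<open>The position of \<open>y\<close> between the two ends;
        \<open>l \<le> l powr (2 / r)\<close> puts the clique's cost above the chord.\<close>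
      define l where "l = y / d'"
      have l: "0 \<le> l" "l \<le> 1" "y = l * d'" using y d' by (auto simp: l_def)
      have "l \<le> l powr (2 / real r)" using l r by (intro le_powr_self) auto
      then have "l * d' powr (2 / real r) \<le> y powr (2 / real r)"
        unfolding l(3) using l d' by (simp add: powr_mult mult_right_mono)
      moreover have "(d' - y) / real r \<le> stair (real (r - 1)) ((d' - y) * c n / real r) / c n"
      proof -
        have "(d' - y) * c n / real r \<le> stair (real (r - 1)) ((d' - y) * c n / real r)" by (rule stair_ge[OF r1(1)])
        then show ?thesis using cp by (simp add: pos_le_divide_eq)
      qed
      moreover have "l * v + (1 - l) * v \<le> l * (d' powr (2 / real r) / 2) + (1 - l) * (d' / real r)"
      proof (intro add_mono mult_left_mono)
        show "v \<le> d' powr (2 / real r) / 2" "v \<le> d' / real r"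
          unfolding v_def by (rule min.cobounded1, rule min.cobounded2)
      qed (use l in auto)
      moreover have "(1 - l) * (d' / real r) = (d' - y) / real r" using l(3) by (simp add: algebra_simps diff_divide_distrib)
      moreover have "l * v + (1 - l) * v = v" by (simp add: algebra_simps)
      moreover have "l * (d' powr (2 / real r) / 2) = l * d' powr (2 / real r) / 2" by simp
      ultimately show "v \<le> rho r d' (c n) y" unfolding rho_def by linarith
    qed
  qed
  from eventually_ratio_ge[OF d'(1,2) v half ev]
  show "eventually (\<lambda>n. min (\<delta> powr (2 / real r) / 2) (\<delta> / real r) - \<epsilon> \<le> log_tail_ratio r \<delta> p n) sequentially"
    by eventually_elim (use d'(3)[folded v_def] in linarith)
qed

lemma phi_le_rho:
  assumes "0 < \<delta>" "0 < C" "0 \<le> y" "y \<le> \<delta>"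
  shows "phi r \<delta> C \<le> rho r \<delta> C y"
proof -
  obtain x where x: "phi r \<delta> C = psi r \<delta> C x" "\<forall>y\<in>{0..1}. psi r \<delta> C x \<le> psi r \<delta> C y"
    using phi_is_minimum[OF r assms(1,2)] by blast
  have "1 - y / \<delta> \<in> {0..1}" using assms by auto
  then have "phi r \<delta> C \<le> psi r \<delta> C (1 - y / \<delta>)" using x by simp
  also have "\<delta> * (1 - (1 - y / \<delta>)) = y" "(1 - y / \<delta>) * \<delta> * C / real r = (\<delta> - y) * C / real r"
    using assms by (simp_all add: left_diff_distrib)
  then have "psi r \<delta> C (1 - y / \<delta>) = rho r \<delta> C y"
    by (simp only: psi_def rho_def stair_def r_real)
  finally show ?thesis .
qed

text \<open>At \<open>x = 0\<close> the clique term is positive; otherwise the staircase is at least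
  its positive argument.\<close>

lemma phi_pos:
  assumes "0 < \<delta>" "0 < C"
  shows "0 < phi r \<delta> C"
proof -
  obtain x where x: "x \<in> {0..1}" "phi r \<delta> C = psi r \<delta> C x"
    using phi_is_minimum[OF r assms] by blast
  have st: "psi r \<delta> C x = (\<delta> * (1 - x)) powr (2 / real r) / 2 + stair (real (r - 1)) (x * \<delta> * C / real r) / C"
    by (simp only: psi_def stair_def r_real)
  have ge: "x * \<delta> * C / real r \<le> stair (real (r - 1)) (x * \<delta> * C / real r)" by (rule stair_ge[OF r1(1)])
  have "0 < psi r \<delta> C x"
  proof (cases "x = 0")
    case True
    have "0 \<le> stair (real (r - 1)) 0 / C" using assms by (intro divide_nonneg_pos stair_nonneg) auto
    then show ?thesis unfolding st using True assms by (simp add: add_pos_nonneg)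
  next
    case False
    then have "0 < x * \<delta> * C / real r" using x assms r by simp
    then have "0 < stair (real (r - 1)) (x * \<delta> * C / real r)" using ge by linarith
    then show ?thesis unfolding st using assms by (intro add_nonneg_pos) auto
  qed
  then show ?thesis using x by simp
qed

text \<open>The staircase function has modulus of continuity \<open>u powr (1 / (r - 1))\<close>.\<close>

lemma phi_le_rho_perturbed:
  assumes d: "0 < d'" "d' < \<delta>" and C: "0 < C" and x: "0 < x" and y: "0 \<le> y" "y \<le> d'"
  defines "u \<equiv> ((\<delta> - d') * C + \<delta> * \<bar>C - x\<bar>) / real r"
  assumes u: "u \<le> 1"
  shows "phi r \<delta> C \<le> rho r d' x y + (u powr (1 / real (r - 1)) / C + (\<delta> * x / real r + 1) * \<bar>1 / C - 1 / x\<bar>)"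
proof -
  define q where "q = real (r - 1)"
  define t where "t = (d' - y) * x / real r"
  have t: "0 \<le> t" using y x by (simp add: t_def)
  have u0: "0 \<le> u" using d C by (simp add: u_def)
  \<comment> \<open>The argument of the staircase for \<open>(\<delta>, C)\<close> exceeds that for
    \<open>(d', x)\<close> by at most \<open>u\<close>, uniformly in \<open>y\<close>.\<close>
  have "(\<delta> - y) * C = (d' - y) * x + ((\<delta> - d') * C + (d' - y) * (C - x))" by (simp add: algebra_simps)
  also have "\<dots> \<le> (d' - y) * x + ((\<delta> - d') * C + \<delta> * \<bar>C - x\<bar>)"
  proof -
    have "(d' - y) * (C - x) \<le> (d' - y) * \<bar>C - x\<bar>" using y by (intro mult_left_mono) auto
    also have "\<dots> \<le> \<delta> * \<bar>C - x\<bar>" using y d by (intro mult_right_mono) auto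
    finally show ?thesis by simp
  qed
  finally have "(\<delta> - y) * C / real r \<le> ((d' - y) * x + ((\<delta> - d') * C + \<delta> * \<bar>C - x\<bar>)) / real r"
    by (intro divide_right_mono) auto
  then have "(\<delta> - y) * C / real r \<le> t + u" by (simp add: t_def u_def add_divide_distrib)
  then have "stair q ((\<delta> - y) * C / real r) \<le> stair q (t + u)" unfolding q_def by (intro stair_mono r1)
  also have "\<dots> \<le> stair q t + u powr (1 / q)" unfolding q_def using u0 u by (intro stair_add_le r1)
  finally have "stair q ((\<delta> - y) * C / real r) / C \<le> (stair q t + u powr (1 / q)) / C"
    using C by (intro divide_right_mono) auto
  also have "\<dots> = stair q t / x + stair q t * (1 / C - 1 / x) + u powr (1 / q) / C"
    by (simp add: add_divide_distrib right_diff_distrib)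
  also have "stair q t * (1 / C - 1 / x) \<le> (\<delta> * x / real r + 1) * \<bar>1 / C - 1 / x\<bar>"
  proof -
    have "stair q t \<le> t + 1" unfolding q_def by (rule stair_le[OF r1(1)])
    moreover have "t \<le> \<delta> * x / real r" unfolding t_def using y d x by (intro divide_right_mono mult_right_mono) auto
    ultimately have "stair q t * \<bar>1 / C - 1 / x\<bar> \<le> (\<delta> * x / real r + 1) * \<bar>1 / C - 1 / x\<bar>"
      by (intro mult_right_mono) auto
    moreover have "stair q t * (1 / C - 1 / x) \<le> stair q t * \<bar>1 / C - 1 / x\<bar>"
      using stair_nonneg[OF t] by (intro mult_left_mono) auto
    ultimately show ?thesis by linarith
  qed
  finally have "stair q ((\<delta> - y) * C / real r) / C
      \<le> stair q t / x + (\<delta> * x / real r + 1) * \<bar>1 / C - 1 / x\<bar> + u powr (1 / q) / C" by simp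
  moreover have "phi r \<delta> C \<le> rho r \<delta> C y" using d y C by (intro phi_le_rho) auto
  ultimately show ?thesis unfolding rho_def q_def t_def by linarith
qed

text \<open>For the upper bound a minimiser \<open>x\<close> of \<open>psi\<close> dictates the
  planted graph. For the lower bound \<open>rho r d' (c n)\<close> is compared with
  \<open>phi r \<delta> C\<close> uniformly in \<open>y\<close>; a modulus of continuity is needed
  because the staircase is not Lipschitz to the right of an integer.\<close>

lemma ratio_tendsto_critical:
  assumes \<delta>: "0 < \<delta>" and C: "0 < C" and c0: "c \<longlonglongrightarrow> C"
  shows "log_tail_ratio r \<delta> p \<longlonglongrightarrow> phi r \<delta> C"
proof (rule tendsto_squeeze_epsilon)
  show "0 < phi r \<delta> C" using \<delta> C by (rule phi_pos)
  fix \<epsilon> :: real assume \<epsilon>: "0 < \<epsilon>"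
  obtain x where x: "x \<in> {0..1}" "phi r \<delta> C = psi r \<delta> C x"
    using phi_is_minimum[OF r \<delta> C] by blast
  define t where "t = x * \<delta> * C / real r"
  have t: "0 \<le> t" using x \<delta> C by (simp add: t_def)
  \<comment> \<open>A partial hub of relative degree \<open>\<theta>\<close> is worth exactly
    \<open>frac t\<close> of a full one. That \<open>\<theta>\<close> is strictly below 1 leaves
    room for the hubs among the \<open>n\<close> vertices.\<close>
  define \<theta> where "\<theta> = frac t powr (1 / real (r - 1))"
  have \<theta>: "0 \<le> \<theta>" "\<theta> < 1" "\<theta> ^ (r - 1) = frac t"
  proof -
    show "0 \<le> \<theta>" by (simp add: \<theta>_def)
    have "frac t powr (1 / real (r - 1)) < 1 powr (1 / real (r - 1))"
      using r1 frac_lt_1[of t] by (intro powr_less_mono2) auto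
    then show "\<theta> < 1" by (simp add: \<theta>_def)
    show "\<theta> ^ (r - 1) = frac t"
    proof (cases "frac t = 0")
      case True
      show ?thesis unfolding \<theta>_def True using r by simp
    next
      case False
      then show ?thesis
        using r powr_power[of "frac t" "1 / real (r - 1)" "r - 1"] by (simp add: \<theta>_def)
    qed
  qed
  define h where "h = nat \<lfloor>t\<rfloor>"
  have h: "real h = of_int \<lfloor>t\<rfloor>" using t by (simp add: h_def)
  define d where "d = (\<lambda>n. nat \<lfloor>\<theta> * real n\<rfloor>)"
  have d: "(\<lambda>n. real (d n) / real n) \<longlonglongrightarrow> \<theta>"
      "(\<lambda>n. real (d n choose (r - 1)) * fact (r - 1) / real n ^ (r - 1)) \<longlonglongrightarrow> frac t"
    unfolding d_def \<theta>(3)[symmetric] using nat_floor_proportion[OF \<theta>(1), of "r - 1"] r by simp_all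
  have C0: "C \<noteq> 0" using C by simp
  have "eventually (\<lambda>n. log_tail_ratio r \<delta> p n \<le> (\<delta> * (1 - x)) powr (2 / real r) / 2 + real h / C + \<theta> / C + \<epsilon>) sequentially"
  proof (rule eventually_clique_ratio_le[OF \<delta>])
    show "0 \<le> \<delta> * (1 - x)" using x \<delta> by simp
    show "(\<lambda>n. real h / c n) \<longlonglongrightarrow> real h / C" by (intro tendsto_divide tendsto_const c0 C0)
    show "(\<lambda>n. real (d n choose (r - 1)) * fact (r - 1) / real n ^ (r - 1) / c n) \<longlonglongrightarrow> frac t / C"
      by (intro tendsto_divide[OF d(2) c0 C0])
    show "(\<lambda>n. real (d n) / real n / c n) \<longlonglongrightarrow> \<theta> / C" by (rule tendsto_divide[OF d(1) c0 C0])
    have "(\<lambda>n. real (h + 1) / real n) \<longlonglongrightarrow> 0" by real_asymp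
    from tendsto_add[OF d(1) this] have "eventually (\<lambda>n. real (d n) / real n + real (h + 1) / real n < 1) sequentially"
      using \<theta> by (intro order_tendstoD(2)) auto
    then show "eventually (\<lambda>n. d n + h + 1 \<le> n) sequentially"
      using eventually_gt_at_top[of 0]
    proof eventually_elim
      case (elim n)
      then have "(real (d n) + real (h + 1)) / real n < 1" by (simp only: add_divide_distrib)
      then show ?case using elim by (simp add: divide_less_eq)
    qed
    have "real h / C + frac t / C = t / C" by (simp add: h frac_def diff_divide_distrib)
    then have "real r * (real h / C + frac t / C) = x * \<delta>" using r C by (simp add: t_def)
    then show "\<delta> \<le> \<delta> * (1 - x) + real r * (real h / C + frac t / C)" by (simp add: algebra_simps)
  qed (rule \<epsilon>)
  moreover have "phi r \<delta> C = (\<delta> * (1 - x)) powr (2 / real r) / 2 + real h / C + \<theta> / C"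
    unfolding x(2) psi_def h \<theta>_def t_def r_real by (simp add: add_divide_distrib)
  ultimately show "eventually (\<lambda>n. log_tail_ratio r \<delta> p n \<le> phi r \<delta> C + \<epsilon>) sequentially" by simp
  assume \<epsilon>2: "\<epsilon> < phi r \<delta> C"
  define q where "q = real (r - 1)"
  have q: "q \<ge> 2" using r1 by (simp add: q_def)
  \<comment> \<open>The three bounds keep \<open>d'\<close> positive, bring the limit of
    \<open>u\<close> down to at most \<open>1 / 2\<close>, and make the limit of \<open>Er\<close>
    at most \<open>\<epsilon> / 4\<close>.\<close>
  define e where "e = min (\<delta> / 2) (min (real r / (2 * C)) (real r / C * (C * \<epsilon> / 4) powr q))"
  have e: "0 < e" "e < \<delta>" "e * C / real r \<le> 1 / 2" "(e * C / real r) powr (1 / q) / C \<le> \<epsilon> / 4"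
  proof -
    show "0 < e" using \<delta> C r \<epsilon> by (simp add: e_def)
    have "e \<le> \<delta> / 2" unfolding e_def by (rule min.cobounded1)
    then show "e < \<delta>" using \<delta> by linarith
    have "e * C / real r \<le> real r / (2 * C) * C / real r"
      using C by (intro divide_right_mono mult_right_mono) (auto simp: e_def)
    then show "e * C / real r \<le> 1 / 2" using C r by simp
    have "e * C / real r \<le> real r / C * (C * \<epsilon> / 4) powr q * C / real r"
      using C by (intro divide_right_mono mult_right_mono) (auto simp: e_def)
    also have "\<dots> = (C * \<epsilon> / 4) powr q" using C r by simp
    finally have "(e * C / real r) powr (1 / q) \<le> ((C * \<epsilon> / 4) powr q) powr (1 / q)"
      using C \<open>0 < e\<close> q by (intro powr_mono2) auto
    also have "\<dots> = C * \<epsilon> / 4" using q C \<epsilon> by (simp add: powr_powr)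
    finally show "(e * C / real r) powr (1 / q) / C \<le> \<epsilon> / 4" using C by (simp add: field_simps)
  qed
  define d' where "d' = \<delta> - e"
  have d': "0 < d'" "d' < \<delta>" using e by (auto simp: d'_def)
  define u where "u = (\<lambda>n. ((\<delta> - d') * C + \<delta> * \<bar>C - c n\<bar>) / real r)"
  have "u \<longlonglongrightarrow> ((\<delta> - d') * C + \<delta> * \<bar>C - C\<bar>) / real r"
    unfolding u_def using r by (intro tendsto_intros c0) auto
  then have u: "u \<longlonglongrightarrow> e * C / real r" by (simp add: d'_def)
  define Er where "Er = (\<lambda>n. u n powr (1 / q) / C + (\<delta> * c n / real r + 1) * \<bar>1 / C - 1 / c n\<bar>)"
  have "Er \<longlonglongrightarrow> (e * C / real r) powr (1 / q) / C + (\<delta> * C / real r + 1) * \<bar>1 / C - 1 / C\<bar>"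
    unfolding Er_def using r e C by (intro tendsto_intros tendsto_powr u c0) auto
  then have Er_lim: "Er \<longlonglongrightarrow> (e * C / real r) powr (1 / q) / C" by simp
  have ev_Er: "eventually (\<lambda>n. Er n < \<epsilon> / 2) sequentially"
    by (rule order_tendstoD(2)[OF Er_lim]) (use e(4) \<epsilon> in linarith)
  have ev_u: "eventually (\<lambda>n. u n < 1) sequentially" 
    by (rule order_tendstoD(2)[OF u]) (use e(3) in linarith)
  have ev: "eventually (\<lambda>n. \<forall>y. 0 \<le> y \<longrightarrow> y \<le> d' \<longrightarrow> phi r \<delta> C - \<epsilon> / 2 \<le> rho r d' (c n) y) sequentially"
    using ev_Er ev_u eventually_p
  proof eventually_elim
    case (elim n)
    have cp: "c n > 0" using elim c_pos by simp
    show ?case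
    proof (intro allI impI)
      fix y assume y: "0 \<le> y" "y \<le> d'"
      have "phi r \<delta> C \<le> rho r d' (c n) y + Er n"
        unfolding Er_def u_def q_def
        by (rule phi_le_rho_perturbed[OF d' C cp y]) (use elim in \<open>simp add: u_def\<close>)
      then show "phi r \<delta> C - \<epsilon> / 2 \<le> rho r d' (c n) y" using elim by linarith
    qed
  qed
  have v: "0 < phi r \<delta> C - \<epsilon> / 2" using \<epsilon> \<epsilon>2 by linarith
  have "0 < \<epsilon> / 2" using \<epsilon> by simp
  from eventually_ratio_ge[OF d' v this ev]
  show "eventually (\<lambda>n. phi r \<delta> C - \<epsilon> \<le> log_tail_ratio r \<delta> p n) sequentially"
    by eventually_elim simp
qed

end

theorem theorem1p7:
  fixes r :: nat and \<delta> :: real and p :: "nat \<Rightarrow> real"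
  assumes "r \<ge> 3"
    and "\<delta> > 0"
    and "\<And>n. 0 \<le> p n \<and> p n \<le> 1"
    and "(\<lambda>n. ln (real n) powr (1 / (real r - 2)) / real n)
           \<in> o(\<lambda>n. p n powr ((real r - 1) / 2))"
    and "(\<lambda>n. p n powr ((real r - 1) / 2)) \<in> o(\<lambda>_. 1)"
  shows "((\<lambda>n. real n * p n ^ (r - 1)) \<longlonglongrightarrow> 0
            \<longrightarrow> log_tail_ratio r \<delta> p \<longlonglongrightarrow> \<delta> powr (2 / real r) / 2)
       \<and> (\<forall>c>0. (\<lambda>n. real n * p n ^ (r - 1)) \<longlonglongrightarrow> c
            \<longrightarrow> log_tail_ratio r \<delta> p \<longlonglongrightarrow> phi r \<delta> c)
       \<and> (filterlim (\<lambda>n. real n * p n ^ (r - 1)) at_top sequentially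
            \<longrightarrow> log_tail_ratio r \<delta> p \<longlonglongrightarrow> min (\<delta> powr (2 / real r) / 2) (\<delta> / real r))"
proof -
  interpret clique_regime r p
    by (rule clique_regime.intro) (fact assms)+
  have "(\<lambda>n. real n * p n ^ (r - 1)) = c" by (simp add: fun_eq_iff c_def)
  then show ?thesis
    using ratio_tendsto_small ratio_tendsto_critical ratio_tendsto_large assms(2) by simp
qed

end
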